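(* Suppose that the assumption on $W$ and the $L_f$-smoothness assumption on $f_1,\dots,f_n$ stated in the context hold. Let $\{\mathbf x_k\}$ be generated by the DPRGC algorithm (see context) with step sizes $\gamma=C_\gamma\alpha$ and $\eta=C_\eta\gamma\rho/L$, where $\rho=1-\sigma_2$ and $C_\gamma,C_\eta>0$. For sufficiently small $C_\gamma$ and $C_\eta$ (with the smallness of $C_\eta$ allowed to depend on $C_\gamma$), there exist constants $c\in(0,1)$ and $M>0$, independent of $K$, such that for all $K\ge 1$ $$\frac1K\sum_{k=1}^K\|\hat g_k\|^2\le\frac{f(\mathbf x_0)-\inf_{\mathbf x\in\mathcal M^n}f(\mathbf x)+M}{cK},\qquad \hat g_k:=\frac1n\sum_{i=1}^n\mathrm{grad} f_i(x_{i,k}).$$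
   Context: Manifold. $\mathcal M\subset\mathbb R^{d\times r}$ is a compact smooth embedded submanifold with the Euclidean metric; $\|\cdot\|$ is the Euclidean (Frobenius) norm; $\mathcal P_{\mathcal M}(x)=\arg\min_{y\in\mathcal M}\|y-x\|$ (any nearest point where not unique); $\mathcal P_{T_x\mathcal M}$ is the orthogonal projection onto the tangent space; $\mathrm{grad}\,h(x)=\mathcal P_{T_x\mathcal M}(\nabla h(x))$ is the Riemannian gradient. $\mathcal M$ is $R$-proximally smooth, $R>0$: $\mathcal P_{\mathcal M}(x)$ is a singleton whenever the distance from $x$ to $\mathcal M$ is less than $R$. Stacked notation. $\mathbf x=[x_1^\top,\dots,x_n^\top]^\top\in\mathbb R^{nd\times r}$; $\hat x=\frac1n\sum_i x_i$; $\bar x\in\mathcal P_{\mathcal M}(\hat x)$; $\bar{\mathbf x}$ is $n$ stacked copies of $\bar x$; $\mathcal N(\delta)=\{\mathbf x\in\mathcal M^n:\|\mathbf x-\bar{\mathbf x}\|\le\delta\}$. $\mathcal P_{\mathcal M^n}$ and $\mathcal P_{T_{\mathbf x}\mathcal M^n}$ act blockwise. $f(\mathbf x)=\frac1n\sum_{i=1}^n f_i(x_i)$. In the algorithm, $\mathrm{grad} f(\mathbf x)$ denotes the stack $[\mathrm{grad} f_1(x_1)^\top,\dots,\mathrm{grad} f_n(x_n)^\top]^\top$. $\mathbf W=W\otimes I_d$. Assumption on $W\in\mathbb R^{n\times n}$ (mixing matrix of an undirected network): $W$ is doubly stochastic, $W=W^\top$; $W_{ij}\ge0$, $0<W_{ii}<1$;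 eigenvalues in $(-1,1]$; second largest singular value $\sigma_2\in[0,1)$. Smoothness assumption: each $f_i:\mathbb R^{d\times r}\to\mathbb R$ satisfies $\|\nabla f_i(x)-\nabla f_i(y)\|\le L_f\|x-y\|$ for all $x,y$. Put $L_g=\max_i\max_{x\in\mathcal M}\|\nabla f_i(x)\|$, let $L_{\mathcal P}$ be the Lipschitz constant of $x\mapsto\mathcal P_{T_x\mathcal M}$ on $\mathcal M$, and $L=\max\{L_f+\frac1RL_g,\ L_f+L_gL_{\mathcal P}\}$, assumed positive. Compression operator: $\mathcal C:\mathbb R^{nd\times r}\to\mathbb R^{nd\times r}$ satisfies $\|\mathcal C(\mathbf x)-\mathbf x\|^2\le(1-\alpha)\|\mathbf x\|^2$ for all $\mathbf x$, with a constant $0<\alpha\le1$. DPRGC algorithm, with step sizes $\eta>0$, $\gamma\in(0,1]$. Initialize $\mathbf x_0\in\mathcal N(\delta)$ with $\delta<\min\{R\gamma(1-\sigma_2),\frac R4\}$, $\tilde{\mathbf x}_0=\mathbf x_0$, $\mathbf s_0=\mathbf W\mathbf x_0$, $\mathbf d_0=\mathrm{grad} f(\mathbf x_0)$, $\tilde{\mathbf d}_0=\mathbf d_0$, $\mathbf u_0=\mathbf W\mathbf d_0$. For $k=0,1,2,\dots$: $\mathbf x_{k+1}=\mathcal P_{\mathcal M^n}(\mathbf x_k+\gamma(\mathbf s_k-\tilde{\mathbf x}_k)-\eta\mathcal P_{T_{\mathbf x_k}\mathcal M^n}(\mathbf d_k))$; $\mathbf q_{k+1}=\mathcal C(\mathbf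 x_{k+1}-\tilde{\mathbf x}_k)$, $\tilde{\mathbf x}_{k+1}=\tilde{\mathbf x}_k+\mathbf q_{k+1}$, $\mathbf s_{k+1}=\mathbf s_k+\mathbf W\mathbf q_{k+1}$; $\mathbf d_{k+1}=\mathbf d_k+\gamma(\mathbf u_k-\tilde{\mathbf d}_k)+\mathrm{grad} f(\mathbf x_{k+1})-\mathrm{grad} f(\mathbf x_k)$; $\mathbf p_{k+1}=\mathcal C(\mathbf d_{k+1}-\tilde{\mathbf d}_k)$, $\tilde{\mathbf d}_{k+1}=\tilde{\mathbf d}_k+\mathbf p_{k+1}$, $\mathbf u_{k+1}=\mathbf u_k+\mathbf W\mathbf p_{k+1}$. *)

theory Defs
  imports "HOL-Analysis.Analysis" "HOL-Library.Multiset"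
begin

primrec Ck_on :: "nat \<Rightarrow> 'a::euclidean_space set \<Rightarrow> ('a \<Rightarrow> 'b::euclidean_space) \<Rightarrow> bool" where
  "Ck_on 0 U f \<longleftrightarrow> continuous_on U f"
| "Ck_on (Suc k) U f \<longleftrightarrow> (\<forall>x\<in>U. f differentiable (at x)) \<and>
     (\<forall>v. Ck_on k U (\<lambda>x. frechet_derivative f (at x) v))"

text \<open>Only used on open sets.\<close>

definition smooth_on :: "'a::euclidean_space set \<Rightarrow> ('a \<Rightarrow> 'b::euclidean_space) \<Rightarrow> bool" where
  "smooth_on U f \<longleftrightarrow> (\<forall>k. Ck_on k U f)"

text \<open>Slice charts: around each of its points the set is flattened onto an \<open>m\<close>-dimensional linear
  subspace by a diffeomorphism between open subsets of the ambient space.\<close>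

definition embedded_submanifold :: "nat \<Rightarrow> 'a::euclidean_space set \<Rightarrow> bool" where
  "embedded_submanifold m M \<longleftrightarrow>
     (\<forall>x\<in>M. \<exists>U V (\<phi>::'a \<Rightarrow> 'a) (\<psi>::'a \<Rightarrow> 'a) S.
        open U \<and> x \<in> U \<and> open V \<and> homeomorphism U V \<phi> \<psi> \<and>
        smooth_on U \<phi> \<and> smooth_on V \<psi> \<and>
        subspace S \<and> dim S = m \<and> \<phi> ` (U \<inter> M) = V \<inter> S)"

definition tangent_space :: "'a::euclidean_space set \<Rightarrow> 'a \<Rightarrow> 'a set" where
  "tangent_space M x =
     {v. \<exists>(c::real \<Rightarrow> 'a) e. e > 0 \<and> smooth_on {-e<..<e} c \<and> c ` {-e<..<e} \<subseteq> M \<and>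
         c 0 = x \<and> (c has_vector_derivative v) (at 0)}"

definition orth_proj :: "'a::euclidean_space set \<Rightarrow> 'a \<Rightarrow> 'a" where
  "orth_proj S v = (THE p. p \<in> S \<and> (\<forall>w\<in>S. (v - p) \<bullet> w = 0))"

definition proj_tan :: "'a::euclidean_space set \<Rightarrow> 'a \<Rightarrow> 'a \<Rightarrow> 'a" where
  "proj_tan M x = orth_proj (tangent_space M x)"

definition gradient :: "('a::euclidean_space \<Rightarrow> real) \<Rightarrow> 'a \<Rightarrow> 'a" where
  "gradient h x = (THE D. GDERIV h x :> D)"

definition rgrad :: "'a::euclidean_space set \<Rightarrow> ('a \<Rightarrow> real) \<Rightarrow> 'a \<Rightarrow> 'a" where
  "rgrad M h x = proj_tan M x (gradient h x)"

text \<open>The metric projection is set-valued: \<open>nearest M x\<close> consists of all nearest points.\<close>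

definition nearest :: "'a::euclidean_space set \<Rightarrow> 'a \<Rightarrow> 'a set" where
  "nearest M x = {y. is_arg_min (\<lambda>y. norm (y - x)) (\<lambda>y. y \<in> M) y}"

text \<open>As \<open>infdist x {} = 0\<close>, this forces \<open>M\<close> to be nonempty.\<close>

definition proximally_smooth :: "real \<Rightarrow> 'a::euclidean_space set \<Rightarrow> bool" where
  "proximally_smooth R M \<longleftrightarrow> R > 0 \<and> (\<forall>x. infdist x M < R \<longrightarrow> is_singleton (nearest M x))"

text \<open>Lipschitz continuity of \<open>x \<mapsto> P\<^bsub>T\<^sub>xM\<^esub>\<close> on \<open>M\<close> with respect to the operator norm.\<close>

definition proj_tan_lipschitz :: "real \<Rightarrow> 'a::euclidean_space set \<Rightarrow> bool" where
  "proj_tan_lipschitz LP M \<longleftrightarrow> 0 \<le> LP \<and>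
     (\<forall>x\<in>M. \<forall>y\<in>M. onorm (\<lambda>v. proj_tan M x v - proj_tan M y v) \<le> LP * norm (x - y))"

definition doubly_stochastic :: "real^'n^'n \<Rightarrow> bool" where
  "doubly_stochastic W \<longleftrightarrow> (\<forall>i j. W $ i $ j \<ge> 0) \<and>
     (\<forall>i. (\<Sum>j\<in>UNIV. W $ i $ j) = 1) \<and> (\<forall>j. (\<Sum>i\<in>UNIV. W $ i $ j) = 1)"

definition is_eigenvalue :: "real^'n^'n \<Rightarrow> real \<Rightarrow> bool" where
  "is_eigenvalue A \<mu> \<longleftrightarrow> (\<exists>v. v \<noteq> 0 \<and> A *v v = \<mu> *\<^sub>R v)"

definition is_singular_value :: "real^'n^'n \<Rightarrow> real \<Rightarrow> bool" where
  "is_singular_value A s \<longleftrightarrow> s \<ge> 0 \<and> is_eigenvalue (transpose A ** A) (s\<^sup>2)"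

lemma finite_singular_values: "finite {s. is_singular_value (A::real^'n^'n) s}"
proof -
  let ?B = "transpose A ** A" and ?S = "{s. is_singular_value A s}"
  have B: "(?B *v x) \<bullet> y = (A *v x) \<bullet> (A *v y)" for x y
    by (simp only: matrix_vector_mul_assoc[symmetric] transpose_matrix_vector dot_lmul_matrix)
  have sym: "(?B *v x) \<bullet> y = x \<bullet> (?B *v y)" for x y
    by (subst inner_commute[of x]) (simp only: B inner_commute[of "A *v y"])
  define v where "v s = (SOME v. v \<noteq> 0 \<and> ?B *v v = s\<^sup>2 *\<^sub>R v)" for s
  have v: "v s \<noteq> 0 \<and> ?B *v v s = s\<^sup>2 *\<^sub>R v s" if "s \<in> ?S" for s
    unfolding v_def using that
    unfolding is_singular_value_def is_eigenvalue_def mem_Collect_eq by (elim conjE) (rule someI_ex)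
  have orth: "v s \<bullet> v t = 0" if "s \<in> ?S" "t \<in> ?S" "s \<noteq> t" for s t
  proof -
    have "s\<^sup>2 * (v s \<bullet> v t) = t\<^sup>2 * (v s \<bullet> v t)"
      using sym[of "v s" "v t"] conjunct2[OF v[OF that(1)]] conjunct2[OF v[OF that(2)]]
      by (simp only: inner_scaleR_left inner_scaleR_right)
    moreover have "s\<^sup>2 \<noteq> t\<^sup>2"
      using that by (simp add: is_singular_value_def power2_eq_iff_nonneg)
    ultimately show ?thesis by simp
  qed
  have "inj_on v ?S"
  proof (rule inj_onI, rule ccontr)
    fix s t assume st: "s \<in> ?S" "t \<in> ?S" "v s = v t" "s \<noteq> t"
    then have "v s \<bullet> v s = 0" using orth[of s t] by metis
    then show False using v[OF st(1)] by simp
  qed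
  moreover have "finite (v ` ?S)"
  proof (rule pairwise_orthogonal_imp_finite)
    show "pairwise orthogonal (v ` ?S)"
      unfolding pairwise_def orthogonal_def using orth by blast
  qed
  ultimately show ?thesis by (rule finite_imageD[rotated])
qed

text \<open>Each singular value occurs as often as the dimension of the corresponding eigenspace of
  \<open>A\<^sup>T A\<close>.\<close>

definition singular_values :: "real^'n^'n \<Rightarrow> real multiset" where
  "singular_values A =
     (\<Sum>s\<in>{s. is_singular_value A s}.
        replicate_mset (dim {v. (transpose A ** A) *v v = s\<^sup>2 *\<^sub>R v}) s)"

definition second_singular_value :: "real^'n^'n \<Rightarrow> real" where
  "second_singular_value A = rev (sorted_list_of_multiset (singular_values A)) ! 1"

text \<open>The conditions force \<open>CARD('n) \<ge> 2\<close>, so the second singular value exists. As \<open>W\<close> is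
  symmetric, all its eigenvalues are real.\<close>

definition mixing_matrix :: "real^'n^'n \<Rightarrow> bool" where
  "mixing_matrix W \<longleftrightarrow>
     doubly_stochastic W \<and> transpose W = W \<and> (\<forall>i. 0 < W $ i $ i \<and> W $ i $ i < 1) \<and>
     (\<forall>\<mu>. is_eigenvalue W \<mu> \<longrightarrow> -1 < \<mu> \<and> \<mu> \<le> 1) \<and>
     0 \<le> second_singular_value W \<and> second_singular_value W < 1"

text \<open>A stack of \<open>n\<close> blocks from \<open>'a\<close> is an element of \<open>'a^'n\<close>; its norm is the Euclidean norm of the
  stack. In particular \<open>(real^'r^'d)^'n\<close> stands for the \<open>nd \<times> r\<close> matrices.\<close>

definition mix :: "real^'n^'n \<Rightarrow> ('a::euclidean_space)^'n \<Rightarrow> 'a^'n" where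
  "mix W x = (\<chi> i. \<Sum>j\<in>UNIV. W $ i $ j *\<^sub>R x $ j)"

definition mean :: "('a::euclidean_space)^'n \<Rightarrow> 'a" where
  "mean x = (1 / real CARD('n)) *\<^sub>R (\<Sum>i\<in>UNIV. x $ i)"

definition stack_pow :: "'a::euclidean_space set \<Rightarrow> ('a^'n) set" where
  "stack_pow M = {x. \<forall>i. x $ i \<in> M}"

definition consensus_nbhd :: "'a::euclidean_space set \<Rightarrow> real \<Rightarrow> ('a^'n) set" where
  "consensus_nbhd M \<delta> = {x \<in> stack_pow M. \<exists>xbar \<in> nearest M (mean x). norm (x - (\<chi> i. xbar)) \<le> \<delta>}"

definition nearest_stack :: "'a::euclidean_space set \<Rightarrow> 'a^'n \<Rightarrow> ('a^'n) set" where
  "nearest_stack M x = {y. \<forall>i. y $ i \<in> nearest M (x $ i)}"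

definition proj_tan_stack :: "'a::euclidean_space set \<Rightarrow> 'a^'n \<Rightarrow> 'a^'n \<Rightarrow> 'a^'n" where
  "proj_tan_stack M x v = (\<chi> i. proj_tan M (x $ i) (v $ i))"

text \<open>Stack of the local Riemannian gradients, without the factor \<open>1/n\<close>.\<close>

definition rgrad_stack :: "'a::euclidean_space set \<Rightarrow> ('n \<Rightarrow> 'a \<Rightarrow> real) \<Rightarrow> 'a^'n \<Rightarrow> 'a^'n" where
  "rgrad_stack M f x = (\<chi> i. rgrad M (f i) (x $ i))"

definition objective :: "('n \<Rightarrow> 'a::euclidean_space \<Rightarrow> real) \<Rightarrow> 'a^'n \<Rightarrow> real" where
  "objective f x = (1 / real CARD('n)) * (\<Sum>i\<in>UNIV. f i (x $ i))"

definition compressor :: "real \<Rightarrow> ('b::real_normed_vector \<Rightarrow> 'b) \<Rightarrow> bool" where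
  "compressor \<alpha> C \<longleftrightarrow> 0 < \<alpha> \<and> \<alpha> \<le> 1 \<and> (\<forall>x. (norm (C x - x))\<^sup>2 \<le> (1 - \<alpha>) * (norm x)\<^sup>2)"

text \<open>The sequences form a run of DPRGC; \<open>xt\<close> and \<open>dt\<close> are the compressed surrogates written with a
  tilde, and the membership in \<open>nearest_stack\<close> leaves the choice of nearest points open.\<close>

definition dprgc_run ::
  "'a::euclidean_space set \<Rightarrow> real \<Rightarrow> real^'n^'n \<Rightarrow> ('n \<Rightarrow> 'a \<Rightarrow> real) \<Rightarrow> ('a^'n \<Rightarrow> 'a^'n) \<Rightarrow>
   real \<Rightarrow> real \<Rightarrow> real \<Rightarrow>
   (nat \<Rightarrow> 'a^'n) \<Rightarrow> (nat \<Rightarrow> 'a^'n) \<Rightarrow> (nat \<Rightarrow> 'a^'n) \<Rightarrow>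
   (nat \<Rightarrow> 'a^'n) \<Rightarrow> (nat \<Rightarrow> 'a^'n) \<Rightarrow> (nat \<Rightarrow> 'a^'n) \<Rightarrow>
   (nat \<Rightarrow> 'a^'n) \<Rightarrow> (nat \<Rightarrow> 'a^'n) \<Rightarrow> bool" where
  "dprgc_run M R W f C \<gamma> \<eta> \<delta> x xt s q d dt u p \<longleftrightarrow>
     0 < \<eta> \<and> 0 < \<gamma> \<and> \<gamma> \<le> 1 \<and>
     \<delta> < min (R * \<gamma> * (1 - second_singular_value W)) (R / 4) \<and>
     x 0 \<in> consensus_nbhd M \<delta> \<and> xt 0 = x 0 \<and> s 0 = mix W (x 0) \<and>
     d 0 = rgrad_stack M f (x 0) \<and> dt 0 = d 0 \<and> u 0 = mix W (d 0) \<and>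
     (\<forall>k.
        x (Suc k) \<in> nearest_stack M
          (x k + \<gamma> *\<^sub>R (s k - xt k) - \<eta> *\<^sub>R proj_tan_stack M (x k) (d k)) \<and>
        q (Suc k) = C (x (Suc k) - xt k) \<and>
        xt (Suc k) = xt k + q (Suc k) \<and>
        s (Suc k) = s k + mix W (q (Suc k)) \<and>
        d (Suc k) = d k + \<gamma> *\<^sub>R (u k - dt k) + rgrad_stack M f (x (Suc k)) - rgrad_stack M f (x k) \<and>
        p (Suc k) = C (d (Suc k) - dt k) \<and>
        dt (Suc k) = dt k + p (Suc k) \<and>
        u (Suc k) = u k + mix W (p (Suc k)))"

end

theory Submission
  imports Defs
begin

text \<open>The claim follows once the sum of all squared mean gradients along a run is bounded by a
  constant that does not depend on the run: \<open>f(x\<^sub>0)\<close> is at least the infimum, so \<open>M'\<close> can absorb the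
  whole sum. Constants may depend on the manifold, the objectives, the network and the step sizes.

  \<^bold>\<open>Geometry.\<close> In slice charts a chord of a compact submanifold differs from a tangent vector by a
  quadratic remainder, so a normal vector \<open>\<nu>\<close> at \<open>x\<close> satisfies
  \<open>\<nu> \<bullet> (y - x) \<le> \<kappa> |\<nu>| |y - x|\<^sup>2\<close> (\<open>ex_proximal_normals\<close>). Three consequences carry the rest: close to \<open>M\<close>
  the metric projection is Lipschitz with a constant close to one (\<open>nearest_lipschitz\<close>); the mean of
  points of \<open>M\<close> is quadratically close to \<open>M\<close> (\<open>mean_to_nearest_le\<close>); and a smooth function has a
  quadratic upper bound along \<open>M\<close> in terms of its Riemannian gradient.

  \<^bold>\<open>Linear recursions.\<close> The condition on the second singular value makes the mixing matrix contract
  everything of mean zero (\<open>mixing_contraction_real\<close>). Disagreement and compression error of a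
  gossiping sequence then obey a coupled recursion, and for \<open>\<gamma>\<close> small against \<open>\<alpha>\<close> times the spectral gap a
  weighted sum of the two contracts by a fixed factor (\<open>coupled_contraction\<close>). This applies to the trackers
  \<open>d\<close>, with the gradient differences as inputs, and to the iterates \<open>x\<close>, with inputs \<open>\<eta> |d|\<close>; for the
  latter the expansion by the metric projection is of order \<open>\<gamma>\<^sup>2\<close> and loses against the contraction of
  order \<open>\<gamma>\<close>, as long as the run stays in the region of size \<open>R \<gamma>\<close> where it starts. It never leaves it,
  because the trackers are bounded a priori by compactness of \<open>M\<close>, and \<open>\<eta>\<close> may be chosen small against
  that bound (\<open>consensus_along_run\<close>).

  \<^bold>\<open>Descent.\<close> The trackers have the mean gradient as their mean. Hence the common objective at the
  point nearest to the mean of the iterates decreases by \<open>\<eta>/2\<close> times the squared mean gradient, up to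
  squares of disagreement and displacement (\<open>descent_step\<close>).

  \<^bold>\<open>Closing the loop.\<close> Summed over the iterations, the errors are bounded by \<open>\<eta>\<^sup>2\<close> times the sum of the
  squared trackers, and the latter by the errors and the squared mean gradients. Against the gain
  \<open>\<eta>/2\<close> a loss of order \<open>\<eta>\<^sup>2\<close> is negligible for small \<open>\<eta>\<close> (\<open>small_gain\<close>).\<close>

section \<open>Smooth maps\<close>

lemma Ck_on_cong:
  assumes "open U" "\<And>x. x \<in> U \<Longrightarrow> f x = g x"
  shows "Ck_on k U f \<longleftrightarrow> Ck_on k U g"
  using assms(2)
proof (induction k arbitrary: f g)
  case 0
  then show ?case by (simp cong: continuous_on_cong)
next
  case (Suc k)
  have D: "(f has_derivative D) (at x) \<longleftrightarrow> (g has_derivative D) (at x)" if "x \<in> U" for x D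
    using that Suc.prems assms(1) by (auto intro: has_derivative_transform_within_open[OF _ assms(1)])
  have "frechet_derivative f (at x) = frechet_derivative g (at x)" if "x \<in> U" for x
    using D[OF that] by (simp add: frechet_derivative_def)
  then have "Ck_on k U (\<lambda>x. frechet_derivative f (at x) v) \<longleftrightarrow>
      Ck_on k U (\<lambda>x. frechet_derivative g (at x) v)" for v
    by (intro Suc.IH) simp
  with D show ?case by (simp add: differentiable_def)
qed

text \<open>The direction \<open>v\<close> in which the derivative is taken enters linearly as the direction \<open>v *\<^sub>R s\<close>
  for \<open>g\<close>, so the induction applies to the directional derivative of \<open>g\<close> and no chain rule of
  higher order occurs.\<close>

lemma Ck_on_affine_line:
  fixes a s :: "'a::euclidean_space" and g :: "'a \<Rightarrow> 'b::euclidean_space"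
  assumes "open V" "open I" "\<And>t::real. t \<in> I \<Longrightarrow> a + t *\<^sub>R s \<in> V" "Ck_on k V g"
  shows "Ck_on k I (\<lambda>t. g (a + t *\<^sub>R s))"
  using assms(4)
proof (induction k arbitrary: g)
  case 0
  then have g: "continuous_on V g"
    by simp
  have "continuous_on I (g \<circ> (\<lambda>t. a + t *\<^sub>R s))"
    by (rule continuous_on_compose) (auto intro!: continuous_intros continuous_on_subset[OF g] assms(3))
  then show ?case
    by (simp add: o_def)
next
  case (Suc k)
  have D: "((\<lambda>t. g (a + t *\<^sub>R s)) has_derivative (\<lambda>v. frechet_derivative g (at (a + t *\<^sub>R s)) (v *\<^sub>R s))) (at t)"
    if "t \<in> I" for t
  proof -
    have "(g has_derivative frechet_derivative g (at (a + t *\<^sub>R s))) (at (a + t *\<^sub>R s))"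
      using Suc.prems assms(3)[OF that] by (simp add: frechet_derivative_works)
    moreover have "((\<lambda>t. a + t *\<^sub>R s) has_derivative (\<lambda>v. v *\<^sub>R s)) (at t)"
      by (auto intro!: derivative_eq_intros)
    ultimately show ?thesis
      by (rule has_derivative_compose[rotated])
  qed
  have "Ck_on k I (\<lambda>t. frechet_derivative (\<lambda>t. g (a + t *\<^sub>R s)) (at t) v)" for v
  proof -
    have "Ck_on k V (\<lambda>x. frechet_derivative g (at x) (v *\<^sub>R s))"
      using Suc.prems by simp
    then have "Ck_on k I (\<lambda>t. frechet_derivative g (at (a + t *\<^sub>R s)) (v *\<^sub>R s))"
      by (rule Suc.IH)
    then show ?thesis
      by (subst Ck_on_cong[OF assms(2)]) (simp_all add: frechet_derivative_at[OF D, symmetric])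
  qed
  moreover have "\<forall>t\<in>I. (\<lambda>t. g (a + t *\<^sub>R s)) differentiable (at t)"
    using D by (auto simp: differentiable_def)
  ultimately show ?case
    by simp
qed

lemma smooth_onD:
  assumes "smooth_on U f" "x \<in> U"
  shows "(f has_derivative frechet_derivative f (at x)) (at x)"
proof -
  have "Ck_on (Suc 0) U f"
    using assms(1) unfolding smooth_on_def by blast
  then show ?thesis
    using assms(2) by (simp add: frechet_derivative_works)
qed

text \<open>On a compact convex set the partial derivatives are bounded, and the mean value inequality
  turns their bound into a Lipschitz constant.\<close>

lemma C1_lipschitz_on_compact_convex:
  fixes f :: "'a::euclidean_space \<Rightarrow> 'b::euclidean_space"
  assumes "compact B" "convex B" "B \<subseteq> U" "Ck_on 1 U f"
  obtains K where "K > 0" "\<And>x y. x \<in> B \<Longrightarrow> y \<in> B \<Longrightarrow> norm (f x - f y) \<le> K * norm (x - y)"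
proof -
  let ?D = "\<lambda>x. frechet_derivative f (at x)"
  have c: "continuous_on U (\<lambda>x. ?D x v)" for v
    using assms(4) by simp
  have d: "(f has_derivative ?D x) (at x)" if "x \<in> B" for x
    using that assms(3,4) by (auto simp: frechet_derivative_works)
  have "continuous_on B (\<lambda>x. \<Sum>b\<in>Basis. norm (?D x b))"
    by (intro continuous_intros continuous_on_subset[OF c assms(3)])
  then have "bounded ((\<lambda>x. \<Sum>b\<in>Basis. norm (?D x b)) ` B)"
    using assms(1) by (intro compact_imp_bounded compact_continuous_image)
  then obtain K where K: "K > 0" "\<And>x. x \<in> B \<Longrightarrow> (\<Sum>b\<in>Basis. norm (?D x b)) \<le> K"
    by (fastforce simp: bounded_pos dest: abs_le_D1)
  have "norm (f x - f y) \<le> K * norm (x - y)" if "x \<in> B" "y \<in> B" for x y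
  proof (rule differentiable_bound[OF assms(2) _ _ that])
    show "(f has_derivative ?D x) (at x within B)" if "x \<in> B" for x
      using d[OF that] by (rule has_derivative_at_withinI)
    show "onorm (?D x) \<le> K" if "x \<in> B" for x
      using onorm_componentwise[OF has_derivative_bounded_linear[OF d[OF that]]] K(2)[OF that] by linarith
  qed
  with K(1) show thesis
    by (rule that)
qed

lemma C2_quadratic_remainder:
  fixes f :: "'a::euclidean_space \<Rightarrow> 'b::euclidean_space"
  assumes "compact B" "convex B" "B \<subseteq> U" "Ck_on 2 U f"
  obtains K where "K > 0"
    "\<And>x y. x \<in> B \<Longrightarrow> y \<in> B \<Longrightarrow> norm (f y - f x - frechet_derivative f (at x) (y - x)) \<le> K * (norm (y - x))\<^sup>2"
proof -
  let ?D = "\<lambda>x. frechet_derivative f (at x)"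
  have C2: "Ck_on (Suc 1) U f"
    using assms(4) by (simp only: Suc_1)
  have "\<exists>K>0. \<forall>x\<in>B. \<forall>y\<in>B. norm (?D x v - ?D y v) \<le> K * norm (x - y)" for v
  proof -
    have "Ck_on 1 U (\<lambda>x. ?D x v)"
      using C2 by (simp only: Ck_on.simps)
    then show ?thesis
      by (rule C1_lipschitz_on_compact_convex[OF assms(1-3)]) blast
  qed
  then obtain k where k: "\<And>v. k v > 0" "\<And>v x y. x \<in> B \<Longrightarrow> y \<in> B \<Longrightarrow> norm (?D x v - ?D y v) \<le> k v * norm (x - y)"
    by metis
  let ?K = "\<Sum>b\<in>Basis. k b"
  have K: "?K > 0"
    using k(1) by (intro sum_pos) auto
  have d: "(f has_derivative ?D x) (at x)" if "x \<in> B" for x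
    using that assms(3) C2 by (auto simp: frechet_derivative_works)
  have "norm (f y - f x - ?D x (y - x)) \<le> ?K * (norm (y - x))\<^sup>2" if xy: "x \<in> B" "y \<in> B" for x y
  proof -
    have seg: "closed_segment x y \<subseteq> B"
      using assms(2) xy by (simp add: closed_segment_subset)
    have "norm (f y - f x - ?D x (y - x)) \<le> norm (y - x) * (?K * norm (y - x))"
    proof (rule differentiable_bound_linearization[where S = "closed_segment x y"])
      show "x + t *\<^sub>R (y - x) \<in> closed_segment x y" if "t \<in> {0..1}" for t
        using that by (auto simp: in_segment algebra_simps intro!: exI[of _ t])
      show "(f has_derivative ?D z) (at z within closed_segment x y)" if "z \<in> closed_segment x y" for z
        by (rule has_derivative_at_withinI[OF d]) (use that seg in blast)
      show "onorm (?D z - ?D x) \<le> ?K * norm (y - x)" if z: "z \<in> closed_segment x y" for z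
      proof -
        have zB: "z \<in> B" using z seg by blast
        have "bounded_linear (\<lambda>h. ?D z h - ?D x h)"
          using d[OF zB] d[OF xy(1)] by (intro bounded_linear_sub has_derivative_bounded_linear)
        then have "onorm (?D z - ?D x) \<le> (\<Sum>b\<in>Basis. norm (?D z b - ?D x b))"
          using onorm_componentwise by (fastforce simp: fun_diff_def)
        also have "\<dots> \<le> (\<Sum>b\<in>Basis. k b * norm (z - x))"
          by (intro sum_mono k(2) zB xy)
        also have "\<dots> = ?K * norm (z - x)"
          by (simp add: sum_distrib_right)
        also have "\<dots> \<le> ?K * norm (y - x)"
          using K segment_bound(1)[OF z] by (intro mult_left_mono) auto
        finally show ?thesis .
      qed
    qed auto
    then show ?thesis by (simp add: power2_eq_square mult_ac)
  qed
  with K show thesis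
    by (rule that)
qed

section \<open>Tangent spaces of embedded submanifolds\<close>

definition slice_chart :: "'a::euclidean_space set \<Rightarrow> 'a set \<Rightarrow> 'a set \<Rightarrow> ('a \<Rightarrow> 'a) \<Rightarrow> ('a \<Rightarrow> 'a) \<Rightarrow> 'a set \<Rightarrow> bool" where
  "slice_chart M U V \<phi> \<psi> S \<longleftrightarrow> open U \<and> open V \<and> homeomorphism U V \<phi> \<psi> \<and>
     smooth_on U \<phi> \<and> smooth_on V \<psi> \<and> subspace S \<and> \<phi> ` (U \<inter> M) = V \<inter> S"

lemma slice_chart_inverse:
  assumes "slice_chart M U V \<phi> \<psi> S"
  shows "x \<in> U \<Longrightarrow> \<psi> (\<phi> x) = x" "x \<in> U \<Longrightarrow> \<phi> x \<in> V" "x \<in> U \<inter> M \<Longrightarrow> \<phi> x \<in> S"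
    "b \<in> V \<inter> S \<Longrightarrow> \<psi> b \<in> U \<inter> M"
proof -
  have h: "homeomorphism U V \<phi> \<psi>" and im: "\<phi> ` (U \<inter> M) = V \<inter> S"
    using assms by (auto simp: slice_chart_def)
  show inv: "x \<in> U \<Longrightarrow> \<psi> (\<phi> x) = x" for x
    using h by (simp add: homeomorphism_def)
  show "x \<in> U \<Longrightarrow> \<phi> x \<in> V"
    using h by (auto simp: homeomorphism_def)
  show "x \<in> U \<inter> M \<Longrightarrow> \<phi> x \<in> S"
    using im by blast
  show "b \<in> V \<inter> S \<Longrightarrow> \<psi> b \<in> U \<inter> M"
    using im inv by (metis IntD1 imageE)
qed

text \<open>A straight line in \<open>S\<close> maps to a curve in \<open>M\<close>, which gives one inclusion. Conversely \<open>\<phi>\<close> maps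
  a curve in \<open>M\<close> into \<open>S\<close>, and since \<open>S\<close> is closed the velocity stays in \<open>S\<close>.\<close>

lemma tangent_space_slice_chart:
  assumes ch: "slice_chart M U V \<phi> \<psi> S" and x: "x \<in> U \<inter> M"
  shows "tangent_space M x = frechet_derivative \<psi> (at (\<phi> x)) ` S"
proof (intro equalityI subsetI)
  note inv = slice_chart_inverse[OF ch]
  have op: "open U" "open V" and S: "subspace S" and sm: "smooth_on U \<phi>" "smooth_on V \<psi>"
    using ch by (auto simp: slice_chart_def)
  let ?A = "frechet_derivative \<phi> (at x)" and ?B = "frechet_derivative \<psi> (at (\<phi> x))"
  have A: "(\<phi> has_derivative ?A) (at x)" and B: "(\<psi> has_derivative ?B) (at (\<phi> x))"
    using x inv by (auto intro: smooth_onD sm)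
  fix v
  {
    assume "v \<in> tangent_space M x"
    then obtain c e where e: "e > 0" and c: "c ` {-e<..<e} \<subseteq> M" "c 0 = x" "(c has_vector_derivative v) (at 0)"
      unfolding tangent_space_def by blast
    have c': "(c has_derivative (\<lambda>t. t *\<^sub>R v)) (at 0)"
      using c(3) by (simp add: has_vector_derivative_def)
    have "((\<lambda>t. \<phi> (c t)) has_derivative (\<lambda>t. ?A (t *\<^sub>R v))) (at 0)"
      using A c(2) by (intro has_derivative_compose[OF c']) simp
    then have dphi: "((\<lambda>t. \<phi> (c t)) has_derivative (\<lambda>t. t *\<^sub>R ?A v)) (at 0)"
      using A by (simp add: linear_cmul has_derivative_linear)
    have "isCont c 0"
      using c' by (rule has_derivative_continuous)
    then have "\<forall>\<^sub>F t in at 0. c t \<in> U"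
      using op(1) x c(2) by (auto simp: isCont_def intro: topological_tendstoD)
    moreover have "\<forall>\<^sub>F t in at 0. t \<in> {-e<..<e}"
      using e by (intro eventually_at_in_open') auto
    ultimately have ev: "\<forall>\<^sub>F t in at 0. c t \<in> U \<inter> M"
      by eventually_elim (use c(1) in auto)
    have "?A v \<in> S"
    proof (rule Lim_in_closed_set[OF closed_subspace[OF S]])
      show "\<forall>\<^sub>F t in at 0. (\<phi> (c t) - \<phi> (c 0)) /\<^sub>R t \<in> S"
        using ev
      proof eventually_elim
        case (elim t)
        then have "\<phi> (c t) - \<phi> (c 0) \<in> S"
          using c(2) x inv S by (intro subspace_diff) auto
        then show ?case
          using S by (rule subspace_scale[rotated])
      qed
      show "((\<lambda>t. (\<phi> (c t) - \<phi> (c 0)) /\<^sub>R t) \<longlongrightarrow> ?A v) (at 0)"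
      proof -
        have "(\<lambda>t. (\<phi> (c t) - \<phi> (c 0) - t *\<^sub>R ?A v) /\<^sub>R norm t) \<midarrow>0\<rightarrow> 0"
          using dphi by (simp add: has_derivative_at_within)
        then have "(\<lambda>t. norm ((\<phi> (c t) - \<phi> (c 0) - t *\<^sub>R ?A v) /\<^sub>R norm t)) \<midarrow>0\<rightarrow> 0"
          by (rule tendsto_norm_zero)
        then have "(\<lambda>t. norm ((\<phi> (c t) - \<phi> (c 0)) /\<^sub>R t - ?A v)) \<midarrow>0\<rightarrow> 0"
        proof (rule Lim_transform_eventually)
          have "norm ((\<phi> (c t) - \<phi> (c 0) - t *\<^sub>R ?A v) /\<^sub>R norm t) = norm ((\<phi> (c t) - \<phi> (c 0)) /\<^sub>R t - ?A v)"
            if "t \<noteq> 0" for t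
          proof -
            have "norm ((\<phi> (c t) - \<phi> (c 0) - t *\<^sub>R ?A v) /\<^sub>R norm t) = norm ((\<phi> (c t) - \<phi> (c 0) - t *\<^sub>R ?A v) /\<^sub>R t)"
              by simp
            also have "(\<phi> (c t) - \<phi> (c 0) - t *\<^sub>R ?A v) /\<^sub>R t = (\<phi> (c t) - \<phi> (c 0)) /\<^sub>R t - ?A v"
              using that by (simp add: scaleR_diff_right)
            finally show ?thesis .
          qed
          then show "\<forall>\<^sub>F t in at 0. norm ((\<phi> (c t) - \<phi> (c 0) - t *\<^sub>R ?A v) /\<^sub>R norm t) =
              norm ((\<phi> (c t) - \<phi> (c 0)) /\<^sub>R t - ?A v)"
            by (simp add: eventually_at_filter)
        qed
        then show ?thesis
          by (simp only: tendsto_norm_zero_iff flip: Lim_null)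
      qed
    qed simp
    moreover have "v = ?B (?A v)"
    proof -
      have "((\<lambda>t. \<psi> (\<phi> (c t))) has_derivative (\<lambda>t. ?B (t *\<^sub>R ?A v))) (at 0)"
        using B c(2) by (intro has_derivative_compose[OF dphi]) simp
      then have "(c has_derivative (\<lambda>t. ?B (t *\<^sub>R ?A v))) (at 0)"
        by (rule has_derivative_transform_eventually)
          (use ev c(2) x inv in \<open>auto elim!: eventually_mono\<close>)
      from has_derivative_unique[OF c' this] have "1 *\<^sub>R v = ?B (1 *\<^sub>R ?A v)"
        by meson
      then show ?thesis by simp
    qed
    ultimately show "v \<in> ?B ` S" by blast
  }
  {
    assume "v \<in> ?B ` S"
    then obtain s where s: "s \<in> S" "v = ?B s" by blast
    have "isCont (\<lambda>t::real. \<phi> x + t *\<^sub>R s) 0"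
      by (intro continuous_intros)
    then have "((\<lambda>t::real. \<phi> x + t *\<^sub>R s) \<longlongrightarrow> \<phi> x) (nhds 0)"
      by (simp add: isCont_def continuous_within tendsto_nhds_iff)
    then have "\<forall>\<^sub>F t::real in nhds 0. \<phi> x + t *\<^sub>R s \<in> V"
      using op(2) x inv by (intro topological_tendstoD) auto
    then obtain e where e: "e > 0" "\<And>t::real. \<bar>t\<bar> < e \<Longrightarrow> \<phi> x + t *\<^sub>R s \<in> V"
      by (auto simp: eventually_nhds_metric)
    let ?c = "\<lambda>t. \<psi> (\<phi> x + t *\<^sub>R s)"
    have "smooth_on {-e<..<e} ?c"
      unfolding smooth_on_def
    proof (intro allI Ck_on_affine_line[OF op(2)])
      show "Ck_on k V \<psi>" for k
        using sm(2) by (simp add: smooth_on_def)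
      show "\<phi> x + t *\<^sub>R s \<in> V" if "t \<in> {-e<..<e}" for t
        using that by (intro e(2)) auto
    qed simp
    moreover have "?c ` {-e<..<e} \<subseteq> M"
    proof safe
      fix t assume "t \<in> {-e<..<e}"
      then have "\<phi> x + t *\<^sub>R s \<in> V \<inter> S"
        using e(2)[of t] x inv S s(1) by (auto intro: subspace_add subspace_scale)
      then show "?c t \<in> M" using inv(4) by blast
    qed
    moreover have "?c 0 = x"
      using x inv by simp
    moreover have "(?c has_vector_derivative v) (at 0)"
    proof -
      have "((\<lambda>t. \<phi> x + t *\<^sub>R s) has_derivative (\<lambda>t. t *\<^sub>R s)) (at 0)"
        by (auto intro!: derivative_eq_intros)
      then have "(?c has_derivative (\<lambda>t. ?B (t *\<^sub>R s))) (at 0)"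
        by (rule has_derivative_compose) (use B in simp)
      then show ?thesis
        using B s(2) by (simp add: has_vector_derivative_def linear_cmul has_derivative_linear)
    qed
    ultimately show "v \<in> tangent_space M x"
      unfolding tangent_space_def using e(1) by blast
  }
qed

lemma embedded_submanifold_chart:
  assumes "embedded_submanifold m M" "x \<in> M"
  obtains U V \<phi> \<psi> S where "slice_chart M U V \<phi> \<psi> S" "x \<in> U"
  using assms unfolding embedded_submanifold_def slice_chart_def by metis

lemma subspace_tangent_space:
  assumes "embedded_submanifold m M" "x \<in> M"
  shows "subspace (tangent_space M x)"
proof -
  obtain U V \<phi> \<psi> S where ch: "slice_chart M U V \<phi> \<psi> S" and x: "x \<in> U"
    using embedded_submanifold_chart[OF assms] .
  have "(\<psi> has_derivative frechet_derivative \<psi> (at (\<phi> x))) (at (\<phi> x))"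
    using ch x slice_chart_inverse(2)[OF ch x] by (auto simp: slice_chart_def intro: smooth_onD)
  moreover have "subspace S"
    using ch by (simp add: slice_chart_def)
  ultimately show ?thesis
    using tangent_space_slice_chart[OF ch] x assms(2)
    by (simp add: linear_subspace_image has_derivative_linear)
qed

text \<open>In a chart a chord of \<open>M\<close> is the image of a chord of \<open>S\<close>; its first order part is tangent, and
  the remainder is quadratic by Taylor's theorem.\<close>

lemma chord_near_tangent_local:
  assumes "embedded_submanifold m M" "x0 \<in> M"
  obtains e K where "e > 0"
    "\<And>x y. x \<in> M \<inter> ball x0 e \<Longrightarrow> y \<in> M \<inter> ball x0 e \<Longrightarrow>
       \<exists>w\<in>tangent_space M x. norm (y - x - w) \<le> K * (norm (y - x))\<^sup>2"
proof -
  obtain U V \<phi> \<psi> S where ch: "slice_chart M U V \<phi> \<psi> S" and x0: "x0 \<in> U"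
    using embedded_submanifold_chart[OF assms] .
  note inv = slice_chart_inverse[OF ch]
  have op: "open U" "open V" and S: "subspace S" and sm: "smooth_on U \<phi>" "smooth_on V \<psi>"
    and hom: "homeomorphism U V \<phi> \<psi>"
    using ch by (auto simp: slice_chart_def)
  obtain r where r: "r > 0" "cball (\<phi> x0) r \<subseteq> V"
    using op(2) inv(2)[OF x0] open_contains_cball by metis
  have "Ck_on 2 V \<psi>"
    using sm(2) by (simp add: smooth_on_def)
  from this obtain K1 where K1: "K1 > 0" "\<And>a b. a \<in> cball (\<phi> x0) r \<Longrightarrow> b \<in> cball (\<phi> x0) r \<Longrightarrow>
      norm (\<psi> b - \<psi> a - frechet_derivative \<psi> (at a) (b - a)) \<le> K1 * (norm (b - a))\<^sup>2"
    by (rule C2_quadratic_remainder[OF compact_cball convex_cball r(2)]) blast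
  have "open (U \<inter> \<phi> -` ball (\<phi> x0) r)"
    using hom op(1) by (intro continuous_open_preimage) (auto simp: homeomorphism_def)
  moreover have "x0 \<in> U \<inter> \<phi> -` ball (\<phi> x0) r"
    using x0 r(1) by simp
  ultimately obtain e where e: "e > 0" "cball x0 e \<subseteq> U \<inter> \<phi> -` ball (\<phi> x0) r"
    using open_contains_cball by metis
  have eU: "cball x0 e \<subseteq> U"
    using e(2) by blast
  have "Ck_on 1 U \<phi>"
    using sm(1) by (simp only: smooth_on_def)
  then obtain K2 where K2: "K2 > 0" "\<And>x y. x \<in> cball x0 e \<Longrightarrow> y \<in> cball x0 e \<Longrightarrow>
      norm (\<phi> x - \<phi> y) \<le> K2 * norm (x - y)"
    by (rule C1_lipschitz_on_compact_convex[OF compact_cball convex_cball eU]) blast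
  show thesis
  proof (rule that[OF e(1), where K = "K1 * K2\<^sup>2"])
    fix x y assume xy: "x \<in> M \<inter> ball x0 e" "y \<in> M \<inter> ball x0 e"
    then have c: "x \<in> cball x0 e" "y \<in> cball x0 e" by auto
    then have U: "x \<in> U \<inter> M" "y \<in> U \<inter> M" and
      b: "\<phi> x \<in> cball (\<phi> x0) r" "\<phi> y \<in> cball (\<phi> x0) r"
      using e(2) xy by fastforce+
    let ?w = "frechet_derivative \<psi> (at (\<phi> x)) (\<phi> y - \<phi> x)"
    have "?w \<in> tangent_space M x"
      using tangent_space_slice_chart[OF ch U(1)] inv(3)[OF U(1)] inv(3)[OF U(2)] S
      by (auto intro: subspace_diff)
    moreover have "norm (y - x - ?w) \<le> K1 * K2\<^sup>2 * (norm (y - x))\<^sup>2"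
    proof -
      have "norm (y - x - ?w) \<le> K1 * (norm (\<phi> y - \<phi> x))\<^sup>2"
        using K1(2)[OF b] inv(1) U by simp
      also have "\<dots> \<le> K1 * (K2 * norm (y - x))\<^sup>2"
        using K2(2)[OF c(2,1)] K1(1) by (intro mult_left_mono power_mono) auto
      finally show ?thesis by (simp add: power_mult_distrib mult_ac)
    qed
    ultimately show "\<exists>w\<in>tangent_space M x. norm (y - x - w) \<le> K1 * K2\<^sup>2 * (norm (y - x))\<^sup>2"
      by blast
  qed
qed

text \<open>If no constant worked, chords violating the bound with ever larger constants would have to
  shrink, because \<open>w = 0\<close> is tangent; by compactness they accumulate at a point, where the local
  bound contradicts them.\<close>

lemma chord_near_tangent:
  assumes "compact M" "embedded_submanifold m M"
  obtains K where "K > 0"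
    "\<And>x y. x \<in> M \<Longrightarrow> y \<in> M \<Longrightarrow> \<exists>w\<in>tangent_space M x. norm (y - x - w) \<le> K * (norm (y - x))\<^sup>2"
proof -
  have "\<exists>K>0. \<forall>x\<in>M. \<forall>y\<in>M. \<exists>w\<in>tangent_space M x. norm (y - x - w) \<le> K * (norm (y - x))\<^sup>2"
  proof (rule ccontr)
    assume neg: "\<not> ?thesis"
    have "\<exists>x y. x \<in> M \<and> y \<in> M \<and> (\<forall>w\<in>tangent_space M x. norm (y - x - w) > real (Suc n) * (norm (y - x))\<^sup>2)" for n
      using neg by (metis not_le of_nat_0_less_iff zero_less_Suc)
    then obtain x y where xy: "\<And>n. x n \<in> M" "\<And>n. y n \<in> M" and
      big: "\<And>n w. w \<in> tangent_space M (x n) \<Longrightarrow> norm (y n - x n - w) > real (Suc n) * (norm (y n - x n))\<^sup>2"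
      by metis
    have small: "norm (y n - x n) \<le> inverse (real (Suc n))" for n
    proof -
      have "norm (y n - x n) > real (Suc n) * (norm (y n - x n))\<^sup>2"
        using big[of 0 n] subspace_0[OF subspace_tangent_space[OF assms(2) xy(1)]] by simp
      then have "norm (y n - x n) * (real (Suc n) * norm (y n - x n)) < norm (y n - x n) * 1"
        by (simp add: power2_eq_square mult_ac)
      then have "real (Suc n) * norm (y n - x n) < 1"
        using mult_left_less_imp_less[OF _ norm_ge_zero] by blast
      then show ?thesis
        by (simp add: field_simps)
    qed
    obtain x0 s where x0: "x0 \<in> M" and s: "strict_mono s" "(x \<circ> s) \<longlonglongrightarrow> x0"
      using assms(1) xy(1) unfolding compact_def by metis
    have "(\<lambda>n. y n - x n) \<longlonglongrightarrow> 0"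
      using small by (intro Lim_null_comparison[OF _ LIMSEQ_inverse_real_of_nat]) auto
    then have "((\<lambda>n. y n - x n) \<circ> s) \<longlonglongrightarrow> 0"
      using s(1) by (rule LIMSEQ_subseq_LIMSEQ)
    from tendsto_add[OF this s(2)] have y: "(y \<circ> s) \<longlonglongrightarrow> x0"
      by (simp add: o_def)
    obtain e K where e: "e > 0" and K: "\<And>x y. x \<in> M \<inter> ball x0 e \<Longrightarrow> y \<in> M \<inter> ball x0 e \<Longrightarrow>
       \<exists>w\<in>tangent_space M x. norm (y - x - w) \<le> K * (norm (y - x))\<^sup>2"
      by (rule chord_near_tangent_local[OF assms(2) x0]) blast
    have "\<forall>\<^sub>F n in sequentially. (x \<circ> s) n \<in> ball x0 e"
      using topological_tendstoD[OF s(2), of "ball x0 e"] e by simp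
    moreover have "\<forall>\<^sub>F n in sequentially. (y \<circ> s) n \<in> ball x0 e"
      using topological_tendstoD[OF y, of "ball x0 e"] e by simp
    moreover have "\<forall>\<^sub>F n in sequentially. real n \<ge> K"
      using eventually_ge_at_top[of "nat \<lceil>K\<rceil>"] by eventually_elim linarith
    ultimately have "\<forall>\<^sub>F n in sequentially. False"
    proof eventually_elim
      case (elim n)
      then obtain w where w: "w \<in> tangent_space M (x (s n))"
        "norm (y (s n) - x (s n) - w) \<le> K * (norm (y (s n) - x (s n)))\<^sup>2"
        using K[of "x (s n)" "y (s n)"] xy by auto
      moreover have "K \<le> real (Suc (s n))"
        using elim seq_suble[OF s(1), of n] by linarith
      ultimately have "norm (y (s n) - x (s n) - w) \<le> real (Suc (s n)) * (norm (y (s n) - x (s n)))\<^sup>2"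
        by (meson mult_right_mono order_trans zero_le_power2)
      then show ?case using big[OF w(1)] by linarith
    qed
    then show False by simp
  qed
  then show thesis using that by blast
qed

section \<open>Normal vectors and nearest points\<close>

definition normal_to :: "'a::euclidean_space set \<Rightarrow> 'a \<Rightarrow> 'a \<Rightarrow> bool" where
  "normal_to M x \<nu> \<longleftrightarrow> (\<forall>w\<in>tangent_space M x. \<nu> \<bullet> w = 0)"

text \<open>The proximal normal inequality of a set of positive reach, with \<open>\<kappa>\<close> in the place of one half of
  the inverse of the reach.\<close>

definition proximal_normals :: "real \<Rightarrow> 'a::euclidean_space set \<Rightarrow> bool" where
  "proximal_normals \<kappa> M \<longleftrightarrow> 0 < \<kappa> \<and>
     (\<forall>x\<in>M. \<forall>y\<in>M. \<forall>\<nu>. normal_to M x \<nu> \<longrightarrow> \<nu> \<bullet> (y - x) \<le> \<kappa> * norm \<nu> * (norm (y - x))\<^sup>2)"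

text \<open>A normal vector only sees the part of a chord that is not tangent.\<close>

lemma ex_proximal_normals:
  assumes "compact M" "embedded_submanifold m M"
  obtains \<kappa> where "proximal_normals \<kappa> M"
proof -
  obtain K where K: "K > 0"
    "\<And>x y. x \<in> M \<Longrightarrow> y \<in> M \<Longrightarrow> \<exists>w\<in>tangent_space M x. norm (y - x - w) \<le> K * (norm (y - x))\<^sup>2"
    by (rule chord_near_tangent[OF assms]) blast
  have "\<nu> \<bullet> (y - x) \<le> K * norm \<nu> * (norm (y - x))\<^sup>2" if xy: "x \<in> M" "y \<in> M" and n: "normal_to M x \<nu>" for x y \<nu>
  proof -
    obtain w where w: "w \<in> tangent_space M x" "norm (y - x - w) \<le> K * (norm (y - x))\<^sup>2"
      using K(2)[OF xy] by blast
    have "\<nu> \<bullet> (y - x) = \<nu> \<bullet> (y - x - w)"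
      using n w(1) by (simp add: normal_to_def inner_diff_right)
    also have "\<dots> \<le> norm \<nu> * norm (y - x - w)"
      by (rule norm_cauchy_schwarz)
    also have "\<dots> \<le> norm \<nu> * (K * (norm (y - x))\<^sup>2)"
      using w(2) by (intro mult_left_mono) auto
    finally show ?thesis by (simp add: mult_ac)
  qed
  then show thesis
    using K(1) by (intro that[of K]) (auto simp: proximal_normals_def)
qed

lemma nearestD:
  assumes "y \<in> nearest M z"
  shows "y \<in> M" "w \<in> M \<Longrightarrow> norm (z - y) \<le> norm (z - w)"
  using assms unfolding nearest_def is_arg_min_def
  by (auto simp: not_less norm_minus_commute)

lemma ex_nearest:
  assumes "compact M" "M \<noteq> {}"
  shows "\<exists>y. y \<in> nearest M z"
proof -
  have "continuous_on M (\<lambda>y. norm (y - z))"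
    by (intro continuous_intros)
  from continuous_attains_inf[OF assms this] show ?thesis
    by (auto simp: nearest_def is_arg_min_def not_less)
qed

text \<open>Along any curve in \<open>M\<close> through the nearest point the distance to \<open>z\<close> is minimal there, so its
  derivative vanishes.\<close>

lemma nearest_normal:
  assumes "y \<in> nearest M z"
  shows "normal_to M y (z - y)"
  unfolding normal_to_def
proof
  fix w assume "w \<in> tangent_space M y"
  then obtain c e where e: "e > 0" and c: "c ` {-e<..<e} \<subseteq> M" "c 0 = y" "(c has_vector_derivative w) (at 0)"
    unfolding tangent_space_def by blast
  let ?h = "\<lambda>t. (c t - z) \<bullet> (c t - z)"
  have "(c has_derivative (\<lambda>t. t *\<^sub>R w)) (at 0)"
    using c(3) by (simp add: has_vector_derivative_def)
  then have "(?h has_derivative (\<lambda>t. (c 0 - z) \<bullet> (t *\<^sub>R w) + (t *\<^sub>R w) \<bullet> (c 0 - z))) (at 0)"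
    by (auto intro!: derivative_eq_intros)
  then have "DERIV ?h 0 :> 2 * ((y - z) \<bullet> w)"
    unfolding has_field_derivative_def
    by (rule has_derivative_eq_rhs) (auto simp: fun_eq_iff c(2) inner_commute)
  moreover have "\<forall>t. \<bar>0 - t\<bar> < e \<longrightarrow> ?h 0 \<le> ?h t"
  proof (intro allI impI)
    fix t :: real assume "\<bar>0 - t\<bar> < e"
    then have "t \<in> {-e<..<e}"
      by (auto simp: abs_less_iff)
    then have "c t \<in> M"
      using c(1) by blast
    then have "norm (c 0 - z) \<le> norm (c t - z)"
      using nearestD(2)[OF assms] c(2) by (metis norm_minus_commute)
    then show "?h 0 \<le> ?h t"
      by (simp add: dot_square_norm power_mono)
  qed
  ultimately have "2 * ((y - z) \<bullet> w) = 0"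
    using e by (intro DERIV_local_min)
  then show "(z - y) \<bullet> w = 0"
    by (simp add: inner_diff_left)
qed

lemma nearest_prox_ineq:
  assumes "proximal_normals \<kappa> M" "y \<in> nearest M z" "w \<in> M"
  shows "(z - y) \<bullet> (w - y) \<le> \<kappa> * norm (z - y) * (norm (w - y))\<^sup>2"
  using assms nearest_normal[OF assms(2)] nearestD(1)[OF assms(2)] unfolding proximal_normals_def by blast

text \<open>Adding the proximal inequalities at the two nearest points shows that the metric projection is
  Lipschitz near \<open>M\<close>, with a constant close to one when both points are close to \<open>M\<close>.\<close>

lemma nearest_lipschitz:
  assumes prox: "proximal_normals \<kappa> M" and y: "y1 \<in> nearest M z1" "y2 \<in> nearest M z2"
  shows "(1 - \<kappa> * (norm (z1 - y1) + norm (z2 - y2))) * norm (y1 - y2) \<le> norm (z1 - z2)"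
proof (cases "y1 = y2")
  case False
  let ?D = "norm (y1 - y2)"
  have 1: "(z1 - y1) \<bullet> (y2 - y1) \<le> \<kappa> * norm (z1 - y1) * ?D\<^sup>2"
    using nearest_prox_ineq[OF prox y(1) nearestD(1)[OF y(2)]] by (simp add: norm_minus_commute)
  have 2: "(z2 - y2) \<bullet> (y1 - y2) \<le> \<kappa> * norm (z2 - y2) * ?D\<^sup>2"
    using nearest_prox_ineq[OF prox y(2) nearestD(1)[OF y(1)]] by simp
  have "?D\<^sup>2 = (z1 - z2) \<bullet> (y1 - y2) + (z1 - y1) \<bullet> (y2 - y1) + (z2 - y2) \<bullet> (y1 - y2)"
    by (simp add: power2_norm_eq_inner algebra_simps)
  also have "\<dots> \<le> norm (z1 - z2) * ?D + \<kappa> * norm (z1 - y1) * ?D\<^sup>2 + \<kappa> * norm (z2 - y2) * ?D\<^sup>2"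
    using 1 2 norm_cauchy_schwarz[of "z1 - z2" "y1 - y2"] by linarith
  finally have "?D * ((1 - \<kappa> * (norm (z1 - y1) + norm (z2 - y2))) * ?D) \<le> ?D * norm (z1 - z2)"
    by (simp add: power2_eq_square algebra_simps)
  then show ?thesis
    using False by simp
qed simp

section \<open>Orthogonal projections onto tangent spaces\<close>

lemma orth_proj_eqI:
  assumes "subspace S" "p \<in> S" "\<And>w. w \<in> S \<Longrightarrow> (v - p) \<bullet> w = 0"
  shows "orth_proj S v = p"
  unfolding orth_proj_def
proof (rule the_equality)
  fix q assume q: "q \<in> S \<and> (\<forall>w\<in>S. (v - q) \<bullet> w = 0)"
  have "q - p \<in> S"
    using q assms(1,2) by (intro subspace_diff) auto
  then have "(v - p) \<bullet> (q - p) = 0" "(v - q) \<bullet> (q - p) = 0"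
    using q assms(3) by auto
  then have "(q - p) \<bullet> (q - p) = 0"
    by (simp add: inner_diff_left)
  then show "q = p" by simp
qed (use assms in auto)

lemma orth_proj:
  assumes "subspace S"
  shows "orth_proj S v \<in> S" "w \<in> S \<Longrightarrow> (v - orth_proj S v) \<bullet> w = 0"
proof -
  obtain y z where yz: "y \<in> span S" "\<And>w. w \<in> span S \<Longrightarrow> orthogonal z w" "v = y + z"
    using orthogonal_subspace_decomp_exists[of S v] by metis
  have "span S = S"
    using assms by (rule span_eq_iff[THEN iffD2])
  with yz have "orth_proj S v = y"
    by (intro orth_proj_eqI assms) (auto simp: orthogonal_def)
  with yz \<open>span S = S\<close> show "orth_proj S v \<in> S" "w \<in> S \<Longrightarrow> (v - orth_proj S v) \<bullet> w = 0"
    by (auto simp: orthogonal_def)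
qed

lemma orth_proj_id: "subspace S \<Longrightarrow> v \<in> S \<Longrightarrow> orth_proj S v = v"
  by (rule orth_proj_eqI) auto

lemma orth_proj_self_adjoint:
  assumes "subspace S"
  shows "orth_proj S v \<bullet> w = v \<bullet> orth_proj S w"
  using orth_proj(2)[OF assms orth_proj(1)[OF assms, of w], of v]
    orth_proj(2)[OF assms orth_proj(1)[OF assms, of v], of w]
  by (metis eq_iff_diff_eq_0 inner_commute inner_diff_left)

lemma bounded_linear_orth_proj:
  assumes "subspace S"
  shows "bounded_linear (orth_proj S)"
proof -
  have "linear (orth_proj S)"
  proof
    show "orth_proj S (v + w) = orth_proj S v + orth_proj S w" for v w
    proof (rule orth_proj_eqI[OF assms])
      show "orth_proj S v + orth_proj S w \<in> S"
        by (intro subspace_add orth_proj(1) assms)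
      show "(v + w - (orth_proj S v + orth_proj S w)) \<bullet> u = 0" if "u \<in> S" for u
        using orth_proj(2)[OF assms that, of v] orth_proj(2)[OF assms that, of w]
        by (simp add: inner_diff_left inner_add_left)
    qed
    show "orth_proj S (r *\<^sub>R v) = r *\<^sub>R orth_proj S v" for r v
    proof (rule orth_proj_eqI[OF assms])
      show "r *\<^sub>R orth_proj S v \<in> S"
        using assms orth_proj(1)[OF assms] by (rule subspace_scale)
      show "(r *\<^sub>R v - r *\<^sub>R orth_proj S v) \<bullet> u = 0" if "u \<in> S" for u
        using orth_proj(2)[OF assms that, of v] by (simp flip: scaleR_diff_right)
    qed
  qed
  then show ?thesis
    by (simp add: linear_conv_bounded_linear)
qed

lemma norm_orth_proj_le:
  assumes "subspace S"
  shows "norm (orth_proj S v) \<le> norm v"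
proof -
  have "(norm (orth_proj S v))\<^sup>2 = v \<bullet> orth_proj S v"
    using orth_proj(2)[OF assms orth_proj(1)[OF assms], of v v]
    by (simp add: power2_norm_eq_inner inner_diff_left)
  also have "\<dots> \<le> norm v * norm (orth_proj S v)"
    by (rule norm_cauchy_schwarz)
  finally show ?thesis
    by (cases "orth_proj S v = 0") (simp_all add: power2_eq_square)
qed

section \<open>Averaging over the blocks of a stack\<close>

definition center :: "('a::euclidean_space)^'n \<Rightarrow> 'a^'n" where
  "center x = x - (\<chi> i. mean x)"

lemma norm_stack_power2: "(norm (x :: ('a::euclidean_space)^'n))\<^sup>2 = (\<Sum>i\<in>UNIV. (norm (x $ i))\<^sup>2)"
  by (simp add: norm_vec_def L2_set_def sum_nonneg)

lemma norm_stack_le: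
  assumes "\<And>i. norm (x $ i) \<le> c * norm (y $ i)" "c \<ge> 0"
  shows "norm (x :: ('a::euclidean_space)^'n) \<le> c * norm (y :: ('b::euclidean_space)^'n)"
proof -
  have "(norm x)\<^sup>2 \<le> (\<Sum>i\<in>UNIV. (c * norm (y $ i))\<^sup>2)"
    unfolding norm_stack_power2 using assms by (intro sum_mono power_mono) auto
  also have "\<dots> = (c * norm y)\<^sup>2"
    by (simp add: norm_stack_power2 power_mult_distrib sum_distrib_left)
  finally show ?thesis
    by (rule power2_le_imp_le) (use assms(2) in simp)
qed

lemma mean_add: "mean (x + y) = mean x + mean y"
  by (simp add: mean_def sum.distrib scaleR_add_right)

lemma mean_diff: "mean (x - y) = mean x - mean y"
  by (simp add: mean_def sum_subtractf scaleR_diff_right)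

lemma mean_scaleR: "mean (c *\<^sub>R x) = c *\<^sub>R mean x"
  by (simp add: mean_def scaleR_sum_right[symmetric] mult.commute)

lemma mean_const [simp]: "mean ((\<chi> i. y) :: ('a::euclidean_space)^'n) = y"
  by (simp add: mean_def sum_constant_scaleR)

lemma center_add: "center (x + y) = center x + center y"
  by (simp add: center_def mean_add vec_eq_iff)

lemma center_scaleR: "center (c *\<^sub>R x) = c *\<^sub>R center x"
  by (simp add: center_def mean_scaleR vec_eq_iff scaleR_diff_right)

lemma mean_center [simp]: "mean (center x) = 0"
  by (simp add: center_def mean_diff)

lemma sum_center_eq_0: "(\<Sum>i\<in>UNIV. x $ i - mean x) = 0" for x :: "('a::euclidean_space)^'n"
  using mean_center[of x] by (simp add: mean_def center_def)

text \<open>Pythagoras: deviations from the mean are orthogonal to constant stacks. So the mean is the best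
  constant approximation, and \<open>center\<close> measures the distance to consensus.\<close>

lemma norm_diff_const_power2:
  "(norm (x - (\<chi> i. y)))\<^sup>2 = (norm (center x))\<^sup>2 + real CARD('n) * (norm (mean x - y))\<^sup>2"
  for x :: "('a::euclidean_space)^'n"
proof -
  have "(norm (x $ i - y))\<^sup>2 =
      (norm (x $ i - mean x))\<^sup>2 + 2 * ((x $ i - mean x) \<bullet> (mean x - y)) + (norm (mean x - y))\<^sup>2" for i
    by (simp add: power2_norm_eq_inner algebra_simps inner_commute)
  then have "(norm (x - (\<chi> i. y)))\<^sup>2 = (\<Sum>i\<in>UNIV. (norm (x $ i - mean x))\<^sup>2)
      + 2 * ((\<Sum>i\<in>UNIV. x $ i - mean x) \<bullet> (mean x - y)) + real CARD('n) * (norm (mean x - y))\<^sup>2"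
    unfolding norm_stack_power2 inner_sum_left by (simp add: sum.distrib sum_distrib_left)
  then show ?thesis
    unfolding sum_center_eq_0 by (simp add: norm_stack_power2 center_def)
qed

lemma norm_center_le: "norm (center x) \<le> norm (x - (\<chi> i. y))" for x :: "('a::euclidean_space)^'n"
  by (rule power2_le_imp_le) (simp_all add: norm_diff_const_power2)

lemma norm_center_le_norm: "norm (center x) \<le> norm x" for x :: "('a::euclidean_space)^'n"
proof -
  have "(\<chi> i. 0) = (0 :: 'a^'n)"
    by (simp add: vec_eq_iff)
  then show ?thesis
    using norm_center_le[of x 0] by simp
qed

lemma norm_power2_mean: "(norm x)\<^sup>2 = (norm (center x))\<^sup>2 + real CARD('n) * (norm (mean x))\<^sup>2"
  for x :: "('a::euclidean_space)^'n"
proof -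
  have "(\<chi> i. 0) = (0 :: 'a^'n)"
    by (simp add: vec_eq_iff)
  then show ?thesis
    using norm_diff_const_power2[of x 0] by simp
qed

lemma norm_mean_le: "norm (mean x) \<le> norm x" for x :: "('a::euclidean_space)^'n"
proof (rule power2_le_imp_le)
  have "1 * (norm (mean x))\<^sup>2 \<le> real CARD('n) * (norm (mean x))\<^sup>2"
    by (intro mult_right_mono) (simp_all add: Suc_le_eq)
  then show "(norm (mean x))\<^sup>2 \<le> (norm x)\<^sup>2"
    unfolding norm_power2_mean[of x] using zero_le_power2[of "norm (center x)"] by linarith
qed simp

section \<open>The mixing matrix contracts the disagreement\<close>

lemma mix_add: "mix W (x + y) = mix W x + mix W y"
  by (simp add: mix_def vec_eq_iff scaleR_add_right sum.distrib)

lemma mix_diff: "mix W (x - y) = mix W x - mix W y"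
  by (simp add: mix_def vec_eq_iff scaleR_diff_right sum_subtractf)

lemma mix_const:
  assumes "doubly_stochastic W"
  shows "mix W (\<chi> i. y) = (\<chi> i. y)"
  using assms by (simp add: mix_def vec_eq_iff doubly_stochastic_def flip: scaleR_left.sum)

lemma mean_mix:
  assumes "doubly_stochastic W"
  shows "mean (mix W x) = mean x"
proof -
  have "(\<Sum>i\<in>UNIV. \<Sum>j\<in>UNIV. W $ i $ j *\<^sub>R x $ j) = (\<Sum>j\<in>UNIV. \<Sum>i\<in>UNIV. W $ i $ j *\<^sub>R x $ j)"
    by (rule sum.swap)
  also have "\<dots> = (\<Sum>j\<in>UNIV. x $ j)"
    using assms by (simp add: doubly_stochastic_def flip: scaleR_left.sum)
  finally show ?thesis
    by (simp add: mean_def mix_def)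
qed

lemma mix_real: "mix W x = W *v x" for x :: "real^'n"
  by (simp add: mix_def matrix_vector_mult_def)

text \<open>Statements about norms of mixed stacks reduce to real stacks by reading off coordinates.\<close>

lemma norm_stack_power2_coords:
  "(norm x)\<^sup>2 = (\<Sum>b\<in>Basis. (norm ((\<chi> i. x $ i \<bullet> b) :: real^'n))\<^sup>2)" for x :: "('a::euclidean_space)^'n"
proof -
  have "(norm x)\<^sup>2 = (\<Sum>i\<in>UNIV. \<Sum>b\<in>Basis. (x $ i \<bullet> b)\<^sup>2)"
    unfolding norm_stack_power2
    by (intro sum.cong refl) (simp only: power2_norm_eq_inner, subst euclidean_inner, simp add: power2_eq_square)
  also have "\<dots> = (\<Sum>b\<in>Basis. \<Sum>i\<in>UNIV. (x $ i \<bullet> b)\<^sup>2)"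
    by (rule sum.swap)
  finally show ?thesis
    by (simp add: norm_stack_power2)
qed

lemma mix_coord: "(\<chi> i. mix W x $ i \<bullet> b) = W *v (\<chi> i. x $ i \<bullet> b)"
  by (simp add: mix_def matrix_vector_mult_def inner_sum_left)

lemma norm_mix_le_coords:
  assumes "\<And>b. b \<in> Basis \<Longrightarrow> norm (W *v (\<chi> i. x $ i \<bullet> b)) \<le> c * norm ((\<chi> i. x $ i \<bullet> b) :: real^'n)" "c \<ge> 0"
  shows "norm (mix W x) \<le> c * norm (x :: ('a::euclidean_space)^'n)"
proof -
  have "(norm (mix W x))\<^sup>2 \<le> (\<Sum>b\<in>Basis. (c * norm ((\<chi> i. x $ i \<bullet> b) :: real^'n))\<^sup>2)"
    unfolding norm_stack_power2_coords[of "mix W x"] mix_coord using assms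
    by (intro sum_mono power_mono) auto
  also have "\<dots> = (c * norm x)\<^sup>2"
    by (simp add: norm_stack_power2_coords[of x] power_mult_distrib sum_distrib_left)
  finally show ?thesis
    by (rule power2_le_imp_le) (use assms(2) in simp)
qed

text \<open>Each block of \<open>W x\<close> is a convex combination, so Jensen's inequality bounds its square, and the
  column sums add the bounds up to the square of \<open>x\<close>.\<close>

lemma norm_doubly_stochastic_le:
  assumes "doubly_stochastic W"
  shows "norm (W *v x) \<le> norm (x :: real^'n)"
proof (rule power2_le_imp_le)
  have W: "\<And>i j. W $ i $ j \<ge> 0" "\<And>i. (\<Sum>j\<in>UNIV. W $ i $ j) = 1" "\<And>j. (\<Sum>i\<in>UNIV. W $ i $ j) = 1"
    using assms by (auto simp: doubly_stochastic_def)
  have "(\<Sum>j\<in>UNIV. W $ i $ j * x $ j)\<^sup>2 \<le> (\<Sum>j\<in>UNIV. W $ i $ j * (x $ j)\<^sup>2)" for i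
  proof -
    let ?m = "\<Sum>j\<in>UNIV. W $ i $ j * x $ j"
    have "0 \<le> (\<Sum>j\<in>UNIV. W $ i $ j * (x $ j - ?m)\<^sup>2)"
      using W(1) by (intro sum_nonneg) auto
    also have "\<dots> = (\<Sum>j\<in>UNIV. W $ i $ j * (x $ j)\<^sup>2 - 2 * ?m * (W $ i $ j * x $ j) + ?m\<^sup>2 * W $ i $ j)"
      by (intro sum.cong refl) (simp add: power2_diff algebra_simps)
    also have "\<dots> = (\<Sum>j\<in>UNIV. W $ i $ j * (x $ j)\<^sup>2) - 2 * ?m * ?m + ?m\<^sup>2 * (\<Sum>j\<in>UNIV. W $ i $ j)"
      by (simp only: sum.distrib sum_subtractf flip: sum_distrib_left)
    finally show ?thesis
      using W(2) by (simp add: power2_eq_square)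
  qed
  then have "(norm (W *v x))\<^sup>2 \<le> (\<Sum>i\<in>UNIV. \<Sum>j\<in>UNIV. W $ i $ j * (x $ j)\<^sup>2)"
    unfolding norm_stack_power2 by (intro sum_mono) (simp add: matrix_vector_mult_def)
  also have "\<dots> = (\<Sum>j\<in>UNIV. \<Sum>i\<in>UNIV. W $ i $ j * (x $ j)\<^sup>2)"
    by (rule sum.swap)
  also have "\<dots> = (norm x)\<^sup>2"
    using W(3) by (simp add: norm_stack_power2 flip: sum_distrib_right)
  finally show "(norm (W *v x))\<^sup>2 \<le> (norm x)\<^sup>2" .
qed simp

lemma norm_mix_le:
  assumes "doubly_stochastic W"
  shows "norm (mix W x) \<le> norm x"
  using norm_mix_le_coords[of W x 1] norm_doubly_stochastic_le[OF assms] by simp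

lemma count_singular_values:
  assumes "is_singular_value A s"
  shows "count (singular_values A) s = dim {v. (transpose A ** A) *v v = s\<^sup>2 *\<^sub>R v}"
  using assms finite_singular_values[of A]
  by (simp add: singular_values_def count_sum if_distrib[where f = "\<lambda>m. count m s"] sum.delta' cong: if_cong)

lemma count_list_descending:
  fixes l :: "real list"
  assumes "sorted_wrt (\<ge>) l" "length l \<ge> 2" "l ! 1 < s"
  shows "count (mset l) s \<le> 1"
proof -
  obtain a b r where l: "l = a # b # r"
    using assms(2) by (metis One_nat_def Suc_1 Suc_le_length_iff)
  then have "s \<notin> set (b # r)"
    using assms by fastforce
  then have "count (mset (b # r)) s = 0"
    by (metis count_eq_zero_iff set_mset_mset)
  then show ?thesis
    using l by simp
qed

text \<open>A singular value of multiplicity two fills two places of the descending list.\<close>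

lemma second_singular_value_ge:
  assumes "is_singular_value A s" "dim {v. (transpose A ** A) *v v = s\<^sup>2 *\<^sub>R v} \<ge> 2"
  shows "second_singular_value A \<ge> s"
proof (rule ccontr)
  assume small: "\<not> ?thesis"
  let ?l = "rev (sorted_list_of_multiset (singular_values A))"
  have m: "mset ?l = singular_values A"
    by simp
  have c: "count (mset ?l) s \<ge> 2"
    using assms by (simp add: m count_singular_values)
  then have "length ?l \<ge> 2"
    by (metis count_le_size order_trans size_mset)
  moreover have "sorted_wrt (\<ge>) ?l"
    by (simp add: sorted_wrt_rev)
  ultimately have "count (mset ?l) s \<le> 1"
    using small by (intro count_list_descending) (auto simp: second_singular_value_def)
  with c show False by simp
qed

text \<open>Among the vectors of mean zero on the unit sphere there is one whose image is longest. If that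
  image had norm one, the vector would be fixed by \<open>W\<^sup>T W\<close> just as the constant vector is, and the
  second singular value would be at least one.\<close>

lemma mixing_contraction_real:
  fixes W :: "real^'n^'n"
  assumes "mixing_matrix W"
  obtains \<sigma> where "0 \<le> \<sigma>" "\<sigma> < 1" "\<And>v. mean v = 0 \<Longrightarrow> norm (W *v v) \<le> \<sigma> * norm v"
proof -
  have ds: "doubly_stochastic W" and sv: "second_singular_value W < 1"
    using assms by (auto simp: mixing_matrix_def)
  let ?B = "transpose W ** W" and ?Z = "{v :: real^'n. mean v = 0} \<inter> sphere 0 1"
  have dot: "(?B *v x) \<bullet> y = (W *v x) \<bullet> (W *v y)" for x y
    by (simp only: matrix_vector_mul_assoc[symmetric] transpose_matrix_vector dot_lmul_matrix)
  have lin_mean: "linear (mean :: real^'n \<Rightarrow> real)"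
    by (rule linearI) (simp_all add: mean_add mean_scaleR)
  have "closed {v :: real^'n. mean v = 0}"
    by (intro closed_Collect_eq linear_continuous_on linear_conv_bounded_linear[THEN iffD1] lin_mean
        continuous_intros)
  then have "compact ?Z"
    by (simp add: compact_Int_closed inf_commute closed_Int_compact)
  show thesis
  proof (cases "?Z = {}")
    case True
    have "norm (W *v v) \<le> 0 * norm v" if "mean v = 0" for v :: "real^'n"
    proof (cases "v = 0")
      case False
      then have "(1 / norm v) *\<^sub>R v \<in> ?Z"
        using that by (simp add: mean_scaleR)
      with True show ?thesis by blast
    qed simp
    then show thesis
      by (intro that[of 0]) auto
  next
    case False
    have "continuous_on ?Z (\<lambda>v. norm (W *v v))"
      by (intro continuous_intros matrix_vector_mult_linear_continuous_on)
    then obtain v0 where v0: "v0 \<in> ?Z" "\<And>v. v \<in> ?Z \<Longrightarrow> norm (W *v v) \<le> norm (W *v v0)"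
      using continuous_attains_sup[OF \<open>compact ?Z\<close> False] by blast
    have "norm (W *v v0) < 1"
    proof (rule ccontr)
      assume "\<not> ?thesis"
      then have n1: "norm (W *v v0) = 1"
        using norm_doubly_stochastic_le[OF ds, of v0] v0(1) by simp
      have "norm (?B *v v0) \<le> 1"
      proof -
        have "(norm (?B *v v0))\<^sup>2 = (W *v v0) \<bullet> (W *v (?B *v v0))"
          by (simp add: power2_norm_eq_inner dot)
        also have "\<dots> \<le> norm (W *v v0) * norm (W *v (?B *v v0))"
          by (rule norm_cauchy_schwarz)
        also have "\<dots> \<le> 1 * norm (?B *v v0)"
          using n1 norm_doubly_stochastic_le[OF ds] by simp
        finally show ?thesis
          by (cases "?B *v v0 = 0") (simp_all add: power2_eq_square)
      qed
      moreover have "(?B *v v0) \<bullet> v0 = 1"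
        using n1 by (simp add: dot dot_square_norm)
      moreover have "(norm (?B *v v0 - v0))\<^sup>2 = (norm (?B *v v0))\<^sup>2 - 2 * ((?B *v v0) \<bullet> v0) + (norm v0)\<^sup>2"
        by (simp add: power2_norm_eq_inner algebra_simps inner_commute)
      ultimately have "(norm (?B *v v0 - v0))\<^sup>2 \<le> 0"
        using v0(1) power_mono[of "norm (?B *v v0)" 1 2] by simp
      then have fix0: "?B *v v0 = v0"
        by simp
      let ?E = "{v. ?B *v v = 1\<^sup>2 *\<^sub>R v}" and ?o = "(\<chi> i. 1) :: real^'n"
      have o: "W *v ?o = ?o"
        using mix_const[OF ds, of "1::real"] by (simp add: mix_real)
      moreover have "transpose W = W"
        using assms by (simp add: mixing_matrix_def)
      ultimately have "?o \<in> ?E"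
        by (simp flip: matrix_vector_mul_assoc)
      moreover have "v0 \<in> ?E"
        using fix0 by simp
      moreover have "v0 \<notin> span {?o}"
      proof
        assume "v0 \<in> span {?o}"
        then obtain k where k: "v0 = k *\<^sub>R ?o"
          by (auto simp: span_singleton)
        then have "k = 0"
          using v0(1) by (simp add: mean_scaleR)
        then show False using k v0(1) by simp
      qed
      moreover have "?o \<noteq> 0"
        by (simp add: vec_eq_iff)
      ultimately have ind: "independent {v0, ?o}" and sub: "{v0, ?o} \<subseteq> ?E"
        by (auto simp: independent_insert)
      have "v0 \<noteq> ?o"
        using \<open>v0 \<notin> span {?o}\<close> span_base by blast
      then have "2 = card {v0, ?o}"
        by simp
      also have "\<dots> \<le> dim ?E"
        by (rule independent_card_le_dim[OF sub ind])
      finally have "2 \<le> dim ?E" .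
      moreover have "is_singular_value W 1"
        using fix0 v0(1) by (auto simp: is_singular_value_def is_eigenvalue_def intro!: exI[of _ v0])
      ultimately show False
        using second_singular_value_ge[of W 1] sv by simp
    qed
    moreover have "norm (W *v v) \<le> norm (W *v v0) * norm v" if "mean v = 0" for v :: "real^'n"
    proof (cases "v = 0")
      case False
      then have "(1 / norm v) *\<^sub>R v \<in> ?Z"
        using that by (simp add: mean_scaleR)
      then have "norm (W *v ((1 / norm v) *\<^sub>R v)) \<le> norm (W *v v0)"
        by (rule v0(2))
      then show ?thesis
        using False by (simp add: matrix_vector_mult_scaleR field_simps)
    qed simp
    ultimately show thesis
      by (intro that[of "norm (W *v v0)"]) auto
  qed
qed

definition mixing_gap :: "real \<Rightarrow> real^'n^'n \<Rightarrow> bool" where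
  "mixing_gap r W \<longleftrightarrow> doubly_stochastic W \<and> 0 < r \<and> r \<le> 1 \<and>
     (\<forall>v. mean v = 0 \<longrightarrow> norm (W *v v) \<le> (1 - r) * norm v)"

lemma ex_mixing_gap:
  assumes "mixing_matrix W"
  obtains r where "mixing_gap r W"
proof -
  obtain \<sigma> where "0 \<le> \<sigma>" "\<sigma> < 1" "\<And>v. mean v = 0 \<Longrightarrow> norm (W *v v) \<le> \<sigma> * norm v"
    by (rule mixing_contraction_real[OF assms]) blast
  moreover have "doubly_stochastic W"
    using assms by (simp add: mixing_matrix_def)
  ultimately show thesis
    by (intro that[of "1 - \<sigma>"]) (auto simp: mixing_gap_def)
qed

lemma norm_mix_mean_zero_le:
  fixes y :: "('a::euclidean_space)^'n"
  assumes gap: "mixing_gap r W" and y: "mean y = 0"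
  shows "norm (mix W y) \<le> (1 - r) * norm y"
proof (rule norm_mix_le_coords)
  fix b :: 'a
  have "mean (\<chi> i. y $ i \<bullet> b) = mean y \<bullet> b"
    by (simp add: mean_def inner_sum_left)
  then show "norm (W *v (\<chi> i. y $ i \<bullet> b)) \<le> (1 - r) * norm (\<chi> i. y $ i \<bullet> b)"
    using gap y by (simp add: mixing_gap_def)
qed (use gap in \<open>simp add: mixing_gap_def\<close>)

section \<open>The mean of points of a manifold and its nearest point\<close>

text \<open>The mean is closer to the manifold than to the points by an order: averaging the proximal
  inequalities at the nearest point leaves only the quadratic right hand sides.\<close>

lemma mean_to_nearest_le:
  fixes x :: "('a::euclidean_space)^'n"
  assumes p: "p \<in> nearest M (mean x)" and x: "x \<in> stack_pow M"
  shows "real CARD('n) * (norm (mean x - p))\<^sup>2 \<le> (norm (center x))\<^sup>2"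
    and "(norm (x - (\<chi> i. p)))\<^sup>2 \<le> 2 * (norm (center x))\<^sup>2"
    and "proximal_normals \<kappa> M \<Longrightarrow> norm (mean x - p) \<le> 2 * \<kappa> * (norm (center x))\<^sup>2"
proof -
  let ?n = "real CARD('n)"
  have xM: "x $ i \<in> M" for i
    using x by (simp add: stack_pow_def)
  have "norm (mean x - p) \<le> norm (x $ i - mean x)" for i
    using nearestD(2)[OF p xM] by (metis norm_minus_commute)
  then have "(\<Sum>i\<in>(UNIV::'n set). (norm (mean x - p))\<^sup>2) \<le> (\<Sum>i\<in>UNIV. (norm (x $ i - mean x))\<^sup>2)"
    by (intro sum_mono power_mono) auto
  then show 1: "?n * (norm (mean x - p))\<^sup>2 \<le> (norm (center x))\<^sup>2"
    by (simp add: norm_stack_power2 center_def)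
  then show 2: "(norm (x - (\<chi> i. p)))\<^sup>2 \<le> 2 * (norm (center x))\<^sup>2"
    by (simp add: norm_diff_const_power2)
  assume prox: "proximal_normals \<kappa> M"
  then have \<kappa>: "\<kappa> > 0" by (simp add: proximal_normals_def)
  let ?d = "norm (mean x - p)"
  have "?n * ?d\<^sup>2 = (\<Sum>i\<in>UNIV. (mean x - p) \<bullet> (x $ i - p))"
  proof -
    have "(\<Sum>i\<in>UNIV. (mean x - p) \<bullet> (x $ i - p)) = (mean x - p) \<bullet> (\<Sum>i\<in>UNIV. (x $ i - mean x) + (mean x - p))"
      by (simp add: inner_sum_right)
    also have "\<dots> = ?n * ?d\<^sup>2"
      by (simp only: sum.distrib sum_center_eq_0)
        (simp add: sum_constant_scaleR power2_norm_eq_inner)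
    finally show ?thesis by simp
  qed
  also have "\<dots> \<le> (\<Sum>i\<in>UNIV. \<kappa> * ?d * (norm (x $ i - p))\<^sup>2)"
    by (intro sum_mono nearest_prox_ineq[OF prox p xM])
  also have "\<dots> = \<kappa> * ?d * (norm (x - (\<chi> i. p)))\<^sup>2"
    by (simp add: norm_stack_power2 sum_distrib_left)
  also have "\<dots> \<le> \<kappa> * ?d * (2 * (norm (center x))\<^sup>2)"
    using 2 \<kappa> by (intro mult_left_mono) auto
  finally have "?d * (?n * ?d) \<le> ?d * (2 * \<kappa> * (norm (center x))\<^sup>2)"
    by (simp add: power2_eq_square mult_ac)
  then have "?n * ?d \<le> 2 * \<kappa> * (norm (center x))\<^sup>2 \<or> ?d = 0"
    by (auto simp: mult_le_cancel_left)
  moreover have "1 * ?d \<le> ?n * ?d"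
    by (intro mult_right_mono) (simp_all add: Suc_le_eq)
  ultimately show "?d \<le> 2 * \<kappa> * (norm (center x))\<^sup>2"
    using \<kappa> by auto
qed

section \<open>Gossip with compressed communication\<close>

text \<open>The averaging uses the surrogates \<open>xt\<close> instead of the true values, so it contracts the
  disagreement up to the compression error, and it only ever sees differences between blocks.\<close>

lemma gossip_step:
  fixes x xt :: "('a::euclidean_space)^'n"
  assumes gap: "mixing_gap r W" and g: "0 < \<gamma>" "\<gamma> \<le> 1"
  defines "y \<equiv> x + \<gamma> *\<^sub>R (mix W xt - xt)"
  shows "norm (center y) \<le> (1 - \<gamma> * r) * norm (center x) + 2 * \<gamma> * norm (x - xt)"
    and "norm (y - x) \<le> 2 * \<gamma> * (norm (center x) + norm (x - xt))"
    and "mean y = mean x"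
proof -
  have ds: "doubly_stochastic W"
    using gap by (simp add: mixing_gap_def)
  let ?c = "center x" and ?w = "xt - x"
  have mixx: "mix W x - x = mix W ?c - ?c"
    by (simp add: center_def mix_diff mix_const[OF ds])
  have W2: "norm (mix W v - v) \<le> 2 * norm v" for v :: "'a^'n"
    using norm_triangle_ineq4[of "mix W v" v] norm_mix_le[OF ds, of v] by linarith
  have split: "mix W xt - xt = (mix W ?c - ?c) + (mix W ?w - ?w)"
    unfolding mixx[symmetric] by (simp add: mix_diff)
  have "norm (mix W xt - xt) \<le> 2 * norm ?c + 2 * norm ?w"
    unfolding split using W2 by (intro norm_triangle_mono)
  then have "norm (mix W xt - xt) \<le> 2 * (norm (center x) + norm (x - xt))"
    by (simp add: norm_minus_commute)
  then show "norm (y - x) \<le> 2 * \<gamma> * (norm (center x) + norm (x - xt))"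
    using g(1) by (simp add: y_def mult_ac)
  show "mean y = mean x"
    by (simp add: y_def mean_add mean_scaleR mean_diff mean_mix[OF ds])
  have cc: "center v = v" if "mean v = 0" for v :: "'a^'n"
    using that by (simp add: center_def vec_eq_iff)
  have "center y = ((1 - \<gamma>) *\<^sub>R ?c + \<gamma> *\<^sub>R mix W ?c) + \<gamma> *\<^sub>R (mix W ?w - ?w)"
  proof -
    have "center y = center x + \<gamma> *\<^sub>R center (mix W xt - xt)"
      by (simp add: y_def center_add center_scaleR)
    also have "center (mix W xt - xt) = mix W xt - xt"
      by (rule cc) (simp add: mean_diff mean_mix[OF ds])
    finally show ?thesis
      unfolding split by (simp add: algebra_simps)
  qed
  also have "norm \<dots> \<le> norm ((1 - \<gamma>) *\<^sub>R ?c + \<gamma> *\<^sub>R mix W ?c) + norm (\<gamma> *\<^sub>R (mix W ?w - ?w))"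
    by (rule norm_triangle_ineq)
  also have "norm ((1 - \<gamma>) *\<^sub>R ?c + \<gamma> *\<^sub>R mix W ?c) \<le> (1 - \<gamma>) * norm ?c + \<gamma> * norm (mix W ?c)"
    using norm_triangle_ineq[of "(1 - \<gamma>) *\<^sub>R ?c" "\<gamma> *\<^sub>R mix W ?c"] g by simp
  also have "\<gamma> * norm (mix W ?c) \<le> \<gamma> * ((1 - r) * norm ?c)"
    using norm_mix_mean_zero_le[OF gap mean_center] g by (intro mult_left_mono) auto
  also have "norm (\<gamma> *\<^sub>R (mix W ?w - ?w)) \<le> \<gamma> * (2 * norm ?w)"
    using W2[of ?w] g by simp
  finally show "norm (center y) \<le> (1 - \<gamma> * r) * norm (center x) + 2 * \<gamma> * norm (x - xt)"
    by (simp add: algebra_simps norm_minus_commute)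
qed

lemma compression_error_le:
  assumes "compressor \<alpha> C"
  shows "norm (y - (xt + C (y - xt))) \<le> (1 - \<alpha> / 2) * (norm (x - xt) + norm (y - x))"
proof -
  have \<alpha>: "0 < \<alpha>" "\<alpha> \<le> 1" and c: "(norm (C v - v))\<^sup>2 \<le> (1 - \<alpha>) * (norm v)\<^sup>2" for v
    using assms by (auto simp: compressor_def)
  have "(1 - \<alpha>) * (norm (y - xt))\<^sup>2 \<le> (1 - \<alpha> / 2)\<^sup>2 * (norm (y - xt))\<^sup>2"
    by (intro mult_right_mono) (simp_all add: power2_eq_square algebra_simps)
  with c[of "y - xt"] have "(norm (C (y - xt) - (y - xt)))\<^sup>2 \<le> ((1 - \<alpha> / 2) * norm (y - xt))\<^sup>2"
    by (simp add: power_mult_distrib)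
  then have "norm (C (y - xt) - (y - xt)) \<le> (1 - \<alpha> / 2) * norm (y - xt)"
    by (rule power2_le_imp_le) (use \<alpha> in simp)
  also have "\<dots> \<le> (1 - \<alpha> / 2) * (norm (x - xt) + norm (y - x))"
    using norm_triangle_ineq[of "x - xt" "y - x"] \<alpha> by (intro mult_left_mono) auto
  also have "norm (C (y - xt) - (y - xt)) = norm (y - (xt + C (y - xt)))"
    by (subst norm_minus_commute) (simp add: algebra_simps)
  finally show ?thesis .
qed

text \<open>Disagreement \<open>e\<close> and compression error \<open>a\<close> feed each other. Weighting \<open>a\<close> with a small multiple of
  the spectral gap makes its influence on \<open>e\<close> harmless: \<open>a\<close> contracts at the fixed rate \<open>\<alpha> / 2\<close>, while the
  couplings carry a factor \<open>\<gamma>\<close>, which is small against \<open>\<alpha> r\<close>.\<close>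

lemma coupled_contraction:
  fixes e a h :: real
  assumes r: "0 < r" "r \<le> 1" and \<alpha>: "\<alpha> \<le> 1" and \<gamma>: "0 < \<gamma>" "200 * \<gamma> \<le> \<alpha> * r"
    and nonneg: "0 \<le> e" "0 \<le> a" "0 \<le> h"
    and e': "e' \<le> (1 - \<gamma> * r / 2) * e + 4 * \<gamma> * a + 2 * h"
    and a': "a' \<le> (1 - \<alpha> / 2) * a + 4 * \<gamma> * (e + a) + 2 * h"
  shows "e' + r / 16 * a' \<le> (1 - \<gamma> * r / 4) * (e + r / 16 * a) + 3 * h"
proof -
  have "r / 16 * a' \<le> r / 16 * ((1 - \<alpha> / 2) * a + 4 * \<gamma> * (e + a) + 2 * h)"
    using a' r by (intro mult_left_mono) auto
  then have "e' + r / 16 * a' \<le> (1 - \<gamma> * r / 4) * e + r / 16 * a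
      + (4 * \<gamma> - \<alpha> * r / 32 + \<gamma> * r / 4) * a + (2 + r / 8) * h"
    using e' by (simp add: algebra_simps)
  moreover have "(4 * \<gamma> - \<alpha> * r / 32 + \<gamma> * r / 4) * a \<le> - (\<gamma> * r / 4 * (r / 16)) * a"
  proof (rule mult_right_mono)
    have "\<gamma> * r \<le> \<gamma>"
      using r \<gamma> by simp
    moreover have "\<gamma> * r * r \<le> \<gamma> * r"
      using r \<gamma> by simp
    moreover have "\<gamma> * r / 4 * (r / 16) = \<gamma> * r * r / 64"
      by simp
    ultimately show "4 * \<gamma> - \<alpha> * r / 32 + \<gamma> * r / 4 \<le> - (\<gamma> * r / 4 * (r / 16))"
      using \<gamma> by linarith
  qed (rule nonneg)
  moreover have "(2 + r / 8) * h \<le> 3 * h"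
    using r nonneg by (intro mult_right_mono) auto
  ultimately show ?thesis
    by (simp add: field_simps)
qed

lemma perturbed_contraction_square:
  fixes E h :: real
  assumes \<theta>: "0 < \<theta>" "\<theta> \<le> 1" and "0 \<le> E" "0 \<le> h" "0 \<le> E'" and step: "E' \<le> (1 - \<theta>) * E + 3 * h"
  shows "E'\<^sup>2 \<le> (1 - \<theta>) * E\<^sup>2 + 9 / \<theta> * h\<^sup>2"
proof -
  define z where "z = 3 * h / \<theta>"
  \<comment> \<open>The right hand side of the step is a convex combination of \<open>E\<close> and \<open>z\<close>.\<close>
  have h: "3 * h = \<theta> * z"
    using \<theta> by (simp add: z_def)
  have "E'\<^sup>2 \<le> ((1 - \<theta>) * E + \<theta> * z)\<^sup>2"
    using step assms(5) unfolding h by (intro power_mono) auto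
  also have "\<dots> = (1 - \<theta>) * E\<^sup>2 + \<theta> * z\<^sup>2 - (1 - \<theta>) * \<theta> * (E - z)\<^sup>2"
    by (simp add: power2_eq_square algebra_simps)
  also have "\<dots> \<le> (1 - \<theta>) * E\<^sup>2 + \<theta> * z\<^sup>2"
    using \<theta> by simp
  also have "\<theta> * z\<^sup>2 = 9 / \<theta> * h\<^sup>2"
    using \<theta> by (simp add: z_def power2_eq_square)
  finally show ?thesis .
qed

lemma perturbed_contraction_sum:
  fixes E h :: "nat \<Rightarrow> real"
  assumes \<theta>: "0 < \<theta>" "\<theta> \<le> 1" and nonneg: "\<And>k. 0 \<le> E k" "\<And>k. 0 \<le> h k"
    and step: "\<And>k. E (Suc k) \<le> (1 - \<theta>) * E k + 3 * h k"
  shows "\<theta> * (\<Sum>k<K. (E k)\<^sup>2) \<le> (E 0)\<^sup>2 + 9 / \<theta> * (\<Sum>k<K. (h k)\<^sup>2)"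
proof -
  have "\<theta> * (\<Sum>k<K. (E k)\<^sup>2) + (E K)\<^sup>2 \<le> (E 0)\<^sup>2 + 9 / \<theta> * (\<Sum>k<K. (h k)\<^sup>2)"
  proof (induction K)
    case (Suc K)
    then show ?case
      using perturbed_contraction_square[OF \<theta> nonneg nonneg(1) step, of K]
      by (simp add: algebra_simps)
  qed simp
  then show ?thesis
    using zero_le_power2[of "E K"] by linarith
qed

lemma perturbed_contraction_bound:
  fixes E E' h :: real
  assumes "\<theta> \<le> 1" "E \<le> b" "3 * h \<le> \<theta> * b" "E' \<le> (1 - \<theta>) * E + 3 * h"
  shows "E' \<le> b"
proof -
  have "(1 - \<theta>) * E \<le> (1 - \<theta>) * b"
    using assms by (intro mult_left_mono) auto
  then show ?thesis
    using assms by (simp add: algebra_simps)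
qed

section \<open>Smooth objectives restricted to the manifold\<close>

lemma GDERIV_gradient:
  assumes "f differentiable (at x)"
  shows "GDERIV f x :> gradient f x"
  unfolding gradient_def
proof (rule theI')
  obtain D where D: "(f has_derivative D) (at x)"
    using assms by (auto simp: differentiable_def)
  then have lin: "linear D"
    by (rule has_derivative_linear)
  let ?g = "\<Sum>b\<in>Basis. D b *\<^sub>R b"
  have "D h = h \<bullet> ?g" for h
  proof -
    have "D h = D (\<Sum>b\<in>Basis. (h \<bullet> b) *\<^sub>R b)"
      by (simp add: euclidean_representation)
    also have "\<dots> = (\<Sum>b\<in>Basis. (h \<bullet> b) * D b)"
      by (simp add: linear_sum[OF lin] linear_cmul[OF lin])
    finally show ?thesis
      by (simp add: inner_sum_right mult.commute)
  qed
  then have "D = (\<lambda>h. h \<bullet> ?g)"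
    by (rule ext)
  with D have "GDERIV f x :> ?g"
    by (simp add: gderiv_def)
  then show "\<exists>!D. GDERIV f x :> D"
  proof (rule ex1I)
    fix D' assume "GDERIV f x :> D'"
    then have "(\<lambda>h. h \<bullet> D') = (\<lambda>h. h \<bullet> ?g)"
      using \<open>GDERIV f x :> ?g\<close> unfolding gderiv_def by (rule has_derivative_unique)
    then have "h \<bullet> D' = h \<bullet> ?g" for h
      by meson
    then show "D' = ?g"
      by (metis euclidean_eqI inner_commute)
  qed
qed

lemma lipschitz_gradient_quadratic:
  assumes d: "\<And>x. f differentiable (at x)" and lip: "\<And>x y. norm (gradient f x - gradient f y) \<le> c * norm (x - y)"
  shows "\<bar>f y - f x - gradient f x \<bullet> (y - x)\<bar> \<le> \<bar>c\<bar> * (norm (y - x))\<^sup>2"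
proof -
  have "norm (f y - f x - (y - x) \<bullet> gradient f x) \<le> norm (y - x) * (\<bar>c\<bar> * norm (y - x))"
  proof (rule differentiable_bound_linearization[where S = "closed_segment x y"
        and f' = "\<lambda>z h. h \<bullet> gradient f z"])
    show "x + t *\<^sub>R (y - x) \<in> closed_segment x y" if "t \<in> {0..1}" for t
      using that by (auto simp: in_segment algebra_simps intro!: exI[of _ t])
    show "(f has_derivative (\<lambda>h. h \<bullet> gradient f z)) (at z within closed_segment x y)" for z
      using GDERIV_gradient[OF d, of z] unfolding gderiv_def by (rule has_derivative_at_withinI)
    show "onorm ((\<lambda>h. h \<bullet> gradient f z) - (\<lambda>h. h \<bullet> gradient f x)) \<le> \<bar>c\<bar> * norm (y - x)"
      if z: "z \<in> closed_segment x y" for z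
    proof (rule onorm_le)
      fix h
      have "norm (((\<lambda>h. h \<bullet> gradient f z) - (\<lambda>h. h \<bullet> gradient f x)) h) = \<bar>h \<bullet> (gradient f z - gradient f x)\<bar>"
        by (simp add: inner_diff_right)
      also have "\<dots> \<le> norm h * norm (gradient f z - gradient f x)"
        by (rule Cauchy_Schwarz_ineq2)
      also have "\<dots> \<le> norm h * (\<bar>c\<bar> * norm (y - x))"
      proof (rule mult_left_mono)
        have "norm (gradient f z - gradient f x) \<le> c * norm (z - x)"
          by (rule lip)
        also have "\<dots> \<le> \<bar>c\<bar> * norm (z - x)"
          by (intro mult_right_mono) auto
        also have "\<dots> \<le> \<bar>c\<bar> * norm (y - x)"
          using segment_bound(1)[OF z] by (intro mult_left_mono) auto
        finally show "norm (gradient f z - gradient f x) \<le> \<bar>c\<bar> * norm (y - x)" .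
      qed simp
      finally show "norm (((\<lambda>h. h \<bullet> gradient f z) - (\<lambda>h. h \<bullet> gradient f x)) h) \<le> \<bar>c\<bar> * norm (y - x) * norm h"
        by (simp add: mult.commute)
    qed
  qed auto
  then show ?thesis
    by (simp add: power2_eq_square mult_ac inner_commute)
qed

text \<open>Everything about \<open>M\<close> and the local objectives that enters the analysis of the iteration:
  \<open>\<kappa>\<close> is a curvature bound, \<open>LP\<close>, \<open>B\<close> and \<open>G\<close> are a Lipschitz constant of the tangent
  projections, a bound and a Lipschitz constant of the Riemannian gradients, and \<open>S\<close> is the constant
  of the quadratic upper bound along \<open>M\<close>.\<close>

locale riemannian_objectives =
  fixes M :: "'a::euclidean_space set" and f :: "'n::finite \<Rightarrow> 'a \<Rightarrow> real" and \<kappa> LP B G S :: real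
  assumes nonempty: "M \<noteq> {}" and compact: "compact M"
    and subspace: "x \<in> M \<Longrightarrow> subspace (tangent_space M x)"
    and prox: "proximal_normals \<kappa> M"
    and const_nonneg: "0 \<le> LP" "0 \<le> B" "0 \<le> G" "0 \<le> S"
    and proj_lipschitz: "x \<in> M \<Longrightarrow> y \<in> M \<Longrightarrow> norm (proj_tan M x v - proj_tan M y v) \<le> LP * norm (x - y) * norm v"
    and rgrad_bound: "x \<in> M \<Longrightarrow> norm (rgrad M (f i) x) \<le> B"
    and rgrad_lipschitz: "x \<in> M \<Longrightarrow> y \<in> M \<Longrightarrow> norm (rgrad M (f i) x - rgrad M (f i) y) \<le> G * norm (x - y)"
    and quadratic_upper: "x \<in> M \<Longrightarrow> y \<in> M \<Longrightarrow> f i y \<le> f i x + rgrad M (f i) x \<bullet> (y - x) + S * (norm (y - x))\<^sup>2"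

text \<open>In the quadratic upper bound the gradient may be replaced by its tangential part: the normal part
  pairs with the chord \<open>y - x\<close> to second order only.\<close>

lemma riemannian_objectives_exist:
  fixes M :: "'a::euclidean_space set" and f :: "'n::finite \<Rightarrow> 'a \<Rightarrow> real"
  assumes M: "compact M" "embedded_submanifold m M" "M \<noteq> {}"
    and d: "\<And>i x. f i differentiable (at x)"
    and lip: "\<And>i x y. norm (gradient (f i) x - gradient (f i) y) \<le> c * norm (x - y)"
    and LP: "proj_tan_lipschitz LP M"
  obtains \<kappa> B G S where "riemannian_objectives M f \<kappa> LP B G S"
proof -
  obtain \<kappa> where \<kappa>: "proximal_normals \<kappa> M"
    by (rule ex_proximal_normals[OF M(1,2)])
  have \<kappa>0: "\<kappa> > 0" using \<kappa> by (simp add: proximal_normals_def)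
  have sub: "subspace (tangent_space M x)" if "x \<in> M" for x
    by (rule subspace_tangent_space[OF M(2) that])
  obtain b where b: "\<And>x. x \<in> M \<Longrightarrow> norm x \<le> b"
    using compact_imp_bounded[OF M(1)] by (auto simp: bounded_iff)
  with M(3) have b0: "0 \<le> b"
    by (meson all_not_in_conv norm_ge_zero order_trans)
  have lip': "norm (gradient (f i) x - gradient (f i) y) \<le> \<bar>c\<bar> * norm (x - y)" for i x y
    using lip[of i x y] mult_right_mono[OF abs_ge_self norm_ge_zero] by (rule order_trans)
  define B where "B = (\<Sum>i\<in>UNIV. norm (gradient (f i) 0)) + \<bar>c\<bar> * b"
  have B0: "0 \<le> B"
    using b0 by (simp add: B_def sum_nonneg)
  have gB: "norm (gradient (f i) x) \<le> B" if "x \<in> M" for i x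
  proof -
    have "norm (gradient (f i) x) \<le> norm (gradient (f i) 0) + norm (gradient (f i) x - gradient (f i) 0)"
      using norm_triangle_ineq2[of "gradient (f i) x" "gradient (f i) 0"] by simp
    also have "norm (gradient (f i) 0) \<le> (\<Sum>i\<in>UNIV. norm (gradient (f i) 0))"
      by (rule member_le_sum) auto
    also have "norm (gradient (f i) x - gradient (f i) 0) \<le> \<bar>c\<bar> * norm x"
      using lip'[of i x 0] by simp
    also have "\<bar>c\<bar> * norm x \<le> \<bar>c\<bar> * b"
      using b[OF that] by (intro mult_left_mono) auto
    finally show ?thesis by (simp add: B_def)
  qed
  have P_le: "norm (proj_tan M x v) \<le> norm v" if "x \<in> M" for x v
    unfolding proj_tan_def by (rule norm_orth_proj_le[OF sub[OF that]])
  have bl: "bounded_linear (proj_tan M x)" if "x \<in> M" for x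
    using bounded_linear_orth_proj[OF sub[OF that]] by (simp add: proj_tan_def[abs_def])
  have projlip: "norm (proj_tan M x v - proj_tan M y v) \<le> LP * norm (x - y) * norm v" if "x \<in> M" "y \<in> M" for x y v
  proof -
    have "norm (proj_tan M x v - proj_tan M y v) \<le> onorm (\<lambda>v. proj_tan M x v - proj_tan M y v) * norm v"
      using onorm[OF bounded_linear_sub[OF bl[OF that(1)] bl[OF that(2)]]] .
    also have "\<dots> \<le> LP * norm (x - y) * norm v"
      using LP that by (intro mult_right_mono) (auto simp: proj_tan_lipschitz_def)
    finally show ?thesis .
  qed
  have LP0: "0 \<le> LP" using LP by (simp add: proj_tan_lipschitz_def)
  have "riemannian_objectives M f \<kappa> LP B (LP * B + \<bar>c\<bar>) (\<bar>c\<bar> + 2 * \<kappa> * B)"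
  proof
    show "norm (rgrad M (f i) x) \<le> B" if "x \<in> M" for x i
      using P_le[OF that] gB[OF that] order_trans unfolding rgrad_def by blast
    show "norm (rgrad M (f i) x - rgrad M (f i) y) \<le> (LP * B + \<bar>c\<bar>) * norm (x - y)" if xy: "x \<in> M" "y \<in> M" for x y i
    proof -
      let ?g = "gradient (f i)"
      have "rgrad M (f i) x - rgrad M (f i) y =
          (proj_tan M x (?g x) - proj_tan M y (?g x)) + proj_tan M y (?g x - ?g y)"
        using bl[OF xy(2)] by (simp add: rgrad_def bounded_linear.linear linear_diff)
      also have "norm \<dots> \<le> LP * norm (x - y) * norm (?g x) + norm (?g x - ?g y)"
        by (intro norm_triangle_mono projlip[OF xy] P_le[OF xy(2)])
      also have "LP * norm (x - y) * norm (?g x) \<le> LP * norm (x - y) * B"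
        using LP0 gB[OF xy(1)] by (intro mult_left_mono) auto
      also have "norm (?g x - ?g y) \<le> \<bar>c\<bar> * norm (x - y)"
        by (rule lip')
      finally show ?thesis by (simp add: algebra_simps)
    qed
    show "f i y \<le> f i x + rgrad M (f i) x \<bullet> (y - x) + (\<bar>c\<bar> + 2 * \<kappa> * B) * (norm (y - x))\<^sup>2"
      if xy: "x \<in> M" "y \<in> M" for x y i
    proof -
      let ?g = "gradient (f i) x" and ?\<nu> = "gradient (f i) x - rgrad M (f i) x"
      have "normal_to M x ?\<nu>"
        using orth_proj(2)[OF sub[OF xy(1)]] by (simp add: normal_to_def rgrad_def proj_tan_def)
      then have "?\<nu> \<bullet> (y - x) \<le> \<kappa> * norm ?\<nu> * (norm (y - x))\<^sup>2"
        using \<kappa> xy by (simp add: proximal_normals_def)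
      also have "\<dots> \<le> \<kappa> * (2 * B) * (norm (y - x))\<^sup>2"
      proof (intro mult_right_mono mult_left_mono)
        have "norm (rgrad M (f i) x) \<le> B"
          using P_le[OF xy(1)] gB[OF xy(1)] order_trans unfolding rgrad_def by blast
        then show "norm ?\<nu> \<le> 2 * B"
          using norm_triangle_ineq4[of ?g "rgrad M (f i) x"] gB[OF xy(1), of i] by linarith
      qed (use \<kappa>0 in auto)
      finally have "?g \<bullet> (y - x) \<le> rgrad M (f i) x \<bullet> (y - x) + 2 * \<kappa> * B * (norm (y - x))\<^sup>2"
        by (simp add: inner_diff_left mult_ac)
      moreover have "\<bar>f i y - f i x - ?g \<bullet> (y - x)\<bar> \<le> \<bar>c\<bar> * (norm (y - x))\<^sup>2"
        by (rule lipschitz_gradient_quadratic[OF d lip])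
      ultimately show ?thesis
        by (simp add: algebra_simps)
    qed
    show "M \<noteq> {}" "compact M" "proximal_normals \<kappa> M" "0 \<le> LP" "0 \<le> B"
      by (fact M \<kappa> LP0 B0)+
    show "0 \<le> LP * B + \<bar>c\<bar>" "0 \<le> \<bar>c\<bar> + 2 * \<kappa> * B"
      using LP0 B0 \<kappa>0 by simp_all
  qed (fact sub projlip)+
  then show thesis
    by (rule that)
qed

section \<open>One iteration near consensus\<close>

lemma nearest_stack_le:
  assumes "x' \<in> nearest_stack M z" "x \<in> stack_pow M"
  shows "norm (z $ i - x' $ i) \<le> norm (z $ i - x $ i)" and "norm (x' $ i - x $ i) \<le> 2 * norm (z $ i - x $ i)"
    and "norm (x' - x) \<le> 2 * norm (z - x)"
proof -
  have 1: "norm (z $ i - x' $ i) \<le> norm (z $ i - x $ i)" for i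
    using assms by (intro nearestD(2)) (auto simp: nearest_stack_def stack_pow_def)
  have 2: "norm (x' $ i - x $ i) \<le> 2 * norm (z $ i - x $ i)" for i
    using 1[of i] norm_triangle_ineq4[of "z $ i - x $ i" "z $ i - x' $ i"] by simp
  show "norm (z $ i - x' $ i) \<le> norm (z $ i - x $ i)" "norm (x' $ i - x $ i) \<le> 2 * norm (z $ i - x $ i)"
    by (fact 1 2)+
  show "norm (x' - x) \<le> 2 * norm (z - x)"
    using 2 by (intro norm_stack_le) auto
qed

lemma nearest_stack_in: "x \<in> nearest_stack M z \<Longrightarrow> x \<in> stack_pow M"
  by (auto simp: nearest_stack_def stack_pow_def dest: nearestD(1))

text \<open>A crude bound, needed where the distance itself enters quadratically.\<close>

lemma mean_to_nearest_le_center: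
  fixes x :: "('a::euclidean_space)^'n"
  assumes "p \<in> nearest M (mean x)" "x \<in> stack_pow M"
  shows "norm (mean x - p) \<le> norm (center x)"
proof (rule power2_le_imp_le)
  have "1 * (norm (mean x - p))\<^sup>2 \<le> real CARD('n) * (norm (mean x - p))\<^sup>2"
    by (intro mult_right_mono) (simp_all add: Suc_le_eq)
  then show "(norm (mean x - p))\<^sup>2 \<le> (norm (center x))\<^sup>2"
    using mean_to_nearest_le(1)[OF assms] by linarith
qed simp

lemma mean_inner_abs_le:
  fixes x :: "('a::euclidean_space)^'n"
  assumes "\<And>i. \<bar>v \<bullet> x $ i\<bar> \<le> c i"
  shows "\<bar>v \<bullet> mean x\<bar> \<le> (\<Sum>i\<in>UNIV. c i)"
proof -
  have "\<bar>v \<bullet> mean x\<bar> = 1 / real CARD('n) * \<bar>\<Sum>i\<in>UNIV. v \<bullet> x $ i\<bar>"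
    by (simp add: mean_def inner_sum_right abs_mult)
  also have "\<dots> \<le> 1 * \<bar>\<Sum>i\<in>UNIV. v \<bullet> x $ i\<bar>"
    by (intro mult_right_mono) (simp_all add: Suc_le_eq)
  also have "\<dots> \<le> (\<Sum>i\<in>UNIV. \<bar>v \<bullet> x $ i\<bar>)"
    by simp
  also have "\<dots> \<le> (\<Sum>i\<in>UNIV. c i)"
    by (intro sum_mono assms)
  finally show ?thesis .
qed

lemma objective_const: "objective f (\<chi> i. p) = 1 / real CARD('n) * (\<Sum>i\<in>UNIV. f i p)"
  for f :: "'n::finite \<Rightarrow> 'a::euclidean_space \<Rightarrow> real"
  by (simp add: objective_def)

lemma young: "0 \<le> c \<Longrightarrow> c * (a * b) \<le> c * (a\<^sup>2 / 2 + b\<^sup>2 / 2)" for a b c :: real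
  using sum_squares_bound[of a b] by (intro mult_left_mono) auto

context riemannian_objectives
begin

text \<open>The metric projection expands distances only by a factor whose excess over one is of second
  order in the displacement and in the disagreement.\<close>

lemma projected_disagreement:
  fixes x x' z :: "'a^'n"
  assumes x: "x \<in> stack_pow M" and x': "x' \<in> nearest_stack M z"
    and \<tau>: "\<kappa> * (norm (z - x) + 2 * \<kappa> * (norm (center x))\<^sup>2) \<le> \<tau>" "\<tau> < 1"
  shows "(1 - \<tau>) * norm (center x') \<le> norm (z - (\<chi> i. mean x))"
proof -
  have \<kappa>: "\<kappa> > 0"
    using prox by (simp add: proximal_normals_def)
  obtain p where p: "p \<in> nearest M (mean x)"
    using ex_nearest[OF compact nonempty] by blast
  have "norm ((x' - (\<chi> i. p)) $ i) \<le> 1 / (1 - \<tau>) * norm ((z - (\<chi> i. mean x)) $ i)" for i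
  proof -
    have "x' $ i \<in> nearest M (z $ i)"
      using x' by (simp add: nearest_stack_def)
    note lip = nearest_lipschitz[OF prox this p]
    have "norm (z $ i - x' $ i) \<le> norm (z - x)"
      using nearest_stack_le(1)[OF x' x, of i] Finite_Cartesian_Product.norm_nth_le[of "z - x" i] by simp
    moreover have "norm (mean x - p) \<le> 2 * \<kappa> * (norm (center x))\<^sup>2"
      by (rule mean_to_nearest_le(3)[OF p x prox])
    ultimately have "\<kappa> * (norm (z $ i - x' $ i) + norm (mean x - p)) \<le> \<kappa> * (norm (z - x) + 2 * \<kappa> * (norm (center x))\<^sup>2)"
      using \<kappa> by (intro mult_left_mono add_mono) auto
    then have "(1 - \<tau>) * norm (x' $ i - p) \<le> (1 - \<kappa> * (norm (z $ i - x' $ i) + norm (mean x - p))) * norm (x' $ i - p)"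
      using \<tau> by (intro mult_right_mono) auto
    with lip have "(1 - \<tau>) * norm (x' $ i - p) \<le> norm (z $ i - mean x)"
      by linarith
    then show ?thesis
      using \<tau>(2) by (simp add: field_simps)
  qed
  then have "norm (x' - (\<chi> i. p)) \<le> 1 / (1 - \<tau>) * norm (z - (\<chi> i. mean x))"
    using \<tau>(2) by (intro norm_stack_le) auto
  then have "norm (center x') \<le> 1 / (1 - \<tau>) * norm (z - (\<chi> i. mean x))"
    using norm_center_le[of x' p] by linarith
  then show ?thesis
    using \<tau>(2) by (simp add: field_simps)
qed

lemma norm_proj_tan_stack_le: "x \<in> stack_pow M \<Longrightarrow> norm (proj_tan_stack M x v) \<le> norm v"
  using norm_stack_le[of "proj_tan_stack M x v" 1 v] norm_orth_proj_le[OF subspace]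
  by (simp add: proj_tan_stack_def proj_tan_def stack_pow_def)

lemma norm_rgrad_stack_diff_le:
  "x \<in> stack_pow M \<Longrightarrow> y \<in> stack_pow M \<Longrightarrow> norm (rgrad_stack M f x - rgrad_stack M f y) \<le> G * norm (x - y)"
  using rgrad_lipschitz const_nonneg
  by (intro norm_stack_le) (auto simp: rgrad_stack_def stack_pow_def)

lemma norm_rgrad_stack_le:
  assumes "x \<in> stack_pow M"
  shows "norm (rgrad_stack M f x) \<le> real CARD('n) * B"
proof -
  have "norm (rgrad_stack M f x) \<le> (\<Sum>i\<in>UNIV. norm (rgrad_stack M f x $ i))"
    unfolding norm_vec_def by (rule L2_set_le_sum) simp
  also have "\<dots> \<le> (\<Sum>i\<in>(UNIV::'n set). B)"
    using assms rgrad_bound by (intro sum_mono) (auto simp: rgrad_stack_def stack_pow_def)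
  finally show ?thesis by simp
qed

text \<open>The coefficients of the four error terms of the descent estimate below, added up.\<close>

definition descent_const :: real where
  "descent_const = 15 * S + 2 * B * \<kappa> + 4 * LP * B + G\<^sup>2"

text \<open>The common objective is compared at the nearest points \<open>p\<close>, \<open>p'\<close> of the means. Its gradient \<open>v\<close> at
  \<open>p\<close> is tangent. The gossip part of the displacement has mean zero, and the correction made by the
  metric projection is normal at the new points, hence almost orthogonal to \<open>v\<close>. What remains of first
  order is the step along the mean of the trackers, which is the mean gradient \<open>g\<close>.\<close>

lemma descent_step:
  fixes x x' z d :: "'a^'n"
  assumes x: "x \<in> stack_pow M" and x': "x' \<in> nearest_stack M z"
    and p: "p \<in> nearest M (mean x)" and p': "p' \<in> nearest M (mean x')"
    and \<eta>: "0 < \<eta>" "\<eta> \<le> 1"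
    and mean_z: "mean z = mean x - \<eta> *\<^sub>R mean (proj_tan_stack M x d)"
    and mean_d: "mean d = mean (rgrad_stack M f x)"
  shows "objective f (\<chi> i. p') \<le> objective f (\<chi> i. p) - \<eta> / 2 * (norm (mean (rgrad_stack M f x)))\<^sup>2
    + descent_const * ((norm (center x))\<^sup>2 + (norm (center x'))\<^sup>2 + (norm (z - x))\<^sup>2 + \<eta>\<^sup>2 * (norm d)\<^sup>2)"
proof -
  let ?n = "real CARD('n)"
  define g where "g = mean (rgrad_stack M f x)"
  define v where "v = mean (rgrad_stack M f (\<chi> i. p))"
  define e where "e = norm (center x)"
  define e' where "e' = norm (center x')"
  define w where "w = norm (z - x)"
  have \<kappa>: "\<kappa> > 0"
    using prox by (simp add: proximal_normals_def)
  have pM: "p \<in> M" "p' \<in> M"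
    using p p' by (auto dest: nearestD)
  have xM: "x $ i \<in> M" and x'M: "x' $ i \<in> M" for i
    using x nearest_stack_in[OF x'] by (auto simp: stack_pow_def)
  have v_eq: "v = (1 / ?n) *\<^sub>R (\<Sum>i\<in>UNIV. rgrad M (f i) p)"
    by (simp add: v_def mean_def rgrad_stack_def)
  have vT: "v \<in> tangent_space M p"
    unfolding v_eq rgrad_def proj_tan_def
    by (intro subspace_scale subspace_sum subspace pM orth_proj(1))
  have proj_v: "proj_tan M p v = v"
    unfolding proj_tan_def by (rule orth_proj_id[OF subspace[OF pM(1)] vT])
  have "norm v \<le> 1 / ?n * (\<Sum>i\<in>(UNIV::'n set). B)"
    unfolding v_eq norm_scaleR
    by (intro mult_mono order_trans[OF norm_sum] sum_mono rgrad_bound pM) (auto intro: sum_nonneg)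
  then have vB: "norm v \<le> B"
    by simp
  have proj_near: "norm (proj_tan M y v - v) \<le> LP * B * norm (y - p)" if "y \<in> M" for y
  proof -
    have "norm (proj_tan M y v - proj_tan M p v) \<le> LP * norm (y - p) * norm v"
      by (rule proj_lipschitz[OF that pM(1)])
    also have "\<dots> \<le> LP * norm (y - p) * B"
      using vB const_nonneg by (intro mult_left_mono) auto
    finally show ?thesis
      by (simp add: proj_v mult_ac)
  qed
  have LPB: "0 \<le> LP * B"
    using const_nonneg by simp
  have xp: "(norm (x - (\<chi> i. p)))\<^sup>2 \<le> 2 * e\<^sup>2"
    unfolding e_def by (rule mean_to_nearest_le(2)[OF p x])
  have sums: "(\<Sum>i\<in>UNIV. (norm (x $ i - p))\<^sup>2) = (norm (x - (\<chi> i. p)))\<^sup>2"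
    "(\<Sum>i\<in>UNIV. (norm (z $ i - x $ i))\<^sup>2) = w\<^sup>2"
    by (simp_all add: norm_stack_power2 w_def)

  have upper: "objective f (\<chi> i. p') \<le> objective f (\<chi> i. p) + v \<bullet> (p' - p) + S * (norm (p' - p))\<^sup>2"
  proof -
    have "(\<Sum>i\<in>UNIV. f i p') \<le> (\<Sum>i\<in>UNIV. f i p + rgrad M (f i) p \<bullet> (p' - p) + S * (norm (p' - p))\<^sup>2)"
      by (intro sum_mono quadratic_upper pM)
    also have "\<dots> = (\<Sum>i\<in>UNIV. f i p) + (\<Sum>i\<in>UNIV. rgrad M (f i) p) \<bullet> (p' - p) + ?n * (S * (norm (p' - p))\<^sup>2)"
      by (simp add: sum.distrib inner_sum_left)
    finally show ?thesis
      unfolding objective_const v_eq by (simp add: field_simps)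
  qed
  have quad: "(norm (p' - p))\<^sup>2 \<le> 3 * e'\<^sup>2 + 3 * e\<^sup>2 + 12 * w\<^sup>2"
  proof -
    have "norm (mean x' - mean x) \<le> 2 * w"
      using norm_mean_le[of "x' - x"] nearest_stack_le(3)[OF x' x] by (simp add: mean_diff w_def)
    moreover have "norm (mean x' - p') \<le> e'" "norm (mean x - p) \<le> e"
      unfolding e'_def e_def using mean_to_nearest_le_center p p' x nearest_stack_in[OF x'] by blast+
    moreover have "p' - p = (mean x' - mean x) + (mean x - p) - (mean x' - p')"
      by simp
    then have "norm (p' - p) \<le> norm (mean x' - mean x) + norm (mean x - p) + norm (mean x' - p')"
      by (metis add_right_mono norm_triangle_ineq norm_triangle_ineq4 order_trans)
    ultimately have "norm (p' - p) \<le> 2 * w + e + e'"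
      by linarith
    then have "(norm (p' - p))\<^sup>2 \<le> (2 * w + e + e')\<^sup>2"
      by (intro power_mono) auto
    also have "\<dots> \<le> 3 * e'\<^sup>2 + 3 * e\<^sup>2 + 12 * w\<^sup>2"
      using zero_le_power2[of "2 * w - e"] zero_le_power2[of "2 * w - e'"] zero_le_power2[of "e - e'"]
      by (simp add: power2_eq_square algebra_simps)
    finally show ?thesis .
  qed
  have anchor: "v \<bullet> (p' - p) \<le> 2 * B * \<kappa> * e'\<^sup>2 + 2 * B * \<kappa> * e\<^sup>2 + v \<bullet> (mean x' - mean x)"
  proof -
    have "v \<bullet> (p' - mean x') \<le> B * (2 * \<kappa> * e'\<^sup>2)"
      using norm_cauchy_schwarz[of v "p' - mean x'"] vB const_nonneg
        mean_to_nearest_le(3)[OF p' nearest_stack_in[OF x'] prox]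
      by (intro order_trans[OF norm_cauchy_schwarz mult_mono]) (auto simp: e'_def norm_minus_commute)
    moreover have "v \<bullet> (mean x - p) \<le> B * (2 * \<kappa> * e\<^sup>2)"
      using vB const_nonneg mean_to_nearest_le(3)[OF p x prox]
      by (intro order_trans[OF norm_cauchy_schwarz mult_mono]) (auto simp: e_def)
    ultimately show ?thesis
      by (simp add: inner_diff_right)
  qed
  have normal: "\<bar>v \<bullet> mean (z - x')\<bar> \<le> LP * B * (e\<^sup>2 + 5 / 2 * w\<^sup>2)"
  proof -
    have "\<bar>v \<bullet> (z - x') $ i\<bar> \<le> LP * B * ((norm (x $ i - p))\<^sup>2 / 2 + 5 / 2 * (norm (z $ i - x $ i))\<^sup>2)" for i
    proof -
      let ?u = "norm (z $ i - x $ i)"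
      have "normal_to M (x' $ i) (z $ i - x' $ i)"
        using x' by (intro nearest_normal) (simp add: nearest_stack_def)
      then have "proj_tan M (x' $ i) v \<bullet> (z $ i - x' $ i) = 0"
        using orth_proj(1)[OF subspace[OF x'M]] by (simp add: normal_to_def proj_tan_def inner_commute)
      then have "\<bar>v \<bullet> (z - x') $ i\<bar> = \<bar>(proj_tan M (x' $ i) v - v) \<bullet> (z $ i - x' $ i)\<bar>"
        by (simp add: inner_diff_left)
      also have "\<dots> \<le> norm (proj_tan M (x' $ i) v - v) * norm (z $ i - x' $ i)"
        by (rule Cauchy_Schwarz_ineq2)
      also have "\<dots> \<le> (LP * B * (norm (x $ i - p) + 2 * ?u)) * ?u"
      proof (rule mult_mono)
        have "norm (x' $ i - p) \<le> norm (x $ i - p) + 2 * ?u"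
          using norm_triangle_ineq[of "x' $ i - x $ i" "x $ i - p"] nearest_stack_le(2)[OF x' x, of i] by simp
        then show "norm (proj_tan M (x' $ i) v - v) \<le> LP * B * (norm (x $ i - p) + 2 * ?u)"
          using proj_near[OF x'M] LPB by (meson mult_left_mono order_trans)
      qed (use nearest_stack_le(1)[OF x' x, of i] LPB in auto)
      also have "\<dots> \<le> LP * B * ((norm (x $ i - p))\<^sup>2 / 2 + 5 / 2 * ?u\<^sup>2)"
        using young[OF LPB, of "norm (x $ i - p)" ?u] by (simp add: algebra_simps power2_eq_square)
      finally show ?thesis .
    qed
    then have "\<bar>v \<bullet> mean (z - x')\<bar> \<le>
        (\<Sum>i\<in>UNIV. LP * B * ((norm (x $ i - p))\<^sup>2 / 2 + 5 / 2 * (norm (z $ i - x $ i))\<^sup>2))"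
      by (rule mean_inner_abs_le)
    also have "\<dots> = LP * B * ((norm (x - (\<chi> i. p)))\<^sup>2 / 2 + 5 / 2 * w\<^sup>2)"
      unfolding sums[symmetric] by (simp add: sum.distrib flip: sum_distrib_left sum_divide_distrib)
    also have "\<dots> \<le> LP * B * (e\<^sup>2 + 5 / 2 * w\<^sup>2)"
      using xp LPB by (intro mult_left_mono) auto
    finally show ?thesis .
  qed
  have tangential: "- \<eta> * (v \<bullet> mean (proj_tan_stack M x d)) \<le> - \<eta> * (v \<bullet> g) + LP * B * (e\<^sup>2 + \<eta>\<^sup>2 * (norm d)\<^sup>2 / 2)"
  proof -
    have "\<bar>v \<bullet> (\<eta> *\<^sub>R (proj_tan_stack M x d - d)) $ i\<bar> \<le> LP * B * ((norm (x $ i - p))\<^sup>2 / 2 + (\<eta> * norm (d $ i))\<^sup>2 / 2)" for i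
    proof -
      have "v \<bullet> (\<eta> *\<^sub>R (proj_tan_stack M x d - d)) $ i = \<eta> * ((proj_tan M (x $ i) v - v) \<bullet> d $ i)"
        using orth_proj_self_adjoint[OF subspace[OF xM], of i v "d $ i"]
        by (simp add: proj_tan_stack_def proj_tan_def inner_diff_left inner_diff_right)
      then have "\<bar>v \<bullet> (\<eta> *\<^sub>R (proj_tan_stack M x d - d)) $ i\<bar> \<le> \<eta> * (norm (proj_tan M (x $ i) v - v) * norm (d $ i))"
        using \<eta> Cauchy_Schwarz_ineq2[of "proj_tan M (x $ i) v - v" "d $ i"] by (simp add: abs_mult)
      also have "\<dots> \<le> \<eta> * ((LP * B * norm (x $ i - p)) * norm (d $ i))"
        using \<eta> proj_near[OF xM] by (intro mult_left_mono mult_right_mono) auto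
      also have "\<dots> = LP * B * (norm (x $ i - p) * (\<eta> * norm (d $ i)))"
        by simp
      also have "\<dots> \<le> LP * B * ((norm (x $ i - p))\<^sup>2 / 2 + (\<eta> * norm (d $ i))\<^sup>2 / 2)"
        by (rule young[OF LPB])
      finally show ?thesis .
    qed
    then have "\<bar>v \<bullet> mean (\<eta> *\<^sub>R (proj_tan_stack M x d - d))\<bar> \<le>
        (\<Sum>i\<in>UNIV. LP * B * ((norm (x $ i - p))\<^sup>2 / 2 + (\<eta> * norm (d $ i))\<^sup>2 / 2))"
      by (rule mean_inner_abs_le)
    also have "\<dots> = LP * B * ((norm (x - (\<chi> i. p)))\<^sup>2 / 2 + \<eta>\<^sup>2 * (norm d)\<^sup>2 / 2)"
      unfolding sums(1)[symmetric] norm_stack_power2[of d]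
      by (simp add: sum.distrib power_mult_distrib flip: sum_distrib_left sum_divide_distrib)
    also have "\<dots> \<le> LP * B * (e\<^sup>2 + \<eta>\<^sup>2 * (norm d)\<^sup>2 / 2)"
      using xp LPB by (intro mult_left_mono) auto
    finally have "\<bar>\<eta> * (v \<bullet> mean (proj_tan_stack M x d)) - \<eta> * (v \<bullet> g)\<bar> \<le> LP * B * (e\<^sup>2 + \<eta>\<^sup>2 * (norm d)\<^sup>2 / 2)"
      by (simp add: mean_scaleR mean_diff mean_d g_def inner_diff_right right_diff_distrib)
    then show ?thesis by linarith
  qed
  have gain: "- \<eta> * (v \<bullet> g) \<le> - \<eta> / 2 * (norm g)\<^sup>2 + G\<^sup>2 * e\<^sup>2"
  proof -
    have "norm (v - g) \<le> norm (rgrad_stack M f (\<chi> i. p) - rgrad_stack M f x)"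
      unfolding v_def g_def using norm_mean_le by (metis mean_diff)
    also have "\<dots> \<le> G * norm ((\<chi> i. p) - x)"
      using pM x by (intro norm_rgrad_stack_diff_le) (auto simp: stack_pow_def)
    finally have "(norm (v - g))\<^sup>2 \<le> (G * norm (x - (\<chi> i. p)))\<^sup>2"
      by (intro power_mono) (auto simp: norm_minus_commute)
    also have "\<dots> \<le> G\<^sup>2 * (2 * e\<^sup>2)"
      unfolding power_mult_distrib using xp by (intro mult_left_mono) auto
    finally have "\<eta> / 2 * (norm (v - g))\<^sup>2 \<le> 1 / 2 * (G\<^sup>2 * (2 * e\<^sup>2))"
      using \<eta> by (intro mult_mono) auto
    moreover have "(norm (v - g))\<^sup>2 = (norm v)\<^sup>2 - 2 * (v \<bullet> g) + (norm g)\<^sup>2"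
      by (simp add: power2_norm_eq_inner algebra_simps inner_commute)
    moreover have "0 \<le> \<eta> / 2 * (norm v)\<^sup>2"
      using \<eta> by simp
    ultimately show ?thesis
      by (simp add: algebra_simps)
  qed
  have "v \<bullet> (mean x' - mean x) = - \<eta> * (v \<bullet> mean (proj_tan_stack M x d)) - v \<bullet> mean (z - x')"
    by (simp add: mean_diff mean_z inner_diff_right)
  then have first: "v \<bullet> (mean x' - mean x) \<le> - \<eta> / 2 * (norm g)\<^sup>2 + G\<^sup>2 * e\<^sup>2
      + LP * B * (e\<^sup>2 + \<eta>\<^sup>2 * (norm d)\<^sup>2 / 2) + LP * B * (e\<^sup>2 + 5 / 2 * w\<^sup>2)"
    using normal tangential gain by linarith
  have "S * (norm (p' - p))\<^sup>2 \<le> S * (3 * e'\<^sup>2 + 3 * e\<^sup>2 + 12 * w\<^sup>2)"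
    using quad const_nonneg by (intro mult_left_mono)
  with upper anchor first have "objective f (\<chi> i. p') \<le> objective f (\<chi> i. p) - \<eta> / 2 * (norm g)\<^sup>2
      + (S * (3 * e'\<^sup>2 + 3 * e\<^sup>2 + 12 * w\<^sup>2) + 2 * B * \<kappa> * e'\<^sup>2 + 2 * B * \<kappa> * e\<^sup>2 + G\<^sup>2 * e\<^sup>2
      + LP * B * (e\<^sup>2 + \<eta>\<^sup>2 * (norm d)\<^sup>2 / 2) + LP * B * (e\<^sup>2 + 5 / 2 * w\<^sup>2))"
    by linarith
  also have "(S * (3 * e'\<^sup>2 + 3 * e\<^sup>2 + 12 * w\<^sup>2) + 2 * B * \<kappa> * e'\<^sup>2 + 2 * B * \<kappa> * e\<^sup>2 + G\<^sup>2 * e\<^sup>2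
      + LP * B * (e\<^sup>2 + \<eta>\<^sup>2 * (norm d)\<^sup>2 / 2) + LP * B * (e\<^sup>2 + 5 / 2 * w\<^sup>2))
    \<le> descent_const * (e\<^sup>2 + e'\<^sup>2 + w\<^sup>2 + \<eta>\<^sup>2 * (norm d)\<^sup>2)"
  proof -
    define D where "D = \<eta>\<^sup>2 * (norm d)\<^sup>2"
    have "0 \<le> S * (12 * e\<^sup>2 + 12 * e'\<^sup>2 + 3 * w\<^sup>2 + 15 * D) + 2 * B * \<kappa> * (w\<^sup>2 + D)
      + LP * B * (2 * e\<^sup>2 + 4 * e'\<^sup>2 + 3 / 2 * w\<^sup>2 + 7 / 2 * D) + G\<^sup>2 * (e'\<^sup>2 + w\<^sup>2 + D)"
      using const_nonneg \<kappa> by (intro add_nonneg_nonneg mult_nonneg_nonneg) (auto simp: D_def)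
    then show ?thesis
      unfolding descent_const_def D_def[symmetric] by (simp add: algebra_simps)
  qed
  finally show ?thesis
    unfolding e_def e'_def w_def g_def by simp
qed

end

section \<open>The coupled recursions of a run\<close>

text \<open>The first smallness condition on \<open>\<gamma>\<close> decouples disagreement from compression error, the second
  keeps the expansion by the metric projection below half of the contraction by the gossip.\<close>

locale dprgc_parameters = riemannian_objectives M f \<kappa> LP B G S
  for M :: "'a::euclidean_space set" and f :: "'n::finite \<Rightarrow> 'a \<Rightarrow> real" and \<kappa> LP B G S +
  fixes W :: "real^'n^'n" and C :: "'a^'n \<Rightarrow> 'a^'n" and R r \<alpha> \<gamma> :: real
  assumes gap: "mixing_gap r W" and compressor: "compressor \<alpha> C"
    and R_pos: "0 < R" and \<gamma>_pos: "0 < \<gamma>" and \<gamma>_le_1: "\<gamma> \<le> 1"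
    and \<gamma>_small: "200 * \<gamma> \<le> \<alpha> * r" "2 * \<gamma> * (\<kappa> * (35 * R / r + 2 * \<kappa> * R\<^sup>2)) \<le> r"
begin

text \<open>A run without the redundant variables: \<open>s\<close> and \<open>u\<close> are the mixed surrogates, and the
  starting point is restricted only by its disagreement.\<close>

definition reduced_run :: "real \<Rightarrow> (nat \<Rightarrow> 'a^'n) \<Rightarrow> (nat \<Rightarrow> 'a^'n) \<Rightarrow> (nat \<Rightarrow> 'a^'n) \<Rightarrow> (nat \<Rightarrow> 'a^'n) \<Rightarrow> bool" where
  "reduced_run \<eta> x xt d dt \<longleftrightarrow>
     x 0 \<in> stack_pow M \<and> norm (center (x 0)) \<le> R * \<gamma> \<and> xt 0 = x 0 \<and>
     d 0 = rgrad_stack M f (x 0) \<and> dt 0 = d 0 \<and>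
     (\<forall>k. x (Suc k) \<in> nearest_stack M (x k + \<gamma> *\<^sub>R (mix W (xt k) - xt k) - \<eta> *\<^sub>R proj_tan_stack M (x k) (d k)) \<and>
       xt (Suc k) = xt k + C (x (Suc k) - xt k) \<and>
       d (Suc k) = d k + \<gamma> *\<^sub>R (mix W (dt k) - dt k) + (rgrad_stack M f (x (Suc k)) - rgrad_stack M f (x k)) \<and>
       dt (Suc k) = dt k + C (d (Suc k) - dt k))"

definition lyapunov :: "'a^'n \<Rightarrow> 'a^'n \<Rightarrow> real" where
  "lyapunov y yt = norm (center y) + r / 16 * norm (y - yt)"

definition \<theta> :: real where "\<theta> = \<gamma> * r / 4"

text \<open>The recursion of the trackers contracts by \<open>1 - \<theta>\<close> with inputs of at most six times the bound of
  a gradient stack, which gives \<open>6 / \<theta>\<close> of these bounds for the deviation; the mean adds one more.\<close>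

definition tracker_bound :: real where
  "tracker_bound = (6 / \<theta> + 1) * (real CARD('n) * B)"

lemma r: "0 < r" "r \<le> 1" and \<alpha>: "0 < \<alpha>" "\<alpha> \<le> 1" and ds: "doubly_stochastic W"
  using gap compressor by (auto simp: mixing_gap_def compressor_def)

lemma \<kappa>_pos: "0 < \<kappa>"
  using prox by (simp add: proximal_normals_def)

lemma \<theta>: "0 < \<theta>" "\<theta> \<le> 1"
  using r \<gamma>_pos \<gamma>_le_1 mult_mono[of \<gamma> 1 r 1] by (auto simp: \<theta>_def)

lemma lyapunov_bounds:
  "0 \<le> lyapunov y yt" "norm (center y) \<le> lyapunov y yt" "norm (y - yt) \<le> 16 / r * lyapunov y yt"
  "norm (center y) + norm (y - yt) \<le> 16 / r * lyapunov y yt"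
  "lyapunov y y = norm (center y)"
proof -
  have "r * norm (center y) \<le> 16 * norm (center y)"
    using r by (intro mult_right_mono) auto
  then show "0 \<le> lyapunov y yt" "norm (center y) \<le> lyapunov y yt" "norm (y - yt) \<le> 16 / r * lyapunov y yt"
    "norm (center y) + norm (y - yt) \<le> 16 / r * lyapunov y yt" "lyapunov y y = norm (center y)"
    using r by (auto simp: lyapunov_def field_simps)
qed

lemma tracking_contraction:
  assumes "reduced_run \<eta> x xt d dt"
  shows "lyapunov (d (Suc k)) (dt (Suc k)) \<le> (1 - \<theta>) * lyapunov (d k) (dt k)
    + 3 * norm (rgrad_stack M f (x (Suc k)) - rgrad_stack M f (x k))"
proof -
  let ?h = "rgrad_stack M f (x (Suc k)) - rgrad_stack M f (x k)"
  let ?y = "d k + \<gamma> *\<^sub>R (mix W (dt k) - dt k)"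
  let ?e = "norm (center (d k))" and ?a = "norm (d k - dt k)"
  have d: "d (Suc k) = ?y + ?h" and dt: "dt (Suc k) = dt k + C (d (Suc k) - dt k)"
    using assms by (auto simp: reduced_run_def)
  note g = gossip_step[OF gap \<gamma>_pos \<gamma>_le_1, of "d k" "dt k"]
  have nn: "0 \<le> \<gamma> * r * ?e" "0 \<le> \<gamma> * ?a" "0 \<le> \<gamma> * (?e + ?a)" "0 \<le> norm ?h"
    using \<gamma>_pos r by auto
  have "norm (center (d (Suc k))) \<le> norm (center ?y) + norm ?h"
    unfolding d center_add by (intro order_trans[OF norm_triangle_ineq] add_left_mono norm_center_le_norm)
  also have "\<dots> \<le> (?e - \<gamma> * r * ?e / 2) + 4 * \<gamma> * ?a + 2 * norm ?h"
  proof -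
    have "norm (center ?y) \<le> ?e - \<gamma> * r * ?e + 2 * \<gamma> * ?a"
      using g(1) by (simp add: algebra_simps)
    then show ?thesis
      using nn by linarith
  qed
  also have "?e - \<gamma> * r * ?e / 2 = (1 - \<gamma> * r / 2) * ?e"
    by (simp add: algebra_simps)
  finally have 1: "norm (center (d (Suc k))) \<le> (1 - \<gamma> * r / 2) * ?e + 4 * \<gamma> * ?a + 2 * norm ?h" .
  have "norm (d (Suc k) - d k) \<le> 2 * \<gamma> * (?e + ?a) + norm ?h"
    using g(2) norm_triangle_ineq[of "?y - d k" ?h] unfolding d by (simp add: algebra_simps)
  then have step: "norm (d (Suc k) - d k) \<le> 4 * \<gamma> * (?e + ?a) + 2 * norm ?h"
    using nn by linarith
  have "norm (d (Suc k) - dt (Suc k)) \<le> (1 - \<alpha> / 2) * (?a + norm (d (Suc k) - d k))"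
    unfolding dt by (rule compression_error_le[OF compressor])
  also have "\<dots> \<le> (1 - \<alpha> / 2) * ?a + 1 * norm (d (Suc k) - d k)"
    unfolding distrib_left using \<alpha> by (intro add_left_mono mult_right_mono) auto
  finally have 2: "norm (d (Suc k) - dt (Suc k)) \<le> (1 - \<alpha> / 2) * ?a + 4 * \<gamma> * (?e + ?a) + 2 * norm ?h"
    using step by linarith
  show ?thesis
    unfolding lyapunov_def \<theta>_def
    by (rule coupled_contraction[OF r \<alpha>(2) \<gamma>_pos \<gamma>_small(1) _ _ _ 1 2]) auto
qed

lemma run_in_stack_pow:
  assumes "reduced_run \<eta> x xt d dt"
  shows "x k \<in> stack_pow M"
  using assms by (cases k) (auto simp: reduced_run_def intro: nearest_stack_in)

lemma mean_tracker:
  assumes "reduced_run \<eta> x xt d dt"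
  shows "mean (d k) = mean (rgrad_stack M f (x k))"
proof (induction k)
  case 0
  then show ?case using assms by (simp add: reduced_run_def)
next
  case (Suc k)
  have "d (Suc k) = d k + \<gamma> *\<^sub>R (mix W (dt k) - dt k) + (rgrad_stack M f (x (Suc k)) - rgrad_stack M f (x k))"
    using assms by (simp add: reduced_run_def)
  then show ?case
    using Suc by (simp add: mean_add mean_diff mean_scaleR mean_mix[OF ds])
qed

text \<open>The inputs of the tracking recursion are differences of gradients, which are bounded on \<open>M\<close>
  wherever the iterates are. So the trackers are bounded independently of \<open>\<eta>\<close> and before anything is
  known about consensus.\<close>

lemma norm_tracker_le:
  assumes run: "reduced_run \<eta> x xt d dt"
  shows "norm (d k) \<le> tracker_bound"
proof -
  let ?b = "real CARD('n) * B"
  have b: "0 \<le> ?b" using const_nonneg by simp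
  have rg: "norm (rgrad_stack M f (x k)) \<le> ?b" for k
    by (rule norm_rgrad_stack_le[OF run_in_stack_pow[OF run]])
  have "lyapunov (d k) (dt k) \<le> 6 / \<theta> * ?b"
  proof (induction k)
    case 0
    have "lyapunov (d 0) (dt 0) = norm (center (d 0))"
      using run by (simp add: reduced_run_def lyapunov_bounds)
    also have "\<dots> \<le> 1 * ?b"
      using rg[of 0] norm_center_le_norm[of "d 0"] run by (simp add: reduced_run_def)
    also have "\<dots> \<le> 6 / \<theta> * ?b"
      using b \<theta> by (intro mult_right_mono) (auto simp: field_simps)
    finally show ?case .
  next
    case (Suc k)
    have "norm (rgrad_stack M f (x (Suc k)) - rgrad_stack M f (x k)) \<le> 2 * ?b"
      using norm_triangle_ineq4[of "rgrad_stack M f (x (Suc k))" "rgrad_stack M f (x k)"] rg[of k] rg[of "Suc k"]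
      by linarith
    then have "3 * norm (rgrad_stack M f (x (Suc k)) - rgrad_stack M f (x k)) \<le> \<theta> * (6 / \<theta> * ?b)"
      using \<theta> by (simp add: mult_ac)
    then show ?case
      by (rule perturbed_contraction_bound[OF \<theta>(2) Suc _ tracking_contraction[OF run]])
  qed
  then have c: "norm (center (d k)) \<le> 6 / \<theta> * ?b"
    using lyapunov_bounds(2) order_trans by blast
  have "(norm (d k))\<^sup>2 \<le> (norm (center (d k)))\<^sup>2 + (norm (rgrad_stack M f (x k)))\<^sup>2"
    unfolding norm_power2_mean[of "d k"] norm_power2_mean[of "rgrad_stack M f (x k)"] mean_tracker[OF run] by simp
  also have "\<dots> \<le> (norm (center (d k)) + norm (rgrad_stack M f (x k)))\<^sup>2"
    by (simp add: power2_sum)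
  finally have "norm (d k) \<le> norm (center (d k)) + norm (rgrad_stack M f (x k))"
    by (rule power2_le_imp_le) simp
  then show ?thesis
    using c rg[of k] by (simp add: tracker_bound_def algebra_simps)
qed

abbreviation proj_input :: "real \<Rightarrow> 'a^'n \<Rightarrow> 'a^'n \<Rightarrow> 'a^'n \<Rightarrow> 'a^'n" where
  "proj_input \<eta> y yt v \<equiv> y + \<gamma> *\<^sub>R (mix W yt - yt) - \<eta> *\<^sub>R proj_tan_stack M y v"

lemma displacement_le:
  assumes "y \<in> stack_pow M" "0 \<le> \<eta>"
  shows "norm (proj_input \<eta> y yt v - y) \<le> 2 * \<gamma> * (norm (center y) + norm (y - yt)) + \<eta> * norm v"
proof -
  have "norm (proj_input \<eta> y yt v - y) \<le> norm (y + \<gamma> *\<^sub>R (mix W yt - yt) - y) + norm (\<eta> *\<^sub>R proj_tan_stack M y v)"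
    using norm_triangle_ineq4[of "y + \<gamma> *\<^sub>R (mix W yt - yt) - y" "\<eta> *\<^sub>R proj_tan_stack M y v"]
    by (simp add: algebra_simps)
  also have "\<dots> \<le> 2 * \<gamma> * (norm (center y) + norm (y - yt)) + \<eta> * norm v"
    using gossip_step(2)[OF gap \<gamma>_pos \<gamma>_le_1, of y yt] norm_proj_tan_stack_le[OF assms(1), of v] assms(2)
    by (intro add_mono) (auto intro: mult_left_mono)
  finally show ?thesis .
qed

text \<open>In the region where the Lyapunov function is at most \<open>R \<gamma>\<close> all displacements are of order
  \<open>\<gamma>\<^sup>2\<close>. Hence the expansion of the metric projection costs only half of the contraction \<open>\<gamma> r\<close> of the
  gossip.\<close>

lemma consensus_contraction:
  assumes y: "y \<in> stack_pow M" and y': "y' \<in> nearest_stack M (proj_input \<eta> y yt v)"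
    and \<eta>: "0 \<le> \<eta>" "3 * (\<eta> * norm v) \<le> \<theta> * (R * \<gamma>)" and region: "lyapunov y yt \<le> R * \<gamma>"
  shows "lyapunov y' (yt + C (y' - yt)) \<le> (1 - \<theta>) * lyapunov y yt + 3 * (\<eta> * norm v)"
proof -
  let ?z = "proj_input \<eta> y yt v" and ?h = "\<eta> * norm v"
  let ?e = "norm (center y)" and ?a = "norm (y - yt)"
  have h: "0 \<le> ?h" using \<eta> by simp
  have R\<gamma>: "0 < R * \<gamma>" using R_pos \<gamma>_pos by simp
  have disp: "norm (?z - y) \<le> 2 * \<gamma> * (?e + ?a) + ?h"
    by (rule displacement_le[OF y \<eta>(1)])
  have e: "?e \<le> R * \<gamma>" and a: "?a \<le> 16 / r * (R * \<gamma>)"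
  proof -
    show "?e \<le> R * \<gamma>"
      using lyapunov_bounds(2) region by (rule order_trans)
    show "?a \<le> 16 / r * (R * \<gamma>)"
      using r by (intro order_trans[OF lyapunov_bounds(3) mult_left_mono[OF region]]) auto
  qed
  have "norm (?z - y) \<le> 35 * R / r * \<gamma>\<^sup>2"
  proof -
    have "1 * (R * \<gamma>) \<le> 1 / r * (R * \<gamma>)"
      using r R\<gamma> by (intro mult_right_mono) (auto simp: field_simps)
    then have "2 * \<gamma> * (?e + ?a) \<le> 2 * \<gamma> * (17 / r * (R * \<gamma>))"
      using e a \<gamma>_pos by (intro mult_left_mono) auto
    moreover have "\<theta> * (R * \<gamma>) \<le> \<gamma> / r * (R * \<gamma>)"
    proof (rule mult_right_mono)
      have "r * r \<le> 1 * 1" using r by (intro mult_mono) auto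
      then have "\<gamma> * (r * r) \<le> \<gamma> * 4"
        using \<gamma>_pos by (intro mult_left_mono) auto
      then show "\<theta> \<le> \<gamma> / r" using r by (simp add: \<theta>_def field_simps)
    qed (use R\<gamma> in simp)
    then have "?h \<le> \<gamma> / r * (R * \<gamma>)"
      using \<eta>(2) h by linarith
    ultimately have "norm (?z - y) \<le> 2 * \<gamma> * (17 / r * (R * \<gamma>)) + \<gamma> / r * (R * \<gamma>)"
      using disp by linarith
    then show ?thesis by (simp add: power2_eq_square field_simps)
  qed
  moreover have "?e\<^sup>2 \<le> (R * \<gamma>)\<^sup>2"
    using e by (intro power_mono) auto
  ultimately have "\<kappa> * (norm (?z - y) + 2 * \<kappa> * ?e\<^sup>2) \<le> \<kappa> * (35 * R / r * \<gamma>\<^sup>2 + 2 * \<kappa> * (R * \<gamma>)\<^sup>2)"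
    using \<kappa>_pos by (intro mult_left_mono add_mono) auto
  also have "\<dots> = \<gamma> / 2 * (2 * \<gamma> * (\<kappa> * (35 * R / r + 2 * \<kappa> * R\<^sup>2)))"
    by (simp add: power2_eq_square algebra_simps)
  also have "\<dots> \<le> \<gamma> / 2 * r"
    using \<gamma>_small(2) \<gamma>_pos by (intro mult_left_mono) auto
  finally have "\<kappa> * (norm (?z - y) + 2 * \<kappa> * ?e\<^sup>2) \<le> \<gamma> * r / 2"
    by simp
  moreover have half: "\<gamma> * r / 2 \<le> 1 / 2"
    using \<theta>_def \<theta> r \<gamma>_pos \<gamma>_le_1 mult_mono[of \<gamma> 1 r 1] by simp
  ultimately have proj: "(1 - \<gamma> * r / 2) * norm (center y') \<le> norm (?z - (\<chi> i. mean y))"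
    by (intro projected_disagreement[OF y y']) auto
  let ?g = "y + \<gamma> *\<^sub>R (mix W yt - yt)"
  have "norm (?z - (\<chi> i. mean y)) \<le> norm (center ?g) + norm (\<eta> *\<^sub>R proj_tan_stack M y v)"
    using norm_triangle_ineq4[of "center ?g" "\<eta> *\<^sub>R proj_tan_stack M y v"]
      gossip_step(3)[OF gap \<gamma>_pos \<gamma>_le_1, of y yt]
    by (simp add: center_def algebra_simps)
  also have "\<dots> \<le> ((1 - \<gamma> * r) * ?e + 2 * \<gamma> * ?a) + ?h"
    using gossip_step(1)[OF gap \<gamma>_pos \<gamma>_le_1, of y yt] norm_proj_tan_stack_le[OF y, of v] \<eta>(1)
    by (intro add_mono) (auto intro: mult_left_mono)
  also have "\<dots> \<le> (1 - \<gamma> * r / 2) * ((1 - \<gamma> * r / 2) * ?e + 4 * \<gamma> * ?a + 2 * ?h)"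
  proof -
    define q where "q = \<gamma> * r / 2"
    define X where "X = 4 * \<gamma> * ?a + 2 * ?h"
    have half_X: "X / 2 = 2 * \<gamma> * ?a + ?h"
      by (simp add: X_def)
    have "0 \<le> X"
      using \<gamma>_pos h by (simp add: X_def)
    then have "1 / 2 * X \<le> (1 - q) * X"
      using half by (intro mult_right_mono) (auto simp: q_def)
    moreover have "0 \<le> q\<^sup>2 * ?e" by simp
    ultimately have "(1 - 2 * q) * ?e + X / 2 \<le> (1 - 2 * q) * ?e + q\<^sup>2 * ?e + (1 - q) * X"
      by linarith
    also have "\<dots> = (1 - q) * ((1 - q) * ?e + X)"
      by (simp add: power2_eq_square algebra_simps)
    finally have "(1 - 2 * q) * ?e + (2 * \<gamma> * ?a + ?h) \<le> (1 - q) * ((1 - q) * ?e + X)"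
      by (simp only: half_X)
    then show ?thesis
      by (simp add: q_def X_def add.assoc)
  qed
  finally have "(1 - \<gamma> * r / 2) * norm (center y') \<le> (1 - \<gamma> * r / 2) * ((1 - \<gamma> * r / 2) * ?e + 4 * \<gamma> * ?a + 2 * ?h)"
    using proj by linarith
  then have 1: "norm (center y') \<le> (1 - \<gamma> * r / 2) * ?e + 4 * \<gamma> * ?a + 2 * ?h"
    by (rule mult_left_le_imp_le) (use half in simp)
  have step: "norm (y' - y) \<le> 4 * \<gamma> * (?e + ?a) + 2 * ?h"
    using nearest_stack_le(3)[OF y' y] disp by linarith
  have "norm (y' - (yt + C (y' - yt))) \<le> (1 - \<alpha> / 2) * (?a + norm (y' - y))"
    by (rule compression_error_le[OF compressor])
  also have "\<dots> \<le> (1 - \<alpha> / 2) * ?a + 1 * norm (y' - y)"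
    unfolding distrib_left using \<alpha> by (intro add_left_mono mult_right_mono) auto
  finally have 2: "norm (y' - (yt + C (y' - yt))) \<le> (1 - \<alpha> / 2) * ?a + 4 * \<gamma> * (?e + ?a) + 2 * ?h"
    using step by linarith
  show ?thesis
    unfolding lyapunov_def \<theta>_def
    by (rule coupled_contraction[OF r \<alpha>(2) \<gamma>_pos \<gamma>_small(1) _ _ h 1 2]) auto
qed

lemma consensus_along_run:
  assumes run: "reduced_run \<eta> x xt d dt" and \<eta>: "0 \<le> \<eta>" "3 * (\<eta> * tracker_bound) \<le> \<theta> * (R * \<gamma>)"
  shows "lyapunov (x k) (xt k) \<le> R * \<gamma>"
    and "lyapunov (x (Suc k)) (xt (Suc k)) \<le> (1 - \<theta>) * lyapunov (x k) (xt k) + 3 * (\<eta> * norm (d k))"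
proof -
  have small: "3 * (\<eta> * norm (d k)) \<le> \<theta> * (R * \<gamma>)" for k
    using mult_left_mono[OF norm_tracker_le[OF run, of k] \<eta>(1)] \<eta>(2) by linarith
  have step: "lyapunov (x (Suc k)) (xt (Suc k)) \<le> (1 - \<theta>) * lyapunov (x k) (xt k) + 3 * (\<eta> * norm (d k))"
    if "lyapunov (x k) (xt k) \<le> R * \<gamma>" for k
  proof -
    have "x (Suc k) \<in> nearest_stack M (proj_input \<eta> (x k) (xt k) (d k))"
      "xt (Suc k) = xt k + C (x (Suc k) - xt k)"
      using run by (auto simp: reduced_run_def)
    with consensus_contraction[OF run_in_stack_pow[OF run] this(1) \<eta>(1) small that] show ?thesis
      by simp
  qed
  show *: "lyapunov (x k) (xt k) \<le> R * \<gamma>" for k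
  proof (induction k)
    case 0
    then show ?case using run by (simp add: reduced_run_def lyapunov_bounds)
  next
    case (Suc k)
    then show ?case
      by (rule perturbed_contraction_bound[OF \<theta>(2) _ small step[OF Suc]])
  qed
  show "lyapunov (x (Suc k)) (xt (Suc k)) \<le> (1 - \<theta>) * lyapunov (x k) (xt k) + 3 * (\<eta> * norm (d k))"
    by (rule step[OF *])
qed

end

section \<open>Summation over the iterations\<close>

text \<open>\<open>X\<close>, \<open>Y\<close>, \<open>Z\<close> stand for the sums of the squared consensus errors, trackers and mean gradients. The
  first two bounds give \<open>\<eta>\<^sup>2 Y = O(\<eta>) (1 + \<eta>\<^sup>2 Y)\<close> once \<open>\<eta> Z\<close> is replaced by the third, so for small
  \<open>\<eta>\<close> the loop closes with \<open>\<eta>\<^sup>2 Y \<le> 1\<close>.\<close>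

lemma small_gain:
  fixes X Y Z K \<eta> :: real
  assumes K: "1 \<le> K" and \<eta>: "0 < \<eta>" "\<eta> \<le> 1" "8 * K ^ 3 * \<eta> \<le> 1"
    and nonneg: "0 \<le> Y"
    and X: "X \<le> K * (1 + \<eta>\<^sup>2 * Y)"
    and Y: "Y \<le> K * (1 + X + \<eta>\<^sup>2 * Y + Z)"
    and Z: "\<eta> * Z \<le> K * (1 + X + \<eta>\<^sup>2 * Y)"
  shows "Z \<le> 4 * K\<^sup>2 / \<eta>"
proof -
  define Q where "Q = \<eta>\<^sup>2 * Y"
  have Q: "0 \<le> Q" using nonneg by (simp add: Q_def)
  have XQ: "K * (1 + X + Q) \<le> 2 * K\<^sup>2 * (1 + Q)"
  proof -
    have "1 + X + Q \<le> (1 + K) * (1 + Q)"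
      using X by (simp add: Q_def algebra_simps)
    also have "\<dots> \<le> 2 * K * (1 + Q)"
      using K Q by (intro mult_right_mono) auto
    finally have "K * (1 + X + Q) \<le> K * (2 * K * (1 + Q))"
      using K by (intro mult_left_mono) auto
    then show ?thesis by (simp add: power2_eq_square mult_ac)
  qed
  then have ZQ: "\<eta> * Z \<le> 2 * K\<^sup>2 * (1 + Q)"
    using Z by (simp add: Q_def)
  have "Q \<le> \<eta>\<^sup>2 * (K * (1 + X + Q) + K * Z)"
    unfolding Q_def[of] using Y by (intro mult_left_mono) (auto simp: Q_def algebra_simps)
  also have "\<dots> \<le> \<eta>\<^sup>2 * (2 * K\<^sup>2 * (1 + Q)) + \<eta> * K * (\<eta> * Z)"
    using mult_left_mono[OF XQ, of "\<eta>\<^sup>2"] by (simp add: power2_eq_square algebra_simps)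
  also have "\<dots> \<le> \<eta> * K * (2 * K\<^sup>2 * (1 + Q)) + \<eta> * K * (2 * K\<^sup>2 * (1 + Q))"
  proof (rule add_mono)
    have "\<eta> * \<eta> \<le> \<eta> * K"
      using \<eta> K by (intro mult_left_mono) auto
    then show "\<eta>\<^sup>2 * (2 * K\<^sup>2 * (1 + Q)) \<le> \<eta> * K * (2 * K\<^sup>2 * (1 + Q))"
      unfolding power2_eq_square[of \<eta>] using Q by (intro mult_right_mono) auto
    show "\<eta> * K * (\<eta> * Z) \<le> \<eta> * K * (2 * K\<^sup>2 * (1 + Q))"
      using ZQ \<eta> K by (intro mult_left_mono) auto
  qed
  also have "\<dots> = (8 * K ^ 3 * \<eta>) * ((1 + Q) / 2)"
    by (simp add: power2_eq_square power3_eq_cube)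
  also have "\<dots> \<le> 1 * ((1 + Q) / 2)"
    using \<eta>(3) Q by (intro mult_right_mono) auto
  finally have "Q \<le> 1" by simp
  then have "2 * K\<^sup>2 * (1 + Q) \<le> 2 * K\<^sup>2 * 2"
    by (intro mult_left_mono) auto
  with ZQ have "\<eta> * Z \<le> 4 * K\<^sup>2" by linarith
  then show ?thesis
    using \<eta> by (simp add: field_simps)
qed

context dprgc_parameters
begin

lemma objective_oscillation:
  obtains \<omega> where "0 \<le> \<omega>" "\<And>p p'. p \<in> M \<Longrightarrow> p' \<in> M \<Longrightarrow> objective f (\<chi> i. p) - objective f (\<chi> i. p') \<le> \<omega>"
proof -
  obtain b where b: "\<And>x. x \<in> M \<Longrightarrow> norm x \<le> b"
    using compact_imp_bounded[OF compact] by (auto simp: bounded_iff)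
  have "objective f (\<chi> i. p) - objective f (\<chi> i. p') \<le> B * (2 * b) + S * (2 * b)\<^sup>2"
    if p: "p \<in> M" "p' \<in> M" for p p'
  proof -
    have d: "norm (p - p') \<le> 2 * b"
      using norm_triangle_ineq4[of p p'] b[OF p(1)] b[OF p(2)] by linarith
    have "f i p \<le> f i p' + (B * (2 * b) + S * (2 * b)\<^sup>2)" for i
    proof -
      have "rgrad M (f i) p' \<bullet> (p - p') \<le> B * (2 * b)"
        using d rgrad_bound[OF p(2)] const_nonneg
        by (intro order_trans[OF norm_cauchy_schwarz mult_mono]) auto
      moreover have "S * (norm (p - p'))\<^sup>2 \<le> S * (2 * b)\<^sup>2"
        using d const_nonneg by (intro mult_left_mono power_mono) auto
      ultimately show ?thesis
        using quadratic_upper[OF p(2,1), of i] by linarith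
    qed
    then have "(\<Sum>i\<in>UNIV. f i p) \<le> (\<Sum>i\<in>UNIV. f i p' + (B * (2 * b) + S * (2 * b)\<^sup>2))"
      by (rule sum_mono)
    also have "\<dots> = (\<Sum>i\<in>UNIV. f i p') + real CARD('n) * (B * (2 * b) + S * (2 * b)\<^sup>2)"
      by (simp add: sum.distrib)
    finally show ?thesis
      unfolding objective_const by (simp add: field_simps)
  qed
  then show thesis
    by (intro that[of "\<bar>B * (2 * b) + S * (2 * b)\<^sup>2\<bar>"]) (auto intro: order_trans[OF _ abs_ge_self])
qed

definition displacement_const :: real where
  "displacement_const = 2 * (32 / r)\<^sup>2 + 2"

lemma displacement_square_le:
  assumes "y \<in> stack_pow M" "0 \<le> \<eta>"
  shows "(norm (proj_input \<eta> y yt v - y))\<^sup>2 \<le> displacement_const * ((lyapunov y yt)\<^sup>2 + \<eta>\<^sup>2 * (norm v)\<^sup>2)"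
proof -
  let ?E = "lyapunov y yt"
  have "2 * \<gamma> * (norm (center y) + norm (y - yt)) \<le> 2 * 1 * (16 / r * ?E)"
    using \<gamma>_le_1 \<gamma>_pos lyapunov_bounds(4)[of y yt] by (intro mult_mono) auto
  then have "norm (proj_input \<eta> y yt v - y) \<le> 32 / r * ?E + \<eta> * norm v"
    using displacement_le[OF assms, of yt v] by simp
  then have "(norm (proj_input \<eta> y yt v - y))\<^sup>2 \<le> (32 / r * ?E + \<eta> * norm v)\<^sup>2"
    by (intro power_mono) auto
  also have "\<dots> \<le> 2 * (32 / r * ?E)\<^sup>2 + 2 * (\<eta> * norm v)\<^sup>2"
    using sum_squares_bound[of "32 / r * ?E" "\<eta> * norm v"] by (simp add: power2_sum)
  also have "\<dots> \<le> displacement_const * (?E\<^sup>2 + \<eta>\<^sup>2 * (norm v)\<^sup>2)"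
  proof -
    define c where "c = (32 / r)\<^sup>2"
    have "0 \<le> 2 * c * (\<eta>\<^sup>2 * (norm v)\<^sup>2) + 2 * ?E\<^sup>2"
      by (simp add: c_def)
    then show ?thesis
      unfolding displacement_const_def power_mult_distrib c_def[symmetric] by (simp add: algebra_simps)
  qed
  finally show ?thesis .
qed

lemma displacement_const_nonneg: "0 \<le> displacement_const"
  by (simp add: displacement_const_def)

lemma sum_consensus_le:
  assumes run: "reduced_run \<eta> x xt d dt" and \<eta>: "0 \<le> \<eta>" "3 * (\<eta> * tracker_bound) \<le> \<theta> * (R * \<gamma>)"
  shows "(\<Sum>k<N. (lyapunov (x k) (xt k))\<^sup>2) \<le>
    ((R * \<gamma>)\<^sup>2 / \<theta> + 9 / \<theta>\<^sup>2) * (1 + \<eta>\<^sup>2 * (\<Sum>k<N. (norm (d k))\<^sup>2))"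
proof -
  let ?Y = "\<Sum>k<N. (norm (d k))\<^sup>2"
  have "\<theta> * (\<Sum>k<N. (lyapunov (x k) (xt k))\<^sup>2) \<le> (lyapunov (x 0) (xt 0))\<^sup>2 + 9 / \<theta> * (\<Sum>k<N. (\<eta> * norm (d k))\<^sup>2)"
    using \<eta> by (intro perturbed_contraction_sum \<theta> lyapunov_bounds(1) consensus_along_run[OF run]) auto
  also have "\<dots> \<le> (R * \<gamma>)\<^sup>2 + 9 / \<theta> * (\<eta>\<^sup>2 * ?Y)"
    using consensus_along_run(1)[OF run \<eta>, of 0] lyapunov_bounds(1)
    by (intro add_mono power_mono) (auto simp: power_mult_distrib sum_distrib_left)
  finally have "(\<Sum>k<N. (lyapunov (x k) (xt k))\<^sup>2) \<le> (R * \<gamma>)\<^sup>2 / \<theta> + 9 / \<theta>\<^sup>2 * (\<eta>\<^sup>2 * ?Y)"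
    using \<theta> by (simp add: field_simps power2_eq_square)
  also have "\<dots> \<le> ((R * \<gamma>)\<^sup>2 / \<theta> + 9 / \<theta>\<^sup>2) * (1 + \<eta>\<^sup>2 * ?Y)"
  proof -
    have "0 \<le> (R * \<gamma>)\<^sup>2 / \<theta> * (\<eta>\<^sup>2 * ?Y)" "0 \<le> 9 / \<theta>\<^sup>2"
      using \<theta> by (auto intro!: mult_nonneg_nonneg divide_nonneg_nonneg sum_nonneg)
    then show ?thesis by (simp add: algebra_simps)
  qed
  finally show ?thesis .
qed

lemma displacement_along_run:
  assumes run: "reduced_run \<eta> x xt d dt" and \<eta>: "0 \<le> \<eta>"
  shows "norm (x (Suc k) - x k) \<le> 2 * norm (proj_input \<eta> (x k) (xt k) (d k) - x k)"
    and "(norm (proj_input \<eta> (x k) (xt k) (d k) - x k))\<^sup>2 \<le>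
      displacement_const * ((lyapunov (x k) (xt k))\<^sup>2 + \<eta>\<^sup>2 * (norm (d k))\<^sup>2)"
proof -
  have "x (Suc k) \<in> nearest_stack M (proj_input \<eta> (x k) (xt k) (d k))"
    using run by (simp add: reduced_run_def)
  then show "norm (x (Suc k) - x k) \<le> 2 * norm (proj_input \<eta> (x k) (xt k) (d k) - x k)"
    by (rule nearest_stack_le(3)[OF _ run_in_stack_pow[OF run]])
  show "(norm (proj_input \<eta> (x k) (xt k) (d k) - x k))\<^sup>2 \<le>
      displacement_const * ((lyapunov (x k) (xt k))\<^sup>2 + \<eta>\<^sup>2 * (norm (d k))\<^sup>2)"
    by (rule displacement_square_le[OF run_in_stack_pow[OF run] \<eta>])
qed

definition tracking_const :: real where
  "tracking_const = (real CARD('n) * B)\<^sup>2 / \<theta> + 36 * G\<^sup>2 * displacement_const / \<theta>\<^sup>2 + real CARD('n)"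

text \<open>A tracker splits into its mean, which is the mean gradient, and its deviation from it, which is
  driven by the displacements.\<close>

lemma sum_trackers_le:
  assumes run: "reduced_run \<eta> x xt d dt" and \<eta>: "0 \<le> \<eta>"
  shows "(\<Sum>k<N. (norm (d k))\<^sup>2) \<le> tracking_const *
    (1 + (\<Sum>k<N. (lyapunov (x k) (xt k))\<^sup>2) + \<eta>\<^sup>2 * (\<Sum>k<N. (norm (d k))\<^sup>2)
       + (\<Sum>k<N. (norm (mean (rgrad_stack M f (x k))))\<^sup>2))"
proof -
  let ?n = "real CARD('n)" and ?T = "\<lambda>k. lyapunov (d k) (dt k)"
  let ?h = "\<lambda>k. norm (rgrad_stack M f (x (Suc k)) - rgrad_stack M f (x k))"
  define X where "X = (\<Sum>k<N. (lyapunov (x k) (xt k))\<^sup>2)"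
  define Y where "Y = (\<Sum>k<N. (norm (d k))\<^sup>2)"
  define Z where "Z = (\<Sum>k<N. (norm (mean (rgrad_stack M f (x k))))\<^sup>2)"
  have nn: "0 \<le> X" "0 \<le> Y" "0 \<le> Z"
    by (auto simp: X_def Y_def Z_def intro: sum_nonneg)
  have h: "(?h k)\<^sup>2 \<le> 4 * G\<^sup>2 * displacement_const * ((lyapunov (x k) (xt k))\<^sup>2 + \<eta>\<^sup>2 * (norm (d k))\<^sup>2)" for k
  proof -
    let ?w = "norm (proj_input \<eta> (x k) (xt k) (d k) - x k)"
    have "?h k \<le> G * norm (x (Suc k) - x k)"
      by (intro norm_rgrad_stack_diff_le run_in_stack_pow[OF run])
    also have "\<dots> \<le> G * (2 * ?w)"
      using displacement_along_run(1)[OF run \<eta>] const_nonneg by (intro mult_left_mono) auto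
    finally have "(?h k)\<^sup>2 \<le> (G * (2 * ?w))\<^sup>2"
      by (intro power_mono) auto
    also have "\<dots> = 4 * G\<^sup>2 * ?w\<^sup>2"
      by (simp add: power_mult_distrib)
    also have "\<dots> \<le> 4 * G\<^sup>2 * (displacement_const * ((lyapunov (x k) (xt k))\<^sup>2 + \<eta>\<^sup>2 * (norm (d k))\<^sup>2))"
      using displacement_along_run(2)[OF run \<eta>] by (intro mult_left_mono) auto
    finally show ?thesis by (simp add: mult_ac)
  qed
  have "(\<Sum>k<N. (?h k)\<^sup>2) \<le> (\<Sum>k<N. 4 * G\<^sup>2 * displacement_const * ((lyapunov (x k) (xt k))\<^sup>2 + \<eta>\<^sup>2 * (norm (d k))\<^sup>2))"
    by (intro sum_mono h)
  also have "\<dots> = 4 * G\<^sup>2 * displacement_const * (X + \<eta>\<^sup>2 * Y)"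
    by (simp add: X_def Y_def sum.distrib flip: sum_distrib_left)
  finally have sum_h: "(\<Sum>k<N. (?h k)\<^sup>2) \<le> 4 * G\<^sup>2 * displacement_const * (X + \<eta>\<^sup>2 * Y)" .
  have "\<theta> * (\<Sum>k<N. (?T k)\<^sup>2) \<le> (?T 0)\<^sup>2 + 9 / \<theta> * (\<Sum>k<N. (?h k)\<^sup>2)"
    by (intro perturbed_contraction_sum \<theta> lyapunov_bounds(1) tracking_contraction[OF run]) auto
  also have "\<dots> \<le> (?n * B)\<^sup>2 + 9 / \<theta> * (4 * G\<^sup>2 * displacement_const * (X + \<eta>\<^sup>2 * Y))"
  proof (intro add_mono power_mono mult_left_mono sum_h)
    have "?T 0 = norm (center (rgrad_stack M f (x 0)))"
      using run by (simp add: reduced_run_def lyapunov_bounds)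
    then show "?T 0 \<le> ?n * B"
      using norm_rgrad_stack_le[OF run_in_stack_pow[OF run]] norm_center_le_norm order_trans by metis
  qed (use \<theta> lyapunov_bounds in auto)
  finally have T: "(\<Sum>k<N. (?T k)\<^sup>2) \<le> (?n * B)\<^sup>2 / \<theta> + 36 * G\<^sup>2 * displacement_const / \<theta>\<^sup>2 * (X + \<eta>\<^sup>2 * Y)"
    using \<theta> by (simp add: field_simps power2_eq_square)
  have "(norm (d k))\<^sup>2 \<le> (?T k)\<^sup>2 + ?n * (norm (mean (rgrad_stack M f (x k))))\<^sup>2" for k
    unfolding norm_power2_mean[of "d k"] mean_tracker[OF run]
    by (intro add_right_mono power_mono lyapunov_bounds) auto
  then have "Y \<le> (\<Sum>k<N. (?T k)\<^sup>2 + ?n * (norm (mean (rgrad_stack M f (x k))))\<^sup>2)"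
    unfolding Y_def by (rule sum_mono)
  also have "\<dots> = (\<Sum>k<N. (?T k)\<^sup>2) + ?n * Z"
    by (simp add: Z_def sum.distrib sum_distrib_left)
  finally have Y: "Y \<le> (?n * B)\<^sup>2 / \<theta> * 1 + 36 * G\<^sup>2 * displacement_const / \<theta>\<^sup>2 * (X + \<eta>\<^sup>2 * Y) + ?n * Z"
    using T by simp
  also have "\<dots> \<le> tracking_const * (1 + X + \<eta>\<^sup>2 * Y + Z)"
  proof -
    define t where "t = 1 + X + \<eta>\<^sup>2 * Y + Z"
    have "0 \<le> \<eta>\<^sup>2 * Y"
      using nn by simp
    then have t: "1 \<le> t" "X + \<eta>\<^sup>2 * Y \<le> t" "Z \<le> t"
      using nn by (auto simp: t_def)
    show ?thesis
      unfolding tracking_const_def distrib_right t_def[symmetric]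
      by (rule add_mono[OF add_mono]; rule mult_left_mono[OF t(1)] mult_left_mono[OF t(2)] mult_left_mono[OF t(3)])
        (use \<theta> displacement_const_nonneg in auto)
  qed
  finally show ?thesis
    by (simp add: X_def Y_def Z_def)
qed

text \<open>Telescoping the descent of the common objective at the points nearest to the means.\<close>

lemma sum_gradients_le:
  assumes osc: "\<And>p p'. p \<in> M \<Longrightarrow> p' \<in> M \<Longrightarrow> objective f (\<chi> i. p) - objective f (\<chi> i. p') \<le> \<omega>"
    and run: "reduced_run \<eta> x xt d dt"
    and \<eta>: "0 < \<eta>" "\<eta> \<le> 1" "3 * (\<eta> * tracker_bound) \<le> \<theta> * (R * \<gamma>)"
  shows "\<eta> / 2 * (\<Sum>k<N. (norm (mean (rgrad_stack M f (x k))))\<^sup>2) \<le> \<omega> +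
    descent_const * (3 + displacement_const + 9 / \<theta>) *
      ((\<Sum>k<N. (lyapunov (x k) (xt k))\<^sup>2) + \<eta>\<^sup>2 * (\<Sum>k<N. (norm (d k))\<^sup>2))"
proof -
  let ?E = "\<lambda>k. lyapunov (x k) (xt k)" and ?g = "\<lambda>k. (norm (mean (rgrad_stack M f (x k))))\<^sup>2"
  let ?D = "descent_const * (3 + displacement_const + 9 / \<theta>)"
  have "\<forall>k. \<exists>p. p \<in> nearest M (mean (x k))"
    using ex_nearest[OF compact nonempty] by blast
  then obtain p where p: "\<And>k. p k \<in> nearest M (mean (x k))"
    by metis
  have dc: "0 \<le> descent_const"
    using const_nonneg \<kappa>_pos by (simp add: descent_const_def)
  have step: "objective f (\<chi> i. p (Suc k)) \<le> objective f (\<chi> i. p k) - \<eta> / 2 * ?g k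
      + ?D * ((?E k)\<^sup>2 + \<eta>\<^sup>2 * (norm (d k))\<^sup>2)" for k
  proof -
    let ?z = "proj_input \<eta> (x k) (xt k) (d k)" and ?q = "\<eta>\<^sup>2 * (norm (d k))\<^sup>2"
    have x': "x (Suc k) \<in> nearest_stack M ?z"
      using run by (simp add: reduced_run_def)
    have "mean ?z = mean (x k) - \<eta> *\<^sub>R mean (proj_tan_stack M (x k) (d k))"
      using gossip_step(3)[OF gap \<gamma>_pos \<gamma>_le_1, of "x k" "xt k"] by (simp add: mean_diff mean_scaleR)
    from descent_step[OF run_in_stack_pow[OF run] x' p p \<eta>(1,2) this mean_tracker[OF run]]
    have "objective f (\<chi> i. p (Suc k)) \<le> objective f (\<chi> i. p k) - \<eta> / 2 * ?g k
      + descent_const * ((norm (center (x k)))\<^sup>2 + (norm (center (x (Suc k))))\<^sup>2 + (norm (?z - x k))\<^sup>2 + ?q)" .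
    also have "(norm (center (x k)))\<^sup>2 + (norm (center (x (Suc k))))\<^sup>2 + (norm (?z - x k))\<^sup>2 + ?q
      \<le> (3 + displacement_const + 9 / \<theta>) * ((?E k)\<^sup>2 + ?q)"
    proof -
      have "(norm (center (x k)))\<^sup>2 \<le> (?E k)\<^sup>2" "(norm (center (x (Suc k))))\<^sup>2 \<le> (?E (Suc k))\<^sup>2"
        by (intro power_mono lyapunov_bounds; simp)+
      moreover have "(?E (Suc k))\<^sup>2 \<le> (?E k)\<^sup>2 + 9 / \<theta> * ?q"
      proof -
        have "(?E (Suc k))\<^sup>2 \<le> (1 - \<theta>) * (?E k)\<^sup>2 + 9 / \<theta> * (\<eta> * norm (d k))\<^sup>2"
          using \<eta> by (intro perturbed_contraction_square \<theta> lyapunov_bounds(1) consensus_along_run(2)[OF run]) auto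
        also have "(1 - \<theta>) * (?E k)\<^sup>2 \<le> 1 * (?E k)\<^sup>2"
          using \<theta> by (intro mult_right_mono) auto
        finally show ?thesis by (simp add: power_mult_distrib)
      qed
      moreover have "(norm (?z - x k))\<^sup>2 \<le> displacement_const * ((?E k)\<^sup>2 + ?q)"
        using displacement_along_run(2)[OF run] \<eta>(1) by simp
      moreover have "0 \<le> 9 / \<theta> * (?E k)\<^sup>2" "0 \<le> (?E k)\<^sup>2" "0 \<le> ?q"
        using \<theta> by auto
      ultimately show ?thesis
        by (simp only: distrib_left distrib_right)
    qed
    finally show ?thesis
      using dc by (simp add: mult_left_mono mult.assoc)
  qed
  have "\<eta> / 2 * (\<Sum>k<N. ?g k) + objective f (\<chi> i. p N) \<le> objective f (\<chi> i. p 0)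
      + ?D * ((\<Sum>k<N. (?E k)\<^sup>2) + \<eta>\<^sup>2 * (\<Sum>k<N. (norm (d k))\<^sup>2))"
  proof (induction N)
    case (Suc N)
    then show ?case
      using step[of N] by (simp add: distrib_left)
  qed simp
  moreover have "objective f (\<chi> i. p 0) - objective f (\<chi> i. p N) \<le> \<omega>"
    by (rule osc[OF nearestD(1)[OF p] nearestD(1)[OF p]])
  ultimately show ?thesis by linarith
qed

lemma gradients_square_summable:
  "\<exists>\<eta>0>0. \<forall>\<eta>. 0 < \<eta> \<and> \<eta> < \<eta>0 \<longrightarrow> (\<exists>Z. \<forall>x xt d dt N. reduced_run \<eta> x xt d dt \<longrightarrow>
     (\<Sum>k<N. (norm (mean (rgrad_stack M f (x k))))\<^sup>2) \<le> Z)"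
proof -
  obtain \<omega> where \<omega>: "0 \<le> \<omega>"
    "\<And>p p'. p \<in> M \<Longrightarrow> p' \<in> M \<Longrightarrow> objective f (\<chi> i. p) - objective f (\<chi> i. p') \<le> \<omega>"
    by (rule objective_oscillation) blast
  define k1 where "k1 = (R * \<gamma>)\<^sup>2 / \<theta> + 9 / \<theta>\<^sup>2"
  define k3 where "k3 = descent_const * (3 + displacement_const + 9 / \<theta>)"
  define K where "K = 1 + k1 + tracking_const + 2 * (\<omega> + k3)"
  have nn: "0 \<le> k1" "0 \<le> tracking_const" "0 \<le> k3"
    using \<theta> const_nonneg \<kappa>_pos displacement_const_nonneg
    by (auto simp: k1_def tracking_const_def k3_def descent_const_def intro!: add_nonneg_nonneg mult_nonneg_nonneg)
  have K: "1 \<le> K" "k1 \<le> K" "tracking_const \<le> K" "2 * (\<omega> + k3) \<le> K"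
    using nn \<omega>(1) by (auto simp: K_def)
  have tb: "0 \<le> tracker_bound"
    using \<theta> const_nonneg by (simp add: tracker_bound_def)
  \<comment> \<open>The first bound closes the loop of the three sums, the second keeps every run in the region of
    consensus.\<close>
  define \<eta>0 where "\<eta>0 = min (1 / (8 * K ^ 3)) (\<theta> * (R * \<gamma>) / (3 * tracker_bound + 1))"
  have "0 < \<eta>0"
    using K(1) \<theta> R_pos \<gamma>_pos tb by (simp add: \<eta>0_def)
  moreover have "\<exists>Z. \<forall>x xt d dt N. reduced_run \<eta> x xt d dt \<longrightarrow>
     (\<Sum>k<N. (norm (mean (rgrad_stack M f (x k))))\<^sup>2) \<le> Z" if \<eta>: "0 < \<eta>" "\<eta> < \<eta>0" for \<eta>
  proof (intro exI allI impI)
    fix x xt d dt N assume run: "reduced_run \<eta> x xt d dt"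
    let ?X = "\<Sum>k<N. (lyapunov (x k) (xt k))\<^sup>2" and ?Y = "\<Sum>k<N. (norm (d k))\<^sup>2"
      and ?Z = "\<Sum>k<N. (norm (mean (rgrad_stack M f (x k))))\<^sup>2"
    have X0: "0 \<le> ?X" and Y0: "0 \<le> \<eta>\<^sup>2 * ?Y" and Z0: "0 \<le> ?Z"
      by (auto intro!: sum_nonneg mult_nonneg_nonneg)
    have e8: "8 * K ^ 3 * \<eta> \<le> 1"
      using \<eta> K(1) by (simp add: \<eta>0_def field_simps)
    have "1 \<le> K ^ 3"
      using K(1) by (rule one_le_power)
    then have "1 * \<eta> \<le> 8 * K ^ 3 * \<eta>"
      using \<eta>(1) by (intro mult_right_mono) auto
    with e8 have e1: "\<eta> \<le> 1" by linarith
    have "\<eta> * (3 * tracker_bound + 1) < \<theta> * (R * \<gamma>)"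
      using \<eta>(2) tb by (simp add: \<eta>0_def pos_less_divide_eq)
    then have e3: "3 * (\<eta> * tracker_bound) \<le> \<theta> * (R * \<gamma>)"
      using \<eta>(1) by (simp add: algebra_simps)
    have e0: "0 \<le> \<eta>" using \<eta>(1) by simp
    show "?Z \<le> 4 * K\<^sup>2 / \<eta>"
    proof (rule small_gain[OF K(1) \<eta>(1) e1 e8])
      show "0 \<le> ?Y" by (intro sum_nonneg) auto
      have "?X \<le> k1 * (1 + \<eta>\<^sup>2 * ?Y)"
        unfolding k1_def by (rule sum_consensus_le[OF run e0 e3])
      also have "\<dots> \<le> K * (1 + \<eta>\<^sup>2 * ?Y)"
        using K(2) Y0 by (intro mult_right_mono) auto
      finally show "?X \<le> K * (1 + \<eta>\<^sup>2 * ?Y)" .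
      have "?Y \<le> tracking_const * (1 + ?X + \<eta>\<^sup>2 * ?Y + ?Z)"
        by (rule sum_trackers_le[OF run e0])
      also have "\<dots> \<le> K * (1 + ?X + \<eta>\<^sup>2 * ?Y + ?Z)"
        using K(3) X0 Y0 Z0 by (intro mult_right_mono add_nonneg_nonneg) auto
      finally show "?Y \<le> K * (1 + ?X + \<eta>\<^sup>2 * ?Y + ?Z)" .
      have "\<eta> / 2 * ?Z \<le> \<omega> + k3 * (?X + \<eta>\<^sup>2 * ?Y)"
        unfolding k3_def by (rule sum_gradients_le[OF \<omega>(2) run \<eta>(1) e1 e3])
      also have "\<dots> \<le> (\<omega> + k3) * (1 + ?X + \<eta>\<^sup>2 * ?Y)"
        using mult_nonneg_nonneg[OF \<omega>(1) X0] mult_nonneg_nonneg[OF \<omega>(1) Y0] nn(3)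
        by (simp add: algebra_simps)
      finally have "\<eta> * ?Z \<le> 2 * ((\<omega> + k3) * (1 + ?X + \<eta>\<^sup>2 * ?Y))"
        by simp
      also have "\<dots> = 2 * (\<omega> + k3) * (1 + ?X + \<eta>\<^sup>2 * ?Y)"
        by (simp only: mult.assoc)
      also have "\<dots> \<le> K * (1 + ?X + \<eta>\<^sup>2 * ?Y)"
        using K(4) X0 Y0 by (intro mult_right_mono) auto
      finally show "\<eta> * ?Z \<le> K * (1 + ?X + \<eta>\<^sup>2 * ?Y)" .
    qed
  qed
  ultimately show ?thesis by blast
qed

lemma reduced_runI:
  assumes run: "dprgc_run M R W f C \<gamma> \<eta> \<delta> x xt s q d dt u p"
    and \<sigma>: "0 \<le> second_singular_value W"
  shows "reduced_run \<eta> x xt d dt"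
proof -
  have mono: "R * \<gamma> * (1 - second_singular_value W) \<le> R * \<gamma>"
    using \<sigma> R_pos \<gamma>_pos by (intro mult_left_le) auto
  have init: "\<delta> < R * \<gamma> * (1 - second_singular_value W)" "x 0 \<in> consensus_nbhd M \<delta>"
    "xt 0 = x 0" "s 0 = mix W (x 0)" "d 0 = rgrad_stack M f (x 0)" "dt 0 = d 0" "u 0 = mix W (d 0)"
    using run unfolding dprgc_run_def by auto
  have step: "x (Suc k) \<in> nearest_stack M (x k + \<gamma> *\<^sub>R (s k - xt k) - \<eta> *\<^sub>R proj_tan_stack M (x k) (d k))"
    "q (Suc k) = C (x (Suc k) - xt k)" "xt (Suc k) = xt k + q (Suc k)" "s (Suc k) = s k + mix W (q (Suc k))"
    "d (Suc k) = d k + \<gamma> *\<^sub>R (u k - dt k) + rgrad_stack M f (x (Suc k)) - rgrad_stack M f (x k)"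
    "p (Suc k) = C (d (Suc k) - dt k)" "dt (Suc k) = dt k + p (Suc k)" "u (Suc k) = u k + mix W (p (Suc k))" for k
    using run unfolding dprgc_run_def by blast+
  have s: "s k = mix W (xt k)" for k
    by (induction k) (simp_all add: init step mix_add)
  have u: "u k = mix W (dt k)" for k
    by (induction k) (simp_all add: init step mix_add)
  obtain xbar where "x 0 \<in> stack_pow M" "norm (x 0 - (\<chi> i. xbar)) \<le> \<delta>"
    using init(2) by (auto simp: consensus_nbhd_def)
  moreover from this have "norm (center (x 0)) \<le> R * \<gamma>"
    using norm_center_le[of "x 0" xbar] init(1) mono by linarith
  ultimately show ?thesis
    unfolding reduced_run_def using init step s u by (auto simp: add_diff_eq)
qed

end

section \<open>The convergence theorem\<close>

lemma proximally_smooth_nonempty: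
  assumes "proximally_smooth R M"
  shows "M \<noteq> {}"
proof
  assume "M = {}"
  then have "is_singleton (nearest ({} :: 'a set) 0)"
    using assms by (simp add: proximally_smooth_def infdist_def)
  then show False
    by (simp add: nearest_def is_arg_min_def is_singleton_def)
qed

lemma objective_ge_INF:
  assumes M: "compact M" and f: "\<And>i x. f i differentiable (at x)" and x: "x \<in> stack_pow M"
  shows "(INF y\<in>stack_pow M. objective f y) \<le> objective f x"
proof -
  have "\<exists>b. \<forall>y\<in>M. b \<le> f i y" for i
  proof -
    have "continuous_on M (f i)"
      using f by (intro differentiable_imp_continuous_on differentiable_at_imp_differentiable_on)
    then have "bounded (f i ` M)"
      using M by (intro compact_imp_bounded compact_continuous_image)
    then show ?thesis
      using bounded_imp_bdd_below by (fastforce simp: bdd_below_def)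
  qed
  then obtain b where b: "\<And>i y. y \<in> M \<Longrightarrow> b i \<le> f i y"
    by metis
  have "bdd_below (objective f ` stack_pow M)"
    unfolding objective_def
    by (rule bdd_belowI2[where m = "1 / real CARD('c) * (\<Sum>i\<in>UNIV. b i)"])
      (auto simp: stack_pow_def intro!: divide_right_mono sum_mono b)
  then show ?thesis
    using x by (rule cINF_lower)
qed

theorem theorem4p6:
  fixes M :: "(real^'r^'d) set" and m :: nat and R LP Lf Lg L \<rho> \<alpha> :: real
    and W :: "real^'n^'n"
    and f :: "'n \<Rightarrow> real^'r^'d \<Rightarrow> real"
    and C :: "(real^'r^'d)^'n \<Rightarrow> (real^'r^'d)^'n"
  assumes manifold: "compact M" "embedded_submanifold m M" "proximally_smooth R M"
    and mixing: "mixing_matrix W"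
    and smooth: "\<And>i x. f i differentiable (at x)"
      "\<And>i x y. norm (gradient (f i) x - gradient (f i) y) \<le> Lf * norm (x - y)"
    and Lg: "Lg = (MAX i. SUP x\<in>M. norm (gradient (f i) x))"
    and LP: "proj_tan_lipschitz LP M"
    and L: "L = max (Lf + 1 / R * Lg) (Lf + Lg * LP)" "L > 0"
    and compression: "compressor \<alpha> C"
    and rho: "\<rho> = 1 - second_singular_value W"
  shows "\<exists>C\<gamma>\<^sub>0>0. \<forall>C\<gamma>. 0 < C\<gamma> \<and> C\<gamma> < C\<gamma>\<^sub>0 \<longrightarrow>
    (\<exists>C\<eta>\<^sub>0>0. \<forall>C\<eta>. 0 < C\<eta> \<and> C\<eta> < C\<eta>\<^sub>0 \<longrightarrow>
      (\<exists>c M'. 0 < c \<and> c < 1 \<and> 0 < M' \<and>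
        (\<forall>\<gamma> \<eta> \<delta> x xt s q d dt u p.
          \<gamma> = C\<gamma> * \<alpha> \<longrightarrow> \<eta> = C\<eta> * \<gamma> * \<rho> / L \<longrightarrow>
          dprgc_run M R W f C \<gamma> \<eta> \<delta> x xt s q d dt u p \<longrightarrow>
          (\<forall>K\<ge>(1::nat).
            1 / real K * (\<Sum>k=1..K. (norm (mean (rgrad_stack M f (x k))))\<^sup>2)
              \<le> (objective f (x 0) - (INF y\<in>stack_pow M. objective f y) + M') / (c * real K)))))"
proof -
  have R: "0 < R" and \<alpha>: "0 < \<alpha>"
    using manifold(3) compression by (auto simp: proximally_smooth_def compressor_def)
  have \<sigma>: "0 \<le> second_singular_value W" and \<rho>: "0 < \<rho>"
    using mixing rho by (auto simp: mixing_matrix_def)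
  obtain r where r: "mixing_gap r W"
    by (rule ex_mixing_gap[OF mixing])
  then have r0: "0 < r"
    by (simp add: mixing_gap_def)
  obtain \<kappa> B G S where obj: "riemannian_objectives M f \<kappa> LP B G S"
    by (rule riemannian_objectives_exist[OF manifold(1,2) proximally_smooth_nonempty[OF manifold(3)] smooth LP])
  have \<kappa>: "0 < \<kappa>"
    using riemannian_objectives.prox[OF obj] by (simp add: proximal_normals_def)
  define A where "A = \<kappa> * (35 * R / r + 2 * \<kappa> * R\<^sup>2)"
  have A: "0 \<le> A"
    using \<kappa> R r0 by (simp add: A_def)
  \<comment> \<open>The three bounds are the smallness conditions on \<open>\<gamma>\<close>; adding one avoids a division by zero.\<close>
  define \<gamma>0 where "\<gamma>0 = min 1 (min (\<alpha> * r / 200) (r / (2 * A + 1)))"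
  have \<gamma>0: "0 < \<gamma>0"
    using \<alpha> r0 A by (simp add: \<gamma>0_def)
  show ?thesis
  proof (rule exI[of _ "\<gamma>0 / \<alpha>"], intro conjI allI impI)
    show "0 < \<gamma>0 / \<alpha>"
      using \<gamma>0 \<alpha> by simp
    fix C\<gamma> :: real
    assume C\<gamma>: "0 < C\<gamma> \<and> C\<gamma> < \<gamma>0 / \<alpha>"
    define \<gamma> where "\<gamma> = C\<gamma> * \<alpha>"
    have \<gamma>: "0 < \<gamma>" "\<gamma> < \<gamma>0"
      using C\<gamma> \<alpha> by (auto simp: \<gamma>_def field_simps)
    interpret dprgc_parameters M f \<kappa> LP B G S W C R r \<alpha> \<gamma>
    proof (intro dprgc_parameters.intro obj dprgc_parameters_axioms.intro r compression R \<gamma>(1))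
      show "\<gamma> \<le> 1" "200 * \<gamma> \<le> \<alpha> * r"
        using \<gamma> by (auto simp: \<gamma>0_def)
      have "\<gamma> * (2 * A + 1) < r"
        using \<gamma>(2) A by (simp add: \<gamma>0_def pos_less_divide_eq)
      then show "2 * \<gamma> * (\<kappa> * (35 * R / r + 2 * \<kappa> * R\<^sup>2)) \<le> r"
        using \<gamma>(1) unfolding A_def[symmetric] by (simp add: algebra_simps)
    qed
    obtain \<eta>0 where \<eta>0: "0 < \<eta>0" "\<And>\<eta>. 0 < \<eta> \<Longrightarrow> \<eta> < \<eta>0 \<Longrightarrow> \<exists>Z. \<forall>x xt d dt N. reduced_run \<eta> x xt d dt \<longrightarrow>
        (\<Sum>k<N. (norm (mean (rgrad_stack M f (x k))))\<^sup>2) \<le> Z"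
      using gradients_square_summable by blast
    show "\<exists>C\<eta>\<^sub>0>0. \<forall>C\<eta>. 0 < C\<eta> \<and> C\<eta> < C\<eta>\<^sub>0 \<longrightarrow>
      (\<exists>c M'. 0 < c \<and> c < 1 \<and> 0 < M' \<and>
        (\<forall>\<gamma> \<eta> \<delta> x xt s q d dt u p.
          \<gamma> = C\<gamma> * \<alpha> \<longrightarrow> \<eta> = C\<eta> * \<gamma> * \<rho> / L \<longrightarrow>
          dprgc_run M R W f C \<gamma> \<eta> \<delta> x xt s q d dt u p \<longrightarrow>
          (\<forall>K\<ge>(1::nat).
            1 / real K * (\<Sum>k=1..K. (norm (mean (rgrad_stack M f (x k))))\<^sup>2)
              \<le> (objective f (x 0) - (INF y\<in>stack_pow M. objective f y) + M') / (c * real K))))"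
    proof (rule exI[of _ "\<eta>0 * L / (\<gamma> * \<rho>)"], intro conjI allI impI)
      show "0 < \<eta>0 * L / (\<gamma> * \<rho>)"
        using \<eta>0(1) L(2) \<gamma>(1) \<rho> by simp
      fix C\<eta> :: real
      assume C\<eta>: "0 < C\<eta> \<and> C\<eta> < \<eta>0 * L / (\<gamma> * \<rho>)"
      define \<eta> where "\<eta> = C\<eta> * \<gamma> * \<rho> / L"
      have "0 < \<eta>" "\<eta> < \<eta>0"
        using C\<eta> L(2) \<gamma>(1) \<rho> by (auto simp: \<eta>_def field_simps)
      then obtain Z where Z: "\<And>x xt d dt N. reduced_run \<eta> x xt d dt \<Longrightarrow>
          (\<Sum>k<N. (norm (mean (rgrad_stack M f (x k))))\<^sup>2) \<le> Z"
        using \<eta>0(2) by blast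
      \<comment> \<open>The whole sum is bounded, so \<open>c\<close> is arbitrary and \<open>M'\<close> alone carries the estimate.\<close>
      show "\<exists>c M'. 0 < c \<and> c < 1 \<and> 0 < M' \<and>
        (\<forall>\<gamma> \<eta> \<delta> x xt s q d dt u p.
          \<gamma> = C\<gamma> * \<alpha> \<longrightarrow> \<eta> = C\<eta> * \<gamma> * \<rho> / L \<longrightarrow>
          dprgc_run M R W f C \<gamma> \<eta> \<delta> x xt s q d dt u p \<longrightarrow>
          (\<forall>K\<ge>(1::nat).
            1 / real K * (\<Sum>k=1..K. (norm (mean (rgrad_stack M f (x k))))\<^sup>2)
              \<le> (objective f (x 0) - (INF y\<in>stack_pow M. objective f y) + M') / (c * real K)))"
      proof (rule exI[of _ "1 / 2"], rule exI[of _ "\<bar>Z\<bar> + 1"], intro conjI allI impI)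
        fix \<gamma>' \<eta>' \<delta> x xt s q d dt u p and K :: nat
        assume "\<gamma>' = C\<gamma> * \<alpha>" "\<eta>' = C\<eta> * \<gamma>' * \<rho> / L"
          and "dprgc_run M R W f C \<gamma>' \<eta>' \<delta> x xt s q d dt u p" and K: "1 \<le> K"
        then have "dprgc_run M R W f C \<gamma> \<eta> \<delta> x xt s q d dt u p"
          by (simp add: \<gamma>_def \<eta>_def)
        then have run: "reduced_run \<eta> x xt d dt"
          using \<sigma> by (rule reduced_runI)
        let ?g = "\<lambda>k. (norm (mean (rgrad_stack M f (x k))))\<^sup>2"
        let ?gap = "objective f (x 0) - (INF y\<in>stack_pow M. objective f y)"
        have "0 \<le> ?gap"
          using objective_ge_INF[OF manifold(1) smooth(1) run_in_stack_pow[OF run]] by simp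
        have "(\<Sum>k=1..K. ?g k) \<le> (\<Sum>k<Suc K. ?g k)"
          by (rule sum_mono2) auto
        also have "\<dots> \<le> Z"
          by (rule Z[OF run])
        also have "\<dots> \<le> 2 * (?gap + (\<bar>Z\<bar> + 1))"
          using \<open>0 \<le> ?gap\<close> by (cases "0 \<le> Z") auto
        finally show "1 / real K * (\<Sum>k=1..K. ?g k) \<le> (?gap + (\<bar>Z\<bar> + 1)) / (1 / 2 * real K)"
          using K by (simp add: field_simps)
      qed auto
    qed
  qed
qed

end
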